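(* Let $\{q_n\}_{n\ge1}$ be a strictly increasing sequence of prime numbers with $q_1\ge 7$ and $q_n=O(n^d)$ for some integer $d\ge 1$. Let $\ell_n=n^d$ for $n\ge1$, $N_0=1$, $N_r=q_1^{\ell_1}\cdots q_r^{\ell_r}$ for $r\ge1$, $L_0=0$ and $L_s=\sum_{i=1}^s\ell_i$ for $s\ge 1$. Let $\{\omega_n\}_{n\ge1}$ be real weights satisfying $$0<\inf_{n\in\mathbb N}\omega_n\le\sup_{n\in\mathbb N}\omega_n<1 .$$ Then the Cantor-Moran measure $$\mu=\mathop{\ast}_{s=0}^{\infty}\ \mathop{\ast}_{j=0}^{\ell_{s+1}-1}\Big(\omega_n\delta_0+(1-\omega_n)\delta_{N_s^{-1}q_{s+1}^{-(j+1)}}\Big),\qquad n=L_s+j+1,$$ satisfies the $\mathsf{DEL}$ criterion for all integers $b\ge2$ and is pointwise absolutely normal. Moreover, the associated Moran set $$K=\Big\{\sum_{s=0}^\infty\sum_{j=0}^{\ell_{s+1}-1}\frac{\epsilon_{s,j}}{N_sq_{s+1}^{j+1}}:\ \epsilon_{s,j}\in\{0,1\}\text{ for all }s,j\Big\}$$ is a set of uniqueness.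
   Context: $\delta_a$ is the Dirac measure at $a$, and $\mathop{\ast}$ denotes (infinite) convolution of probability measures. The Fourier transform of a Borel probability measure $\mu$ is $\widehat\mu(\xi)=\int e^{-2\pi i\xi x}\,d\mu(x)$. $\mathsf{DEL}$ criterion: $\mu$ satisfies the $\mathsf{DEL}$ criterion for an integer $b\ge 2$ if for all non-zero integers $h$, $$\sum_{N=1}^\infty \frac1{N^3}\sum_{m=0}^{N-1}\sum_{n=0}^{N-1}\widehat\mu\big(h(b^n-b^m)\big)<\infty .$$ A real number $x$ is $b$-normal if the sequence of fractional parts $\{b^kx\}_{k\ge1}$ is equidistributed in $[0,1]$ with respect to Lebesgue measure; $x$ is absolutely normal if it is $b$-normal for every integer $b\ge2$. A Borel probability measure $\mu$ is pointwise absolutely normal if $\mu$-a.e. $x$ is absolutely normal. A set $E\subset[0,1]$ is a set of uniqueness if $\sum_{n=0}^\infty (a_n\cos(2\pi nx)+b_n\sin(2\pi nx))=0$ for all $x\in[0,1]\setminus E$ implies that $a_n=b_n=0$ for each $n$ (where for $n=0$ only $a_0$ is relevant). *)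

theory Defs
  imports "HOL-Probability.Probability" "HOL-Library.Landau_Symbols"
    "HOL-Computational_Algebra.Primes"
begin

section \<open>Measures: two-point measures, convolutions, Fourier transform\<close>

text \<open>\<open>p \<delta>\<^sub>a + (1 - p) \<delta>\<^sub>c\<close>, for \<open>0 \<le> p \<le> 1\<close>.\<close>

definition two_point_measure :: "real \<Rightarrow> real \<Rightarrow> real \<Rightarrow> real measure" where
  "two_point_measure p a c = measure_of UNIV (sets borel)
     (\<lambda>A. ennreal p * emeasure (return borel a) A + ennreal (1 - p) * emeasure (return borel c) A)"

text \<open>\<open>finite_convolution \<nu> n\<close> is \<open>\<nu> 0 \<star> \<dots> \<star> \<nu> (n - 1)\<close>; the empty convolution is \<open>\<delta>\<^sub>0\<close>.\<close>

primrec finite_convolution :: "(nat \<Rightarrow> real measure) \<Rightarrow> nat \<Rightarrow> real measure" where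
  "finite_convolution \<nu> 0 = return borel 0"
| "finite_convolution \<nu> (Suc n) = convolution (finite_convolution \<nu> n) (\<nu> n)"

text \<open>The weak limit of the finite convolutions. If no weak limit exists, nothing can be derived
  about the value, so a result about an infinite convolution has to include its existence.\<close>

definition infinite_convolution :: "(nat \<Rightarrow> real measure) \<Rightarrow> real measure" where
  "infinite_convolution \<nu> =
     (THE \<mu>. real_distribution \<mu> \<and> weak_conv_m (finite_convolution \<nu>) \<mu>)"

text \<open>The normalization differs from that of \<^const>\<open>char\<close>.\<close>

definition fourier_transform :: "real measure \<Rightarrow> real \<Rightarrow> complex" where
  "fourier_transform \<mu> \<xi> = (CLINT x|\<mu>. exp (- 2 * of_real pi * \<i> * of_real \<xi> * of_real x))"

section \<open>The DEL criterion and normality\<close>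

text \<open>The double sum over \<open>m, n\<close> is the integral of \<open>\<bar>\<Sum>n<N. exp (- 2\<pi>ih b\<^sup>n x)\<bar>\<^sup>2\<close>, hence a
  nonnegative real number, so finiteness of the series is its summability.
  The sum over \<open>N \<ge> 1\<close> is indexed by \<open>Suc N\<close>.\<close>

definition DEL_criterion :: "real measure \<Rightarrow> nat \<Rightarrow> bool" where
  "DEL_criterion \<mu> b \<longleftrightarrow> (\<forall>h::int. h \<noteq> 0 \<longrightarrow>
     summable (\<lambda>N. 1 / of_nat (Suc N) ^ 3 *
       (\<Sum>m<Suc N. \<Sum>n<Suc N.
          fourier_transform \<mu> (of_int h * (of_nat b ^ n - of_nat b ^ m)))))"

text \<open>Only the terms of index at least 1 of \<open>u\<close> are used.\<close>

definition equidistributed_01 :: "(nat \<Rightarrow> real) \<Rightarrow> bool" where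
  "equidistributed_01 u \<longleftrightarrow> (\<forall>s t. 0 \<le> s \<and> s \<le> t \<and> t \<le> 1 \<longrightarrow>
     (\<lambda>n. real (card {k \<in> {1..n}. u k \<in> {s..t}}) / real n) \<longlonglongrightarrow> measure lborel {s..t})"

definition normal_in_base :: "nat \<Rightarrow> real \<Rightarrow> bool" where
  "normal_in_base b x \<longleftrightarrow> equidistributed_01 (\<lambda>k. frac (real b ^ k * x))"

definition absolutely_normal :: "real \<Rightarrow> bool" where
  "absolutely_normal x \<longleftrightarrow> (\<forall>b\<ge>2. normal_in_base b x)"

definition pointwise_absolutely_normal :: "real measure \<Rightarrow> bool" where
  "pointwise_absolutely_normal \<mu> \<longleftrightarrow> (AE x in \<mu>. absolutely_normal x)"

section \<open>Sets of uniqueness\<close>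

definition set_of_uniqueness :: "real set \<Rightarrow> bool" where
  "set_of_uniqueness E \<longleftrightarrow> E \<subseteq> {0..1} \<and>
     (\<forall>a b :: nat \<Rightarrow> real.
        (\<forall>x \<in> {0..1} - E.
           (\<lambda>n. a n * cos (2 * pi * real n * x) + b n * sin (2 * pi * real n * x)) sums 0)
        \<longrightarrow> (\<forall>n. a n = 0) \<and> (\<forall>n\<ge>1. b n = 0))"

section \<open>The Cantor-Moran measure and the Moran set\<close>

definition ell :: "nat \<Rightarrow> nat \<Rightarrow> nat" where
  "ell d n = n ^ d"

definition block_start :: "nat \<Rightarrow> nat \<Rightarrow> nat" where
  "block_start d s = (\<Sum>i=1..s. ell d i)"

definition modulus :: "(nat \<Rightarrow> nat) \<Rightarrow> nat \<Rightarrow> nat \<Rightarrow> nat" where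
  "modulus q d r = (\<Prod>i=1..r. q i ^ ell d i)"

definition contraction :: "(nat \<Rightarrow> nat) \<Rightarrow> nat \<Rightarrow> nat \<Rightarrow> nat \<Rightarrow> real" where
  "contraction q d s j = 1 / (real (modulus q d s) * real (q (Suc s)) ^ (j + 1))"

definition cantor_moran_measure :: "(nat \<Rightarrow> nat) \<Rightarrow> nat \<Rightarrow> (nat \<Rightarrow> real) \<Rightarrow> real measure" where
  "cantor_moran_measure q d \<omega> = infinite_convolution (\<lambda>s.
     finite_convolution
       (\<lambda>j. two_point_measure (\<omega> (block_start d s + j + 1)) 0 (contraction q d s j))
       (ell d (Suc s)))"

definition moran_set :: "(nat \<Rightarrow> nat) \<Rightarrow> nat \<Rightarrow> real set" where
  "moran_set q d = {(\<Sum>s. \<Sum>j<ell d (Suc s). \<epsilon> s j * contraction q d s j) | \<epsilon>.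
     \<forall>s j. \<epsilon> s j \<in> {0, 1::real}}"

end

theory Submission
  imports Defs "HOL-Number_Theory.Number_Theory" "HOL-Real_Asymp.Real_Asymp"
begin

text \<open>\<open>DEL\<close>: the Fourier transform at \<open>\<xi>\<close> is bounded by the product over a single block \<open>s\<close>, whose \<open>j\<close>-th
  factor depends on the base-\<open>q\<^sub>s\<^sub>+\<^sub>1\<close> digits of \<open>\<xi> / N\<^sub>s\<close> and has average at most \<open>1 - \<kappa>\<close> over the digit in
  position \<open>j\<close>. At \<open>\<xi> = h (b\<^sup>k - 1) b\<^sup>m\<close>, lifting the exponent shows that along a suitable arithmetic
  progression of \<open>m\<close> all but a few digits of the block are exactly independent and uniform. The number of
  lost digits is controlled by the valuation of \<open>b\<^sup>q\<^sup>-\<^sup>1 - 1\<close>, which is small against the block length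
  since \<open>q\<^sub>n = O(n\<^sup>d)\<close>, and by that of \<open>b\<^sup>k - 1\<close>, which is small for most \<open>k\<close>. This gives averages
  decaying faster than every power of \<open>ln N\<close>.

  Normality: the criterion makes \<open>\<Sum>N. \<bar>S\<^sub>N\<bar>\<^sup>2 / N\<^sup>3\<close> finite almost everywhere for the exponential sums
  \<open>S\<^sub>N\<close>; as \<open>S\<^sub>N\<close> varies slowly, \<open>S\<^sub>N / N\<close> tends to \<open>0\<close>, and Weyl's criterion applies.

  Uniqueness: multiplication by \<open>N\<^sub>s\<close> maps the Moran set into \<open>[0, 1/6]\<close> modulo \<open>1\<close>, so it is an \<open>H\<close>-set.
  Off the set the twice integrated series is locally affine by the theorems of Riemann and Schwarz.
  Pairing it with the second derivative of \<open>e\<^bsup>-2\<pi>imx\<^esup> \<psi>(N\<^sub>s x)\<close>, for a bump \<open>\<psi>\<close> in the gap, and letting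
  \<open>s\<close> tend to infinity isolates the \<open>m\<close>-th coefficient.\<close>

section \<open>Infinite convolutions\<close>

text \<open>One block is enough because all factors of the transform have modulus at most 1, and s
  may be chosen anew for each N. It is taken with N_(s+1) \<le> N < N_(s+2): the left inequality
  leaves room for a full orbit of exponents, the right one keeps ln N polynomial in s, whereas the
  average over about a quarter of the block is exponentially small in its length, which is at least
  s + 1.

  The exponents advance in steps divisible by the totient of N_s, so that residues modulo N_s stand
  still. This must not cost digits in base q_(s+1), and it does not: the totient is built from
  primes q_i and numbers q_i - 1 with i \<le> s, all smaller than q_(s+1).

  For uniqueness no bound on the coefficients is given in advance; it comes from the Cantor-Lebesgue
  theorem on part of one gap. Among the indices congruent to m or -m modulo N_s only m itself stays
  bounded as s grows. The coefficients at the others tend to 0, and their weights are summable by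
  the quadratic Fourier decay of the bump. The number 1/6 is 1/7 + 1/49 + ..., the extreme case of
  smallest prime 7.\<close>

lemma two_point_measure_eq_distr:
  assumes "0 \<le> p" "p \<le> 1"
  shows "two_point_measure p a c = distr (measure_pmf (bernoulli_pmf p)) borel (\<lambda>b. if b then a else c)"
proof -
  let ?M = "distr (measure_pmf (bernoulli_pmf p)) borel (\<lambda>b. if b then a else c)"
  have "ennreal p * emeasure (return borel a) A + ennreal (1 - p) * emeasure (return borel c) A = emeasure ?M A"
    if "A \<in> sets borel" for A
  proof -
    have "emeasure ?M A = (\<integral>\<^sup>+b. indicator A (if b then a else c) \<partial>measure_pmf (bernoulli_pmf p))"
      using that
      by (subst nn_integral_indicator[symmetric], simp, subst nn_integral_distr) auto
    also have "\<dots> = ennreal p * indicator A a + ennreal (1 - p) * indicator A c"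
      using assms by (simp add: nn_integral_bernoulli_pmf mult.commute)
    finally show ?thesis
      using that by (simp add: mult.commute)
  qed
  \<comment> \<open>Countable additivity is not visible from the \<open>measure_of\<close>
    definition; it is inherited from the image of a Bernoulli measure with the same values on Borel
    sets.\<close>
  then have "two_point_measure p a c = measure_of UNIV (sets borel) (emeasure ?M)"
    unfolding two_point_measure_def
    using sets.sigma_sets_eq[of "borel :: real measure"] by (intro measure_of_eq) (simp_all del: emeasure_return)
  also have "\<dots> = ?M"
    using measure_of_of_measure[of ?M] by simp
  finally show ?thesis .
qed

lemma real_distribution_two_point:
  assumes "0 \<le> p" "p \<le> 1"
  shows "real_distribution (two_point_measure p a c)"
proof -
  interpret prob_space "distr (measure_pmf (bernoulli_pmf p)) borel (\<lambda>b. if b then a else c)"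
    by (intro measure_pmf.prob_space_distr) auto
  show ?thesis
    by (simp add: two_point_measure_eq_distr[OF assms] real_distribution_def real_distribution_axioms_def prob_space_axioms)
qed

lemma char_two_point:
  assumes "0 \<le> p" "p \<le> 1"
  shows "char (two_point_measure p a c) t = p * iexp (t * a) + (1 - p) * iexp (t * c)"
proof -
  have "char (two_point_measure p a c) t = (CLINT b|measure_pmf (bernoulli_pmf p). iexp (t * (if b then a else c)))"
    unfolding char_def two_point_measure_eq_distr[OF assms]
    by (subst integral_distr) auto
  also have "\<dots> = p * iexp (t * a) + (1 - p) * iexp (t * c)"
    using assms by (subst integral_measure_pmf[of UNIV]) (auto simp: UNIV_bool scaleR_conv_of_real)
  finally show ?thesis by simp
qed

lemma AE_two_point:
  assumes "0 \<le> p" "p \<le> 1" "0 \<le> c"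
  shows "AE x in two_point_measure p 0 c. 0 \<le> x \<and> x \<le> c"
  unfolding two_point_measure_eq_distr[OF assms(1,2)]
  using assms by (subst AE_distr_iff) (auto simp: AE_measure_pmf_iff)

lemma real_distribution_convolution:
  assumes "real_distribution M" "real_distribution N"
  shows "real_distribution (M \<star> N)"
proof -
  interpret M: real_distribution M by fact
  interpret N: real_distribution N by fact
  interpret pair_prob_space M N ..
  have [measurable_cong]: "sets M = sets borel" "sets N = sets borel" by simp_all
  have "prob_space (M \<star> N)"
    unfolding convolution_def by (intro prob_space_distr) measurable
  then show ?thesis
    by (auto simp: real_distribution_def real_distribution_axioms_def)
qed

lemma char_convolution:
  assumes "real_distribution M" "real_distribution N"
  shows "char (M \<star> N) t = char M t * char N t"
proof -
  interpret M: real_distribution M by fact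
  interpret N: real_distribution N by fact
  interpret pair_prob_space M N ..
  have [measurable_cong]: "sets M = sets borel" "sets N = sets borel" by simp_all
  have int: "integrable (M \<Otimes>\<^sub>M N) (\<lambda>z. iexp (t * (fst z + snd z)))"
    by (intro integrable_const_bound[of _ 1]) auto
  have "char (M \<star> N) t = (CLINT z|M \<Otimes>\<^sub>M N. iexp (t * (fst z + snd z)))"
    unfolding char_def convolution_def
    by (subst integral_distr) (auto simp: case_prod_beta)
  also have "\<dots> = (CLINT x|M. CLINT y|N. iexp (t * (x + y)))"
    using integral_fst'[OF int] by simp
  also have "\<dots> = (CLINT x|M. iexp (t * x) * (CLINT y|N. iexp (t * y)))"
    by (simp add: algebra_simps exp_add)
  finally show ?thesis
    by (simp add: char_def)
qed

lemma AE_convolution: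
  assumes "real_distribution M" "real_distribution N"
    and "AE x in M. 0 \<le> x \<and> x \<le> a" "AE x in N. 0 \<le> x \<and> x \<le> b"
  shows "AE x in M \<star> N. 0 \<le> x \<and> x \<le> a + (b::real)"
proof -
  interpret M: real_distribution M by fact
  interpret N: real_distribution N by fact
  interpret pair_prob_space M N ..
  have [measurable_cong]: "sets M = sets borel" "sets N = sets borel" by simp_all
  have "AE z in M \<Otimes>\<^sub>M N. 0 \<le> fst z + snd z \<and> fst z + snd z \<le> a + b"
  proof (rule AE_pair_measure)
    show "{x \<in> space (M \<Otimes>\<^sub>M N). 0 \<le> fst x + snd x \<and> fst x + snd x \<le> a + b} \<in> sets (M \<Otimes>\<^sub>M N)"
      by measurable
    show "AE x in M. AE y in N. 0 \<le> fst (x, y) + snd (x, y) \<and> fst (x, y) + snd (x, y) \<le> a + b"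
      using assms(3)
    proof eventually_elim
      case (elim x)
      show ?case using assms(4) by eventually_elim (use elim in auto)
    qed
  qed
  then show ?thesis
    unfolding convolution_def
    by (subst AE_distr_iff) (auto simp: case_prod_beta)
qed

lemma real_distribution_return: "real_distribution (return borel x)"
  by (auto simp: real_distribution_def real_distribution_axioms_def prob_space_return)

lemma real_distribution_finite_convolution:
  assumes "\<And>i. i < n \<Longrightarrow> real_distribution (\<nu> i)"
  shows "real_distribution (finite_convolution \<nu> n)"
  using assms by (induction n) (auto intro: real_distribution_convolution real_distribution_return)

lemma char_finite_convolution:
  assumes "\<And>i. i < n \<Longrightarrow> real_distribution (\<nu> i)"
  shows "char (finite_convolution \<nu> n) t = (\<Prod>i<n. char (\<nu> i) t)"
  using assms
proof (induction n)
  case 0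
  show ?case by (simp add: char_def integral_return)
next
  case (Suc n)
  then show ?case
    by (simp add: char_convolution real_distribution_finite_convolution)
qed

lemma AE_finite_convolution:
  assumes "\<And>i. i < n \<Longrightarrow> real_distribution (\<nu> i)"
    and "\<And>i. i < n \<Longrightarrow> AE x in \<nu> i. 0 \<le> x \<and> x \<le> B i"
  shows "AE x in finite_convolution \<nu> n. 0 \<le> x \<and> x \<le> (\<Sum>i<n. B i :: real)"
  using assms
proof (induction n)
  case 0
  show ?case by (subst finite_convolution.simps, subst AE_return) auto
next
  case (Suc n)
  show ?case
    unfolding finite_convolution.simps sum.lessThan_Suc
  proof (rule AE_convolution)
    show "real_distribution (finite_convolution \<nu> n)"
      using Suc.prems(1) by (intro real_distribution_finite_convolution) simp
    show "AE x in finite_convolution \<nu> n. 0 \<le> x \<and> x \<le> (\<Sum>i<n. B i)"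
      by (rule Suc.IH) (rule Suc.prems, simp)+
  qed (rule Suc.prems, simp)+
qed

text \<open>From |e^(iu) - 1| \<le> |u|. It turns summable support widths into summable distances of
  the factors from 1.\<close>

lemma norm_char_minus_1_le:
  assumes "real_distribution M" "AE x in M. 0 \<le> x \<and> x \<le> B"
  shows "norm (char M t - 1) \<le> \<bar>t\<bar> * B"
proof -
  interpret M: real_distribution M by fact
  have "char M t - 1 = (CLINT x|M. iexp (t * x) - 1)"
    unfolding char_def by (subst Bochner_Integration.integral_diff) (auto simp: M.integrable_iexp M.prob_space[simplified])
  also have "norm \<dots> \<le> (LINT x|M. norm (iexp (t * x) - 1))"
    by (rule integral_norm_bound)
  also have "\<dots> \<le> (LINT x|M. \<bar>t\<bar> * B)"
  proof (rule integral_mono_AE)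
    show "AE x in M. norm (iexp (t * x) - 1) \<le> \<bar>t\<bar> * B"
      using assms(2)
    proof eventually_elim
      case (elim x)
      have "norm (iexp (t * x) - 1) \<le> \<bar>t * x\<bar>"
        using iexp_approx1[of "t * x" 0] by simp
      also have "\<dots> \<le> \<bar>t\<bar> * B"
        using elim by (auto simp: abs_mult intro!: mult_left_mono)
      finally show ?case .
    qed
    have "norm (iexp (t * x) - 1) \<le> 2" for x
      using norm_triangle_ineq4[of "iexp (t * x)" 1] by simp
    then show "integrable M (\<lambda>x. norm (iexp (t * x) - 1))"
      by (intro M.integrable_const_bound[of _ 2]) auto
  qed auto
  finally show ?thesis by (simp add: M.prob_space[simplified])
qed

text \<open>Consecutive partial products differ by a partial product times \<open>z n - 1\<close>,
  of norm at most \<open>B n\<close>, so their telescoping series converges absolutely. No factor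
  has to be nonzero.\<close>

lemma convergent_prod_near_1:
  fixes z :: "nat \<Rightarrow> complex"
  assumes "\<And>n. norm (z n) \<le> 1" "\<And>n. norm (z n - 1) \<le> B n" "summable B"
  shows "convergent (\<lambda>n. \<Prod>i<n. z i)"
proof -
  have "norm ((\<Prod>i<Suc n. z i) - (\<Prod>i<n. z i)) \<le> B n" for n
  proof -
    have "(\<Prod>i<Suc n. z i) - (\<Prod>i<n. z i) = (\<Prod>i<n. z i) * (z n - 1)"
      by (simp add: algebra_simps)
    also have "norm \<dots> \<le> 1 * B n"
      unfolding norm_mult
      by (intro mult_mono) (auto simp: prod_norm[symmetric] assms intro!: prod_le_1)
    finally show ?thesis by simp
  qed
  then have "summable (\<lambda>n. (\<Prod>i<Suc n. z i) - (\<Prod>i<n. z i))"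
    by (rule summable_comparison_test'[OF assms(3)])
  then have "convergent (\<lambda>n. \<Sum>j<n. (\<Prod>i<Suc j. z i) - (\<Prod>i<j. z i))"
    by (simp add: summable_iff_convergent)
  then have "convergent (\<lambda>n. (\<Prod>i<n. z i) - 1)"
    by (subst (asm) sum_lessThan_telescope) simp
  then show ?thesis
    by (simp add: convergent_diff_const_right_iff)
qed

text \<open>The supports stay in one bounded interval, so the finite convolutions are tight and a
  subsequence converges weakly. Their characteristic functions converge along the whole sequence, so
  Levy continuity upgrades this to the full sequence, and Levy uniqueness justifies the definite
  description.\<close>

lemma
  assumes \<nu>: "\<And>n. real_distribution (\<nu> n)"
    and AE: "\<And>n. AE x in \<nu> n. 0 \<le> x \<and> x \<le> B n" and B: "summable B"
  shows real_distribution_infinite_convolution: "real_distribution (infinite_convolution \<nu>)"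
    and char_infinite_convolution_tendsto:
      "(\<lambda>n. \<Prod>i<n. char (\<nu> i) t) \<longlonglongrightarrow> char (infinite_convolution \<nu>) t"
proof -
  let ?F = "finite_convolution \<nu>"
  have F: "real_distribution (?F n)" for n
    by (rule real_distribution_finite_convolution) (rule \<nu>)
  have charF: "char (?F n) t = (\<Prod>i<n. char (\<nu> i) t)" for n t
    by (rule char_finite_convolution) (rule \<nu>)
  have B0: "0 \<le> B n" for n
  proof -
    interpret real_distribution "\<nu> n" by (rule \<nu>)
    have "AE x in \<nu> n. 0 \<le> B n" using AE[of n] by eventually_elim simp
    then show ?thesis by simp
  qed
  have conv: "convergent (\<lambda>n. char (?F n) t)" for t
    unfolding charF
    by (rule convergent_prod_near_1[where B="\<lambda>n. \<bar>t\<bar> * B n"])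
       (auto intro: real_distribution.cmod_char_le_1 norm_char_minus_1_le \<nu> AE B summable_mult)
  have "tight ?F"
    unfolding tight_def
  proof (intro conjI allI impI F)
    fix \<epsilon> :: real assume "0 < \<epsilon>"
    show "\<exists>a b. a < b \<and> (\<forall>n. 1 - \<epsilon> < measure (?F n) {a<..b})"
    proof (intro exI conjI allI)
      \<comment> \<open>The mass sits on [0, \<open>suminf B\<close>]; the left end -1 is taken
        because the interval is open on the left.\<close>
      show "-1 < suminf B"
        using suminf_nonneg[OF B B0] by linarith
      fix n
      interpret Fn: real_distribution "?F n" by (rule F)
      have "AE x in ?F n. x \<in> {-1<..suminf B}"
        using AE_finite_convolution[of n \<nu> B, OF \<nu> AE]
      proof eventually_elim
        case (elim x)
        then show ?case using sum_le_suminf[OF B, of "{..<n}"] B0 by auto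
      qed
      then have "measure (?F n) {-1<..suminf B} = 1"
        by (intro Fn.prob_eq_1[THEN iffD2]) auto
      then show "1 - \<epsilon> < measure (?F n) {-1<..suminf B}"
        using \<open>0 < \<epsilon>\<close> by simp
    qed
  qed
  from tight_imp_convergent_subsubsequence[OF this strict_mono_id]
  obtain r \<mu> where r: "strict_mono r" and \<mu>: "real_distribution \<mu>" and w: "weak_conv_m (?F \<circ> r) \<mu>"
    by auto
  have lim: "(\<lambda>n. char (?F n) t) \<longlonglongrightarrow> char \<mu> t" for t
  proof -
    obtain L where L: "(\<lambda>n. char (?F n) t) \<longlonglongrightarrow> L"
      using conv[of t] by (auto simp: convergent_def)
    have "(\<lambda>n. char ((?F \<circ> r) n) t) \<longlonglongrightarrow> char \<mu> t"
      by (rule levy_continuity1[OF _ \<mu> w]) (simp add: F)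
    moreover have "(\<lambda>n. char ((?F \<circ> r) n) t) \<longlonglongrightarrow> L"
      using LIMSEQ_subseq_LIMSEQ[OF L r] by (simp add: o_def)
    ultimately show ?thesis using L LIMSEQ_unique by blast
  qed
  have wF: "weak_conv_m ?F \<mu>"
    by (rule levy_continuity[OF F \<mu> lim])
  have "infinite_convolution \<nu> = \<mu>"
    unfolding infinite_convolution_def
  proof (rule the_equality)
    fix \<mu>' assume *: "real_distribution \<mu>' \<and> weak_conv_m ?F \<mu>'"
    have "char \<mu>' t = char \<mu> t" for t
      using * by (intro LIMSEQ_unique[OF levy_continuity1[OF F] lim]) auto
    then show "\<mu>' = \<mu>"
      using Levy_uniqueness[of \<mu>' \<mu>] * \<mu> by auto
  qed (use \<mu> wF in auto)
  then show "real_distribution (infinite_convolution \<nu>)"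
    and "(\<lambda>n. \<Prod>i<n. char (\<nu> i) t) \<longlonglongrightarrow> char (infinite_convolution \<nu>) t"
    using \<mu> lim[of t] by (simp_all add: charF)
qed

text \<open>All other factors have modulus at most 1, so any single factor bounds the product;
  \<open>s\<close> remains free to be adapted to the frequencies.\<close>

lemma norm_char_infinite_convolution_le:
  assumes \<nu>: "\<And>n. real_distribution (\<nu> n)"
    and AE: "\<And>n. AE x in \<nu> n. 0 \<le> x \<and> x \<le> B n" and B: "summable B"
  shows "norm (char (infinite_convolution \<nu>) t) \<le> norm (char (\<nu> s) t)"
proof (rule tendsto_upperbound)
  show "(\<lambda>n. norm (\<Prod>i<n. char (\<nu> i) t)) \<longlonglongrightarrow> norm (char (infinite_convolution \<nu>) t)"
    by (intro tendsto_norm char_infinite_convolution_tendsto[OF assms])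
  show "\<forall>\<^sub>F n in sequentially. norm (\<Prod>i<n. char (\<nu> i) t) \<le> norm (char (\<nu> s) t)"
    using eventually_gt_at_top[of s]
  proof eventually_elim
    case (elim n)
    have "norm (\<Prod>i<n. char (\<nu> i) t) = norm (char (\<nu> s) t) * norm (\<Prod>i\<in>{..<n}-{s}. char (\<nu> i) t)"
      using elim by (subst prod.remove[of _ s]) (auto simp: norm_mult)
    also have "\<dots> \<le> norm (char (\<nu> s) t) * 1"
      by (intro mult_left_mono)
         (auto simp: prod_norm[symmetric] real_distribution.cmod_char_le_1[OF \<nu>] intro!: prod_le_1)
    finally show ?case by simp
  qed
qed simp

lemma fourier_transform_eq_char: "fourier_transform \<mu> \<xi> = char \<mu> (- 2 * pi * \<xi>)"
  unfolding fourier_transform_def char_def by (simp add: algebra_simps)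

section \<open>The Cantor-Moran measure\<close>

locale moran =
  fixes q :: "nat \<Rightarrow> nat" and d :: nat
  assumes q_strict_mono: "strict_mono_on {1..} q"
    and q_prime: "\<And>n. n \<ge> 1 \<Longrightarrow> prime (q n)"
    and q_1_ge: "q 1 \<ge> 7"
    and d_ge: "d \<ge> 1"
begin

lemma q_Suc_ge: "q (Suc n) \<ge> n + 7"
proof (induction n)
  case 0
  then show ?case using q_1_ge by simp
next
  case (Suc n)
  have "q (Suc n) < q (Suc (Suc n))"
    using q_strict_mono by (auto simp: strict_mono_on_def)
  with Suc show ?case by simp
qed

lemma q_pos: "q (Suc n) > 0"
  using q_Suc_ge[of n] by simp

lemma modulus_0 [simp]: "modulus q d 0 = 1"
  by (simp add: modulus_def)

lemma modulus_Suc: "modulus q d (Suc s) = modulus q d s * q (Suc s) ^ ell d (Suc s)"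
  by (simp add: modulus_def)

lemma modulus_pos: "modulus q d s > 0"
  by (induction s) (simp_all add: modulus_Suc q_pos)

lemma ell_Suc_ge: "ell d (Suc s) \<ge> Suc s"
  using d_ge by (simp add: ell_def self_le_power)

lemma modulus_Suc_ge: "modulus q d (Suc s) \<ge> 7 * modulus q d s"
proof -
  have "7 ^ 1 \<le> q (Suc s) ^ ell d (Suc s)"
    using q_Suc_ge[of s] ell_Suc_ge[of s] by (intro power_mono order_trans[OF _ power_increasing[of 1]]) auto
  then show ?thesis
    by (simp add: modulus_Suc)
qed

lemma modulus_ge: "modulus q d s \<ge> 7 ^ s"
proof (induction s)
  case (Suc s)
  then show ?case using modulus_Suc_ge[of s] by simp
qed simp

lemma contraction_nonneg: "contraction q d s j \<ge> 0"
  by (simp add: contraction_def)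

text \<open>Since p - 1 \<ge> 6 for the prime p of the block, each term is at most one sixth of the
  difference 1/(A p^j) - 1/(A p^(j+1)), and these differences telescope.\<close>

lemma sum_contraction_le:
  "(\<Sum>j<n. contraction q d s j) \<le> (1 / modulus q d s - 1 / (modulus q d s * q (Suc s) ^ n)) / 6"
proof (induction n)
  case 0
  then show ?case by simp
next
  case (Suc n)
  define A where "A = real (modulus q d s)"
  define p where "p = real (q (Suc s))"
  have A: "A > 0" and p: "p \<ge> 7" using modulus_pos q_Suc_ge[of s] by (auto simp: A_def p_def)
  have "6 * (1 / (A * p ^ Suc n)) \<le> (p - 1) * (1 / (A * p ^ Suc n))"
    using A p by (intro mult_right_mono) auto
  also have "\<dots> = 1 / (A * p ^ n) - 1 / (A * p ^ Suc n)"
    using A p by (simp add: field_simps)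
  finally have "1 / (A * p ^ Suc n) \<le> (1 / (A * p ^ n) - 1 / (A * p ^ Suc n)) / 6"
    by simp
  then show ?case
    using Suc by (simp add: contraction_def A_def p_def diff_divide_distrib)
qed

text \<open>Chosen as a difference of consecutive reciprocal moduli, so that the widths telescope
  from block to block as well.\<close>

definition block_width :: "nat \<Rightarrow> real" where
  "block_width s = (1 / modulus q d s - 1 / modulus q d (Suc s)) / 6"

lemma sum_contraction_le_block_width: "(\<Sum>j<ell d (Suc s). contraction q d s j) \<le> block_width s"
  using sum_contraction_le[of s "ell d (Suc s)"] by (simp add: block_width_def modulus_Suc)

lemma block_width_sums: "(\<lambda>i. block_width (i + s)) sums (1 / (6 * modulus q d s))"
proof -
  have lim: "(\<lambda>n. (1/7) ^ n :: real) \<longlonglongrightarrow> 0"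
    by (intro LIMSEQ_realpow_zero) auto
  have le: "norm (1 / real (modulus q d n)) \<le> norm ((1/7) ^ n :: real) * 1" for n
    using modulus_ge[of n] modulus_pos[of n] by (simp add: power_one_over frac_le numeral_power_le_of_nat_cancel_iff)
  have "(\<lambda>n. 1 / real (modulus q d n)) \<longlonglongrightarrow> 0"
    by (rule tendsto_0_le[OF lim always_eventually[OF allI[OF le]]])
  then have "(\<lambda>n. 1 / real (modulus q d (n + s))) \<longlonglongrightarrow> 0"
    by (rule LIMSEQ_ignore_initial_segment)
  from telescope_sums'[OF this]
  have "(\<lambda>n. 1 / real (modulus q d (n + s)) - 1 / real (modulus q d (Suc n + s))) sums (1 / real (modulus q d s))"
    by simp
  from sums_divide[OF this, of 6] show ?thesis
    by (simp add: block_width_def mult.commute)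
qed

context
  fixes \<omega> :: "nat \<Rightarrow> real" and \<delta> :: real
  assumes \<delta>_pos: "\<delta> > 0" and \<omega>_ge: "\<And>n. n \<ge> 1 \<Longrightarrow> \<delta> \<le> \<omega> n" and \<omega>_le: "\<And>n. n \<ge> 1 \<Longrightarrow> \<omega> n \<le> 1 - \<delta>"
begin

abbreviation digit_measure :: "nat \<Rightarrow> nat \<Rightarrow> real measure" where
  "digit_measure s j \<equiv> two_point_measure (\<omega> (block_start d s + j + 1)) 0 (contraction q d s j)"

lemma \<omega>_01: "n \<ge> 1 \<Longrightarrow> 0 \<le> \<omega> n \<and> \<omega> n \<le> 1"
  using \<delta>_pos \<omega>_ge[of n] \<omega>_le[of n] by auto

lemma real_distribution_digit_measure: "real_distribution (digit_measure s j)"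
  by (intro real_distribution_two_point) (use \<omega>_01 in auto)

lemma AE_block:
  "AE x in finite_convolution (digit_measure s) (ell d (Suc s)). 0 \<le> x \<and> x \<le> block_width s"
proof -
  have "AE x in finite_convolution (digit_measure s) (ell d (Suc s)).
      0 \<le> x \<and> x \<le> (\<Sum>j<ell d (Suc s). contraction q d s j)"
    by (intro AE_finite_convolution real_distribution_digit_measure AE_two_point contraction_nonneg)
       (use \<omega>_01 in auto)
  then show ?thesis
    by eventually_elim (use sum_contraction_le_block_width[of s] in auto)
qed

lemma real_distribution_block: "real_distribution (finite_convolution (digit_measure s) n)"
  by (intro real_distribution_finite_convolution real_distribution_digit_measure)

lemma real_distribution_cantor_moran: "real_distribution (cantor_moran_measure q d \<omega>)"
  unfolding cantor_moran_measure_def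
  using real_distribution_block AE_block sums_summable[OF block_width_sums[of 0], simplified]
  by (rule real_distribution_infinite_convolution)

text \<open>The bound \<open>\<bar>z\<bar> \<le> (1 + \<bar>z\<bar>\<^sup>2) / 2\<close> turns the modulus of a factor into a trigonometric polynomial,
  which averages exactly over equally spaced points.\<close>

lemma norm_char_digit_measure_le:
  "norm (char (digit_measure s j) (- 2 * pi * \<xi>)) \<le>
     1 - \<delta>\<^sup>2 * (1 - cos (2 * pi * (\<xi> * contraction q d s j)))"
proof -
  define w where "w = \<omega> (block_start d s + j + 1)"
  define t where "t = 2 * pi * (\<xi> * contraction q d s j)"
  define z where "z = char (digit_measure s j) (- 2 * pi * \<xi>)"
  have w: "\<delta> \<le> w" "w \<le> 1 - \<delta>" using \<omega>_ge \<omega>_le by (auto simp: w_def)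
  have "z = w + (1 - w) * cis (- t)"
    unfolding z_def by (subst char_two_point) (use \<omega>_01 in \<open>auto simp: w_def t_def cis_conv_exp algebra_simps\<close>)
  then have "(norm z)\<^sup>2 = (w + (1 - w) * cos t)\<^sup>2 + ((1 - w) * sin t)\<^sup>2"
    by (simp add: cmod_power2)
  also have "\<dots> = w\<^sup>2 + 2 * w * (1 - w) * cos t + (1 - w)\<^sup>2 * ((sin t)\<^sup>2 + (cos t)\<^sup>2)"
  proof -
    have "(w + (1 - w) * y)\<^sup>2 + ((1 - w) * x)\<^sup>2 = w\<^sup>2 + 2 * w * (1 - w) * y + (1 - w)\<^sup>2 * (x\<^sup>2 + y\<^sup>2)" for x y
      by (simp add: power2_eq_square algebra_simps)
    then show ?thesis .
  qed
  also have "\<dots> = 1 - 2 * (w * (1 - w)) * (1 - cos t)"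
    by (simp add: power2_eq_square algebra_simps)
  finally have *: "(norm z)\<^sup>2 = 1 - 2 * (w * (1 - w)) * (1 - cos t)" .
  have "\<delta>\<^sup>2 * (1 - cos t) \<le> w * (1 - w) * (1 - cos t)"
    unfolding power2_eq_square using w \<delta>_pos by (intro mult_right_mono mult_mono) auto
  moreover have "2 * norm z \<le> 1 + (norm z)\<^sup>2"
    using zero_le_power2[of "1 - norm z"] by (simp add: power2_eq_square algebra_simps)
  ultimately show ?thesis
    using * by (simp add: z_def t_def)
qed

lemma norm_fourier_transform_le:
  "norm (fourier_transform (cantor_moran_measure q d \<omega>) \<xi>) \<le>
     (\<Prod>j<ell d (Suc s). 1 - \<delta>\<^sup>2 * (1 - cos (2 * pi * (\<xi> / (modulus q d s * q (Suc s) ^ Suc j)))))"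
proof -
  have "norm (fourier_transform (cantor_moran_measure q d \<omega>) \<xi>) \<le>
      norm (char (finite_convolution (digit_measure s) (ell d (Suc s))) (- 2 * pi * \<xi>))"
    unfolding fourier_transform_eq_char cantor_moran_measure_def
    using real_distribution_block AE_block sums_summable[OF block_width_sums[of 0], simplified]
    by (rule norm_char_infinite_convolution_le)
  also have "\<dots> = (\<Prod>j<ell d (Suc s). norm (char (digit_measure s j) (- 2 * pi * \<xi>)))"
    by (subst char_finite_convolution) (rule real_distribution_digit_measure, simp add: prod_norm)
  also have "\<dots> \<le> (\<Prod>j<ell d (Suc s). 1 - \<delta>\<^sup>2 * (1 - cos (2 * pi * (\<xi> * contraction q d s j))))"
    by (intro prod_mono conjI norm_ge_zero norm_char_digit_measure_le)
  finally show ?thesis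
    by (simp add: contraction_def)
qed

end

end

section \<open>Uniformly distributed digits\<close>

lemma square_dvd_power_minus_linear:
  fixes y :: int
  shows "(y - 1)\<^sup>2 dvd y ^ i - 1 - int i * (y - 1)"
proof (induction i)
  case (Suc i)
  have "y ^ Suc i - 1 - int (Suc i) * (y - 1) = y * (y ^ i - 1 - int i * (y - 1)) + int i * (y - 1)\<^sup>2"
    by (simp add: power2_eq_square algebra_simps)
  with Suc show ?case by (simp add: dvd_add)
qed simp

text \<open>With y = 1 + p z, the power y^i is 1 + i p z modulo p^2. Summing, the linear parts give
  p z times p (p - 1)/2, which vanishes modulo p^2 because p is odd; so the sum is p modulo
  p^2.\<close>

lemma multiplicity_sum_power_prime:
  fixes p y :: int
  assumes p: "prime p" "odd p" and y: "p dvd y - 1"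
  shows "multiplicity p (\<Sum>i<nat p. y ^ i) = 1"
proof -
  have p2: "p > 0" using p prime_gt_0_int by blast
  obtain z where z: "y - 1 = p * z" using y by (auto elim: dvdE)
  obtain c where c: "p = 2 * c + 1" using p(2) by (auto elim: oddE)
  have sum_id: "(\<Sum>i<nat p. int i) = p * c"
  proof -
    have "2 * (\<Sum>i<n. int i) = int n * (int n - 1)" for n
      by (induction n) (auto simp: algebra_simps)
    from this[of "nat p"] p2 c show ?thesis by simp
  qed
  have "p\<^sup>2 dvd (\<Sum>i<nat p. y ^ i - 1 - int i * (y - 1))"
  proof (rule dvd_sum)
    fix i
    have "p\<^sup>2 dvd (y - 1)\<^sup>2" by (simp add: z power_mult_distrib)
    then show "p\<^sup>2 dvd y ^ i - 1 - int i * (y - 1)"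
      using square_dvd_power_minus_linear dvd_trans by blast
  qed
  also have "(\<Sum>i<nat p. y ^ i - 1 - int i * (y - 1)) = (\<Sum>i<nat p. y ^ i) - p - p\<^sup>2 * (c * z)"
    using p2 by (simp add: sum_subtractf sum_distrib_right[symmetric] sum_id z power2_eq_square)
  finally have "p\<^sup>2 dvd (\<Sum>i<nat p. y ^ i) - p"
    by (metis dvd_add dvd_triv_left diff_add_cancel)
  then obtain w where "(\<Sum>i<nat p. y ^ i) - p = p\<^sup>2 * w" by (auto elim: dvdE)
  then have *: "(\<Sum>i<nat p. y ^ i) = p * (1 + p * w)" by (simp add: power2_eq_square algebra_simps)
  have "\<not> p dvd 1 + p * w"
    using p(1) by (metis dvd_add_left_iff dvd_triv_left not_prime_unit)
  moreover from this have "1 + p * w \<noteq> 0" by (metis dvd_0_right)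
  ultimately show ?thesis
    unfolding * using p2 not_prime_unit[of p] p(1)
    by (subst multiplicity_times_same) (auto simp: not_dvd_imp_multiplicity_0)
qed

lemma multiplicity_int_int: "multiplicity (int p) (int n) = multiplicity p n"
  unfolding multiplicity_def by (simp only: of_nat_power[symmetric] of_nat_dvd_iff)

text \<open>The quotient of y^n - 1 by y - 1 is congruent to n modulo p, hence a unit there if p
  does not divide n. Otherwise one factor p is stripped from n by passing from y to y^p, which
  raises the valuation by exactly 1.\<close>

lemma multiplicity_power_minus_1:
  fixes p y :: int
  assumes p: "prime p" "odd p" and "p dvd y - 1" "y > 1" "n > 0"
  shows "multiplicity p (y ^ n - 1) = multiplicity p (y - 1) + multiplicity p (int n)"
  using assms(3-)
proof (induction n arbitrary: y rule: less_induct)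
  case (less n)
  have p2: "p > 1" using p prime_gt_1_int by blast
  have factor: "multiplicity p (y ^ m - 1) = multiplicity p (y - 1) + multiplicity p (\<Sum>i<m. y ^ i)"
    if "m > 0" for m
  proof -
    have "(\<Sum>i<m. y ^ i) > 0" using that less.prems by (intro sum_pos) auto
    then show ?thesis
      using less.prems p
      by (subst power_diff_1_eq, subst prime_elem_multiplicity_mult_distrib[OF prime_imp_prime_elem]) auto
  qed
  show ?case
  proof (cases "p dvd int n")
    case False
    have "[(\<Sum>i<n. y ^ i) = (\<Sum>i<n. 1 ^ i)] (mod p)"
      by (intro cong_sum cong_pow) (use less.prems in \<open>simp add: cong_iff_dvd_diff\<close>)
    then have "[(\<Sum>i<n. y ^ i) = int n] (mod p)" by simp
    then have "\<not> p dvd (\<Sum>i<n. y ^ i)"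
      using False cong_dvd_iff by blast
    then show ?thesis
      using factor[of n] False less.prems by (simp add: not_dvd_imp_multiplicity_0)
  next
    case True
    then obtain n' where "int n = p * n'" by (auto elim: dvdE)
    moreover from this have "n' \<ge> 0" using p2 by (metis of_nat_0_le_iff zero_le_mult_iff not_less less_le_trans zero_less_one less_trans)
    ultimately have n: "n = nat p * nat n'" by (metis nat_int nat_mult_distrib p2 less_imp_le zero_less_one less_trans)
    with less.prems have "nat n' > 0" by (metis mult_0_right neq0_conv)
    have yp: "multiplicity p (y ^ nat p - 1) = multiplicity p (y - 1) + 1"
      using factor[of "nat p"] p2 multiplicity_sum_power_prime[OF p, of y] less.prems by simp
    have "y ^ nat p > 1" using less.prems p2 by (intro one_less_power) auto
    moreover have "p dvd y ^ nat p - 1"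
      using less.prems by (simp add: power_diff_1_eq)
    moreover have "nat n' < n" using n p2 \<open>nat n' > 0\<close> by simp
    ultimately have "multiplicity p ((y ^ nat p) ^ nat n' - 1) = multiplicity p (y ^ nat p - 1) + multiplicity p (int (nat n'))"
      using less.IH \<open>nat n' > 0\<close> by blast
    moreover have "multiplicity p (int n) = 1 + multiplicity p (int (nat n'))"
      unfolding n using \<open>nat n' > 0\<close> p p2 not_prime_unit[of p]
      by (simp add: multiplicity_times_same)
    ultimately show ?thesis
      using yp by (simp add: n power_mult)
  qed
qed

lemma multiplicity_power_minus_1_nat:
  fixes p y :: nat
  assumes "prime p" "odd p" "p dvd y - 1" "y > 1" "n > 0"
  shows "multiplicity p (y ^ n - 1) = multiplicity p (y - 1) + multiplicity p n"
proof -
  have iy: "int y ^ n - 1 = int (y ^ n - 1)" "int y - 1 = int (y - 1)"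
    using assms by (simp_all add: of_nat_diff)
  have "int p dvd int y - 1" unfolding iy using assms by (simp only: of_nat_dvd_iff)
  then have "multiplicity (int p) (int y ^ n - 1) = multiplicity (int p) (int y - 1) + multiplicity (int p) (int n)"
    using assms by (intro multiplicity_power_minus_1) auto
  then show ?thesis by (simp only: iy multiplicity_int_int)
qed

section \<open>Digit factors and their exact averages\<close>

lemma sum_cos_equally_spaced:
  fixes p :: nat and \<theta> :: real
  assumes "p \<ge> 2"
  shows "(\<Sum>k<p. cos (2 * pi * ((\<theta> + k) / p))) = 0"
proof -
  define z where "z = cis (2 * pi / p)"
  have zp: "z ^ p = 1"
    unfolding z_def Complex.DeMoivre using assms by (simp add: cis_2pi)
  have "z \<noteq> 1"
  proof
    assume "z = 1"
    then have "cos (2 * pi / p) = 1" by (metis z_def cis.simps(1) one_complex.simps(1))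
    then obtain n :: int where "2 * pi / p = n * 2 * pi" by (auto simp: cos_one_2pi_int)
    then have "real_of_int (n * int p) = 1" using assms by (simp add: field_simps)
    then have "n * int p = 1" by linarith
    then show False using assms by (simp add: zmult_eq_1_iff)
  qed
  have "(\<Sum>k<p. cis (2 * pi * ((\<theta> + k) / p))) = cis (2 * pi * \<theta> / p) * (\<Sum>k<p. z ^ k)"
    unfolding sum_distrib_left z_def Complex.DeMoivre cis_mult
    by (intro sum.cong refl arg_cong[where f=cis]) (simp add: add_divide_distrib algebra_simps)
  also have "(\<Sum>k<p. z ^ k) = 0"
    using \<open>z \<noteq> 1\<close> zp by (simp add: geometric_sum)
  finally have "Re (\<Sum>k<p. cis (2 * pi * ((\<theta> + k) / p))) = 0" by simp
  then show ?thesis by simp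
qed

lemma sum_lessThan_mult:
  fixes f :: "nat \<Rightarrow> 'a::comm_monoid_add"
  shows "(\<Sum>u<n * k. f u) = (\<Sum>m<n. \<Sum>i<k. f (m * k + i))"
proof -
  have "sum f {c..<c + k} = (\<Sum>i<k. f (c + i))" for c
    using sum.shift_bounds_nat_ivl[of f 0 c k] by (simp add: lessThan_atLeast0 add.commute)
  then have "(\<Sum>m<n. sum f {m * k..<m * k + k}) = (\<Sum>m<n. \<Sum>i<k. f (m * k + i))"
    by simp
  then show ?thesis
    by (simp only: sum.nat_group)
qed

definition digit_factor :: "real \<Rightarrow> real \<Rightarrow> real" where
  "digit_factor \<kappa> t = 1 - \<kappa> * (1 - cos (2 * pi * t))"

lemma digit_factor_add_int: "n \<in> \<int> \<Longrightarrow> digit_factor \<kappa> (t + n) = digit_factor \<kappa> t"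
proof -
  assume "n \<in> \<int>"
  then obtain m :: int where "n = m" by (auto elim: Ints_cases)
  then have "cos (2 * pi * (t + n)) = cos (2 * pi * t)"
    by (simp add: distrib_left cos_add sin_int_2pin cos_int_2pin)
  then show ?thesis by (simp add: digit_factor_def)
qed

lemma digit_factor_uminus: "digit_factor \<kappa> (- t) = digit_factor \<kappa> t"
  by (simp add: digit_factor_def)

lemma digit_factor_bounds:
  assumes "0 \<le> \<kappa>" "\<kappa> \<le> 1/2"
  shows "0 \<le> digit_factor \<kappa> t" "digit_factor \<kappa> t \<le> 1"
proof -
  have "\<kappa> * (1 - cos (2 * pi * t)) \<le> 1/2 * 2"
    using assms cos_ge_minus_one[of "2 * pi * t"] by (intro mult_mono) auto
  moreover have "0 \<le> \<kappa> * (1 - cos (2 * pi * t))"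
    using assms by (intro mult_nonneg_nonneg) auto
  ultimately show "0 \<le> digit_factor \<kappa> t" "digit_factor \<kappa> t \<le> 1"
    by (auto simp: digit_factor_def)
qed

text \<open>The top digit only occurs in the last factor, so the average can be taken digit by digit.\<close>

lemma sum_prod_digit_factor:
  fixes M x \<kappa> :: real and p :: nat
  assumes p: "p \<ge> 2" and M: "M > 0"
  shows "(\<Sum>u<p ^ r. \<Prod>i<r. digit_factor \<kappa> ((x + M * u) / (M * p ^ Suc i))) = (p * (1 - \<kappa>)) ^ r"
proof (induction r)
  case (Suc r)
  let ?g = "digit_factor \<kappa>"
  have top: "(\<Sum>k<p. ?g ((x + M * (k * p ^ r + u)) / (M * p ^ Suc r))) = p * (1 - \<kappa>)" for u :: nat
  proof -
    define \<theta> where "\<theta> = (x + M * u) / (M * p ^ r)"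
    have "(x + M * (k * p ^ r + u)) / (M * p ^ Suc r) = (\<theta> + k) / p" for k :: nat
      using p M by (simp add: \<theta>_def field_simps)
    then have "(\<Sum>k<p. ?g ((x + M * (k * p ^ r + u)) / (M * p ^ Suc r))) = (\<Sum>k<p. ?g ((\<theta> + k) / p))"
      by simp
    also have "\<dots> = p * (1 - \<kappa>) + \<kappa> * (\<Sum>k<p. cos (2 * pi * ((\<theta> + k) / p)))"
      by (simp add: digit_factor_def sum.distrib sum_subtractf sum_distrib_left algebra_simps)
    also have "\<dots> = p * (1 - \<kappa>)" using sum_cos_equally_spaced[OF p] by simp
    finally show ?thesis .
  qed
  have low: "?g ((x + M * (k * p ^ r + u)) / (M * p ^ Suc i)) = ?g ((x + M * u) / (M * p ^ Suc i))"
    if "i < r" for k u i :: nat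
  proof -
    have "real p ^ r = p ^ Suc i * p ^ (r - Suc i)"
      using that by (simp only: power_add[symmetric]) simp
    then have "(x + M * (k * p ^ r + u)) / (M * p ^ Suc i) = (x + M * u) / (M * p ^ Suc i) + k * p ^ (r - Suc i)"
      using p M by (simp add: field_simps)
    then show ?thesis by (simp only: digit_factor_add_int[OF Ints_of_nat])
  qed
  have "(\<Sum>u<p ^ Suc r. \<Prod>i<Suc r. ?g ((x + M * u) / (M * p ^ Suc i)))
      = (\<Sum>k<p. \<Sum>u<p ^ r. \<Prod>i<Suc r. ?g ((x + M * (k * p ^ r + u)) / (M * p ^ Suc i)))"
    unfolding power_Suc by (subst sum_lessThan_mult) simp
  also have "\<dots> = (\<Sum>k<p. \<Sum>u<p ^ r. (\<Prod>i<r. ?g ((x + M * u) / (M * p ^ Suc i))) * ?g ((x + M * (k * p ^ r + u)) / (M * p ^ Suc r)))"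
    unfolding prod.lessThan_Suc by (intro sum.cong refl arg_cong2[where f="(*)"] prod.cong low) simp
  also have "\<dots> = (\<Sum>u<p ^ r. (\<Prod>i<r. ?g ((x + M * u) / (M * p ^ Suc i))) * (p * (1 - \<kappa>)))"
    by (subst sum.swap) (simp only: sum_distrib_left[symmetric] top)
  also have "\<dots> = (p * (1 - \<kappa>)) ^ Suc r"
    by (simp only: sum_distrib_right[symmetric] Suc) simp
  finally show ?case .
qed simp

text \<open>Along \<open>x y\<^sup>t\<close>, \<open>t < p\<^sup>r\<close>, the base-\<open>p\<close> digits in the positions \<open>a + v, \<dots>, a + v + r - 1\<close>
  (after the modulus \<open>A\<close>) run through all possibilities exactly once.\<close>

lemma sum_orbit_le:
  fixes p A x y :: nat and \<kappa> :: real
  assumes p: "prime p" "odd p" and A: "A > 0" "coprime p A" and x: "x > 0" and y: "y > 1"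
    and dvd: "A dvd x * (y - 1)" and py: "p dvd y - 1"
    and a: "a = multiplicity p (y - 1)" and v: "v = multiplicity p x"
    and l: "a + v + r \<le> l" and \<kappa>: "0 \<le> \<kappa>" "\<kappa> \<le> 1/2"
  shows "(\<Sum>t<p ^ r. \<Prod>j<l. digit_factor \<kappa> (real (x * y ^ t) / (A * p ^ Suc j))) \<le> (p * (1 - \<kappa>)) ^ r"
proof -
  let ?g = "digit_factor \<kappa>"
  define M where "M = A * p ^ (a + v)"
  have p2: "p \<ge> 2" using p prime_ge_2_nat by blast
  have M: "M > 0" using A p2 by (simp add: M_def)
  have mult_pow: "multiplicity p (y ^ n - 1) = a + multiplicity p n" if "n > 0" for n
    using multiplicity_power_minus_1_nat[OF p py y that] by (simp add: a)
  \<comment> \<open>The whole orbit lies in the residue class of x modulo M: divisibility by A is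
    assumed, that by the power of p is lifting the exponent, and the two moduli are coprime.\<close>
  have "M dvd x * (y ^ t - 1)" for t
  proof (cases "t = 0")
    case False
    have "x * (y - 1) dvd x * (y ^ t - 1)"
    proof -
      have "int y - 1 dvd int y ^ t - 1" by (simp add: power_diff_1_eq)
      then have "int (y - 1) dvd int (y ^ t - 1)" using y by (simp add: of_nat_diff)
      then show ?thesis by (simp add: mult_dvd_mono del: of_nat_diff)
    qed
    moreover have "p ^ (a + v) dvd x * (y ^ t - 1)"
    proof -
      have "p ^ v dvd x" "p ^ a dvd y ^ t - 1"
        using mult_pow[of t] False by (auto simp: v intro: multiplicity_dvd multiplicity_dvd')
      then have "p ^ v * p ^ a dvd x * (y ^ t - 1)" by (rule mult_dvd_mono)
      then show ?thesis by (simp add: power_add mult.commute)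
    qed
    moreover have "coprime A (p ^ (a + v))" using A by (simp add: coprime_commute)
    ultimately show ?thesis
      unfolding M_def using dvd_trans[OF dvd] by (intro divides_mult)
  qed simp
  then have "\<forall>t. \<exists>z. x * (y ^ t - 1) = M * z" by (auto simp: dvd_def)
  from choice[OF this] obtain w where w: "x * (y ^ t - 1) = M * w t" for t
    by blast
  have xy: "x * y ^ t = x + M * w t" for t
  proof -
    have "x * y ^ t = x + x * (y ^ t - 1)" using y by (simp add: right_diff_distrib')
    then show ?thesis by (simp only: w[symmetric])
  qed
  define u where "u t = w t mod p ^ r" for t
  \<comment> \<open>If two exponents gave the same residue, M p^r would divide x y^t (y^(t'-t) - 1),
    whose valuation at p is exactly v + a plus that of t' - t. So p^r would divide t' - t, which is
    less than p^r.\<close>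
  have inj: "inj_on u {..<p ^ r}"
  proof (rule linorder_inj_onI)
    fix t t' assume tt: "t < t'" "t' \<in> {..<p ^ r}"
    show "u t \<noteq> u t'"
    proof
      assume "u t = u t'"
      then have "[w t = w t'] (mod p ^ r)" by (simp add: u_def cong_def)
      then have "M * w t mod (M * p ^ r) = M * w t' mod (M * p ^ r)"
        by (simp add: cong_def flip: mult_mod_right)
      then have "[x + M * w t = x + M * w t'] (mod (M * p ^ r))"
        by (intro cong_add cong_refl) (simp add: cong_def)
      then have "[x * y ^ t = x * y ^ t'] (mod (M * p ^ r))" by (simp only: xy)
      moreover have "x * y ^ t \<le> x * y ^ t'"
        using tt y by (intro mult_left_mono power_increasing) auto
      ultimately have "M * p ^ r dvd x * y ^ t' - x * y ^ t"
        by (simp add: cong_sym_eq cong_altdef_nat)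
      moreover have "x * y ^ t' - x * y ^ t = x * y ^ t * (y ^ (t' - t) - 1)"
      proof -
        have "y ^ t' = y ^ t * y ^ (t' - t)" using tt by (simp flip: power_add)
        then show ?thesis by (simp only: right_diff_distrib' mult.assoc mult_1_right)
      qed
      moreover have "p ^ (a + v + r) dvd M * p ^ r" by (simp add: M_def power_add)
      ultimately have "p ^ (a + v + r) dvd x * y ^ t * (y ^ (t' - t) - 1)" by (metis dvd_trans)
      moreover have "y ^ (t' - t) - 1 \<noteq> 0" using one_less_power[of y "t' - t"] tt y by simp
      moreover have "\<not> p dvd y" using py y p2
        by (metis One_nat_def Suc_pred dvd_diffD1 less_imp_le_nat p(1) not_prime_unit)
      ultimately have "a + v + r \<le> multiplicity p (x * y ^ t * (y ^ (t' - t) - 1))"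
        using x y p by (intro multiplicity_geI) auto
      also have "\<dots> = v + (a + multiplicity p (t' - t))"
        using x y p tt \<open>\<not> p dvd y\<close> \<open>y ^ (t' - t) - 1 \<noteq> 0\<close> mult_pow[of "t' - t"]
        by (simp add: prime_elem_multiplicity_mult_distrib prime_elem_multiplicity_power_distrib prime_imp_prime_elem
             not_dvd_imp_multiplicity_0 v)
      finally have "p ^ r dvd t' - t" by (intro multiplicity_dvd') simp
      then have "p ^ r \<le> t' - t" using tt by (intro dvd_imp_le) auto
      with tt show False by simp
    qed
  qed auto
  have bij: "bij_betw u {..<p ^ r} {..<p ^ r}"
  proof -
    have "u ` {..<p ^ r} \<subseteq> {..<p ^ r}" using p2 by (auto simp: u_def)
    then have "u ` {..<p ^ r} = {..<p ^ r}" using inj by (intro card_subset_eq) (auto simp: card_image)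
    then show ?thesis using inj by (simp add: bij_betw_def)
  qed
  have "(\<Prod>j<l. ?g (real (x * y ^ t) / (A * p ^ Suc j))) \<le> (\<Prod>i<r. ?g ((x + M * u t) / (M * p ^ Suc i)))" for t
  proof -
    \<comment> \<open>Only the r positions starting at a + v are kept; the discarded factors lie in
      [0, 1].\<close>
    have "(\<Prod>j<l. ?g (real (x * y ^ t) / (A * p ^ Suc j)))
        \<le> (\<Prod>j\<in>(\<lambda>i. a + v + i) ` {..<r}. ?g (real (x * y ^ t) / (A * p ^ Suc j)))"
    proof -
      let ?F = "\<lambda>j. ?g (real (x * y ^ t) / (A * p ^ Suc j))" and ?I = "(\<lambda>i. a + v + i) ` {..<r}"
      have "prod ?F {..<l} = prod ?F ({..<l} - ?I) * prod ?F ?I"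
        using l by (intro prod.subset_diff) auto
      also have "\<dots> \<le> 1 * prod ?F ?I"
        using digit_factor_bounds[OF \<kappa>] by (intro mult_right_mono prod_le_1 prod_nonneg) auto
      finally show ?thesis by simp
    qed
    also have "\<dots> = (\<Prod>i<r. ?g (real (x * y ^ t) / (A * p ^ Suc (a + v + i))))"
      by (subst prod.reindex) auto
    also have "\<dots> = (\<Prod>i<r. ?g ((x + M * u t) / (M * p ^ Suc i)))"
    proof (rule prod.cong[OF refl])
      fix i assume i: "i \<in> {..<r}"
      define c where "c = w t div p ^ r"
      \<comment> \<open>Replacing \<open>w t\<close> by its residue changes the argument of the i-th
        retained factor by an integer, since i < r.\<close>
      have "w t = u t + p ^ Suc i * (p ^ (r - Suc i) * c)"
        using i by (simp add: u_def c_def mult.assoc[symmetric] flip: power_add power_Suc)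
      then have "real (x * y ^ t) = (x + M * u t) + M * p ^ Suc i * (p ^ (r - Suc i) * c)"
        by (simp only: xy of_nat_add of_nat_mult of_nat_power distrib_left)
      moreover have "real A * p ^ Suc (a + v + i) = M * p ^ Suc i"
        by (simp add: M_def power_add)
      moreover have "real M * real p ^ Suc i \<noteq> 0" using M p2 by simp
      ultimately have "real (x * y ^ t) / (A * p ^ Suc (a + v + i)) = (x + M * u t) / (M * p ^ Suc i) + p ^ (r - Suc i) * c"
        by (simp only: add_divide_distrib nonzero_mult_div_cancel_left not_False_eq_True of_nat_mult of_nat_power of_nat_add)
      then show "?g (real (x * y ^ t) / (A * p ^ Suc (a + v + i))) = ?g ((x + M * u t) / (M * p ^ Suc i))"
        by (simp only: digit_factor_add_int[OF Ints_of_nat])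
    qed
    finally show ?thesis .
  qed
  then have "(\<Sum>t<p ^ r. \<Prod>j<l. ?g (real (x * y ^ t) / (A * p ^ Suc j)))
      \<le> (\<Sum>t<p ^ r. \<Prod>i<r. ?g ((x + M * u t) / (M * p ^ Suc i)))"
    by (intro sum_mono)
  also have "\<dots> = (\<Sum>u<p ^ r. \<Prod>i<r. ?g ((x + real M * u) / (M * p ^ Suc i)))"
    by (subst sum.reindex_bij_betw[OF bij, symmetric]) simp
  also have "\<dots> = (p * (1 - \<kappa>)) ^ r"
    using sum_prod_digit_factor[of p "real M" \<kappa> "real x" r] p2 M by simp
  finally show ?thesis .
qed

section \<open>The DEL criterion\<close>

lemma card_multiples_le:
  fixes n N :: nat
  assumes "n > 0"
  shows "real (card {k \<in> {1..<N}. n dvd k}) \<le> real N / real n"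
proof -
  have "{k \<in> {1..<N}. n dvd k} \<subseteq> (\<lambda>i. n * i) ` {1..N div n}"
  proof
    fix k assume "k \<in> {k \<in> {1..<N}. n dvd k}"
    then obtain i where "k = n * i" "n * i < N" "1 \<le> n * i" by (auto elim: dvdE)
    moreover from this have "1 \<le> i" by (cases i) auto
    moreover have "i \<le> N div n" using \<open>n * i < N\<close> assms by (simp add: less_eq_div_iff_mult_less_eq mult.commute)
    ultimately show "k \<in> (\<lambda>i. n * i) ` {1..N div n}" by auto
  qed
  then have "card {k \<in> {1..<N}. n dvd k} \<le> card ((\<lambda>i. n * i) ` {1..N div n})"
    by (intro card_mono) auto
  also have "\<dots> \<le> N div n"
    using card_image_le[of "{1..N div n}" "\<lambda>i. n * i"] by simp
  finally have "real (card {k \<in> {1..<N}. n dvd k}) \<le> real (N div n)" by simp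
  also have "\<dots> \<le> real N / real n" 
    using assms div_times_less_eq_dividend[of N n] by (simp add: pos_le_divide_eq flip: of_nat_mult)
  finally show ?thesis .
qed

section \<open>Arithmetic of the moduli and averages over the exponents\<close>

context moran
begin

lemma q_strict: "1 \<le> i \<Longrightarrow> i < j \<Longrightarrow> q i < q j"
  using q_strict_mono by (auto simp: strict_mono_on_def)

lemma q_ge: "i \<ge> 1 \<Longrightarrow> q i \<ge> i + 6"
  using q_Suc_ge[of "i - 1"] by simp

lemma odd_q: "n \<ge> 1 \<Longrightarrow> odd (q n)"
  using q_prime[of n] q_ge[of n] prime_odd_nat[of "q n"] by auto

lemma coprime_q_modulus: "s \<le> n \<Longrightarrow> coprime (q (Suc n)) (modulus q d s)"
  unfolding modulus_def
proof (rule prod_coprime_right)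
  fix i assume i: "i \<in> {1..s}" and "s \<le> n"
  then have "q i \<noteq> q (Suc n)" using q_strict[of i "Suc n"] by auto
  then show "coprime (q (Suc n)) (q i ^ ell d i)"
    using i q_prime[of i] q_prime[of "Suc n"] by (simp add: primes_coprime)
qed

text \<open>Euler's totient of \<open>modulus q d s\<close>, written as the product over its prime
  powers.\<close>

definition period :: "nat \<Rightarrow> nat" where
  "period s = (\<Prod>i=1..s. q i ^ (ell d i - 1) * (q i - 1))"

lemma ell_ge_1: "i \<ge> 1 \<Longrightarrow> ell d i \<ge> 1"
  using ell_Suc_ge[of "i - 1"] by simp

lemma period_pos: "period s > 0"
  unfolding period_def
proof (rule prod_pos)
  fix i assume "i \<in> {1..s}"
  then show "0 < q i ^ (ell d i - 1) * (q i - 1)" using q_ge[of i] by auto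
qed

lemma period_le: "period s \<le> modulus q d s"
  unfolding period_def modulus_def
proof (rule prod_mono)
  fix i assume "i \<in> {1..s}"
  then have "q i ^ ell d i = q i ^ (ell d i - 1) * q i"
    using ell_ge_1[of i] by (cases "ell d i") auto
  then show "0 \<le> q i ^ (ell d i - 1) * (q i - 1) \<and> q i ^ (ell d i - 1) * (q i - 1) \<le> q i ^ ell d i"
    by simp
qed

text \<open>Here the monotonicity of \<open>q\<close> is essential: raising \<open>b\<^bsup>q - 1\<^esup>\<close> to the power \<open>period s\<close> does not
  increase the valuation of its difference to \<open>1\<close>.\<close>

lemma q_not_dvd_period: "s \<le> n \<Longrightarrow> \<not> q (Suc n) dvd period s"
proof
  assume "s \<le> n" "q (Suc n) dvd period s"
  then obtain i where i: "1 \<le> i" "i \<le> s" "q (Suc n) dvd q i ^ (ell d i - 1) * (q i - 1)"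
    using prime_dvd_prod_iff[of "{1..s}" "q (Suc n)"] q_prime[of "Suc n"] by (auto simp: period_def)
  then have "q (Suc n) dvd q i \<or> q (Suc n) dvd q i - 1"
    using q_prime[of "Suc n"] by (auto simp: prime_dvd_mult_iff dest: prime_dvd_power)
  then have "q (Suc n) \<le> q i"
    using q_ge[of i] i by (auto dest!: dvd_imp_le)
  then show False
    using q_strict[of i "Suc n"] i \<open>s \<le> n\<close> by auto
qed

text \<open>Primes not dividing b are handled by Euler's theorem. A prime q_i dividing b satisfies i
  \<le> q_i \<le> b, so its exponent i^d is at most b^d \<le> m and the factor b^m absorbs it; this
  is why the first b^d exponents are set aside later.\<close>

lemma modulus_dvd_power:
  assumes b: "b \<ge> 2" and m: "b ^ d \<le> m"
  shows "modulus q d s dvd b ^ m * (b ^ (period s * c) - 1)"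
proof -
  define X where "X = b ^ m * (b ^ (period s * c) - 1)"
  have *: "q i ^ ell d i dvd X" if i: "i \<in> {1..s}" for i
  proof (cases "q i dvd b")
    case True
    then have "q i \<le> b" using b by (intro dvd_imp_le) auto
    then have "i \<le> b" using q_ge[of i] i by auto
    then have "ell d i \<le> m" using m power_mono[of i b d] by (simp add: ell_def)
    then have "q i ^ ell d i dvd b ^ m"
      using True by (meson dvd_trans dvd_power_same le_imp_power_dvd)
    then show ?thesis by (simp add: X_def)
  next
    case False
    have "prime (q i)" using q_prime i by auto
    then have "coprime b (q i)" using False by (metis coprime_commute prime_imp_coprime)
    then have "[b ^ totient (q i ^ ell d i) = 1] (mod q i ^ ell d i)"
      by (intro euler_theorem) simp
    moreover have "totient (q i ^ ell d i) = q i ^ (ell d i - 1) * (q i - 1)"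
      using \<open>prime (q i)\<close> ell_ge_1[of i] i by (intro totient_prime_power) auto
    moreover have "q i ^ (ell d i - 1) * (q i - 1) dvd period s"
      unfolding period_def using i by (intro dvd_prodI) auto
    ultimately obtain k where "period s = totient (q i ^ ell d i) * k" by (auto elim: dvdE)
    then have "b ^ (period s * c) = (b ^ totient (q i ^ ell d i)) ^ (k * c)"
      by (simp add: power_mult mult.assoc)
    moreover have "[(b ^ totient (q i ^ ell d i)) ^ (k * c) = 1 ^ (k * c)] (mod q i ^ ell d i)"
      by (rule cong_pow) fact
    ultimately have "[b ^ (period s * c) = 1] (mod q i ^ ell d i)" by simp
    moreover have "1 \<le> b ^ (period s * c)" using b by simp
    ultimately have "q i ^ ell d i dvd b ^ (period s * c) - 1"
      by (simp add: cong_altdef_nat)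
    then show ?thesis by (simp add: X_def)
  qed
  have "modulus q d n dvd X" if "n \<le> s" for n
    using that
  proof (induction n)
    case (Suc n)
    have "q (Suc n) ^ ell d (Suc n) dvd X" using * Suc.prems by auto
    moreover have "coprime (modulus q d n) (q (Suc n) ^ ell d (Suc n))"
      using coprime_q_modulus[of n n] by (simp add: coprime_commute)
    ultimately show ?case
      using Suc by (simp add: modulus_Suc divides_mult)
  qed simp
  then show ?thesis by (simp add: X_def)
qed

definition block_bound :: "real \<Rightarrow> nat \<Rightarrow> real \<Rightarrow> real" where
  "block_bound \<kappa> s \<xi> = (\<Prod>j<ell d (Suc s). digit_factor \<kappa> (\<xi> / (modulus q d s * q (Suc s) ^ Suc j)))"

lemma block_bound_bounds:
  assumes "0 \<le> \<kappa>" "\<kappa> \<le> 1/2"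
  shows "0 \<le> block_bound \<kappa> s \<xi>" "block_bound \<kappa> s \<xi> \<le> 1"
  unfolding block_bound_def using digit_factor_bounds[OF assms]
  by (auto intro!: prod_nonneg prod_le_1)

lemma block_bound_uminus: "block_bound \<kappa> s (- \<xi>) = block_bound \<kappa> s \<xi>"
  by (simp add: block_bound_def digit_factor_uminus)

context
  fixes b s a :: nat
  assumes b: "b \<ge> 2" and qb: "\<not> q (Suc s) dvd b"
    and a: "a = multiplicity (q (Suc s)) (b ^ (q (Suc s) - 1) - 1)"
begin

lemma q_dvd_power_minus_1: "q (Suc s) dvd b ^ (q (Suc s) - 1) - 1"
proof -
  have "[b ^ (q (Suc s) - 1) = 1] (mod q (Suc s))"
    using q_prime[of "Suc s"] qb by (intro fermat_theorem) auto
  moreover have "1 \<le> b ^ (q (Suc s) - 1)" using b by simp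
  ultimately show ?thesis by (simp add: cong_altdef_nat)
qed

lemma power_gt_1: "n > 0 \<Longrightarrow> b ^ n > 1"
  using b by (intro one_less_power) auto

lemma multiplicity_b_power: "n > 0 \<Longrightarrow>
    multiplicity (q (Suc s)) (b ^ ((q (Suc s) - 1) * n) - 1) = a + multiplicity (q (Suc s)) n"
  unfolding power_mult a
  using q_prime[of "Suc s"] odd_q[of "Suc s"] q_dvd_power_minus_1 q_Suc_ge[of s] power_gt_1
  by (intro multiplicity_power_minus_1_nat) auto

lemma order_valuation_pos: "a \<ge> 1"
  unfolding a
  using q_dvd_power_minus_1 q_prime[of "Suc s"] power_gt_1[of "q (Suc s) - 1"] q_Suc_ge[of s] not_prime_unit[of "q (Suc s)"]
  by (intro multiplicity_geI) auto

text \<open>After the first b^d exponents, the range is covered by windows of length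
  \<open>T\<close>. Within a window each residue class modulo \<open>T1\<close> is a geometric orbit
  of length p^r with ratio b^T1, and the orbit average applies to it.\<close>

lemma sum_block_bound_le:
  fixes h k N r :: nat and \<kappa> :: real
  assumes h: "h > 0" "\<not> q (Suc s) dvd h" and k: "k \<ge> 1"
    and r: "a + multiplicity (q (Suc s)) (b ^ k - 1) + r \<le> ell d (Suc s)"
    and N: "N \<ge> modulus q d (Suc s)" and \<kappa>: "0 \<le> \<kappa>" "\<kappa> \<le> 1/2"
  shows "(\<Sum>m<N. block_bound \<kappa> s (h * (b ^ k - 1) * b ^ m)) \<le> b ^ d + 2 * N * (1 - \<kappa>) ^ r"
proof -
  let ?p = "q (Suc s)" and ?A = "modulus q d s"
  define f where "f m = block_bound \<kappa> s (h * (b ^ k - 1) * b ^ m)" for m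
  define T1 where "T1 = period s * (?p - 1)"
  define T where "T = ?p ^ r * T1"
  define n where "n = N div T + 1"
  have p: "prime ?p" "odd ?p" "?p \<ge> 7" using q_prime odd_q q_Suc_ge[of s] by auto
  have T1: "T1 > 0" using p period_pos by (simp add: T1_def)
  then have T: "T > 0" using p by (simp add: T_def)
  have f0: "0 \<le> f m" "f m \<le> 1" for m
    unfolding f_def by (rule block_bound_bounds[OF \<kappa>])+
  \<comment> \<open>One spare digit pays for the factor p - 1 in \<open>T1\<close>: the valuation a
    is at least 1, hence r + 1 is at most the block length.\<close>
  have TN: "T \<le> N"
  proof -
    have "T \<le> ?p ^ r * (?A * ?p)"
      unfolding T_def T1_def by (intro mult_le_mono period_le) auto
    also have "\<dots> = ?A * ?p ^ Suc r" by simp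
    also have "\<dots> \<le> ?A * ?p ^ ell d (Suc s)"
      using order_valuation_pos r p by (intro mult_le_mono power_increasing) auto
    finally show ?thesis using N by (simp add: modulus_Suc)
  qed
  have orbit: "(\<Sum>t<?p ^ r. f (b ^ d + c + t * T1)) \<le> (?p * (1 - \<kappa>)) ^ r" for c
  proof -
    define x where "x = h * (b ^ k - 1) * b ^ (b ^ d + c)"
    define y where "y = b ^ T1"
    have "f (b ^ d + c + t * T1) = (\<Prod>j<ell d (Suc s). digit_factor \<kappa> (real (x * y ^ t) / (?A * ?p ^ Suc j)))" for t
      unfolding f_def block_bound_def x_def y_def
      by (simp add: power_add power_mult[symmetric] mult.commute mult.left_commute)
    moreover have "(\<Sum>t<?p ^ r. \<Prod>j<ell d (Suc s). digit_factor \<kappa> (real (x * y ^ t) / (?A * ?p ^ Suc j))) \<le> (?p * (1 - \<kappa>)) ^ r"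
    proof (rule sum_orbit_le[OF p(1,2) modulus_pos _ _ _ _ _ refl refl _ \<kappa>])
      show "coprime ?p ?A" by (rule coprime_q_modulus) simp
      have "b ^ k - 1 > 0" using power_gt_1[of k] k by simp
      then show "x > 0" using h b by (simp add: x_def)
      show "y > 1" using power_gt_1 T1 by (simp add: y_def)
      have "?A dvd b ^ (b ^ d + c) * (y - 1)"
        unfolding y_def T1_def by (rule modulus_dvd_power[OF b]) simp
      then show "?A dvd x * (y - 1)"
        unfolding x_def by (metis dvd_mult mult.assoc)
      have my: "multiplicity ?p (y - 1) = a"
        unfolding y_def T1_def using multiplicity_b_power[of "period s"] period_pos q_not_dvd_period[of s s]
        by (simp add: mult.commute not_dvd_imp_multiplicity_0)
      then show "?p dvd y - 1"
        using order_valuation_pos by (metis not_dvd_imp_multiplicity_0 not_one_le_zero)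
      have "multiplicity ?p x = multiplicity ?p (b ^ k - 1)"
        using \<open>b ^ k - 1 > 0\<close> h b qb p
        by (simp add: x_def prime_elem_multiplicity_mult_distrib prime_elem_multiplicity_power_distrib
             prime_imp_prime_elem not_dvd_imp_multiplicity_0)
      then show "multiplicity ?p (y - 1) + multiplicity ?p x + r \<le> ell d (Suc s)"
        using r my by simp
    qed
    ultimately show ?thesis by simp
  qed
  \<comment> \<open>Rounding up to whole windows costs at most one window, of length at most N; this
    is the factor 2 in the bound.\<close>
  have "N \<le> n * T"
    using div_mult_mod_eq[of N T] mod_less_divisor[OF T, of N] unfolding n_def add_mult_distrib by linarith
  then have "(\<Sum>m<N. f m) \<le> (\<Sum>m<b ^ d + n * T. f m)"
    by (intro sum_mono2) (auto simp: f0)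
  also have "\<dots> = (\<Sum>m<b ^ d. f m) + (\<Sum>m<n * T. f (b ^ d + m))"
  proof -
    have "(\<Sum>m<c + j. f m) = (\<Sum>m<c. f m) + (\<Sum>m<j. f (c + m))" for c j
      by (induction j) (simp_all add: add.assoc)
    then show ?thesis .
  qed
  also have "(\<Sum>m<b ^ d. f m) \<le> (\<Sum>m<b ^ d. 1)"
    by (intro sum_mono f0)
  also have "(\<Sum>m<n * T. f (b ^ d + m)) = (\<Sum>i<n. \<Sum>t<?p ^ r. \<Sum>c<T1. f (b ^ d + (i * T + (t * T1 + c))))"
    unfolding sum_lessThan_mult[of _ n T] unfolding T_def sum_lessThan_mult[of _ "?p ^ r" T1] ..
  also have "\<dots> = (\<Sum>i<n. \<Sum>c<T1. \<Sum>t<?p ^ r. f (b ^ d + (i * T + c) + t * T1))"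
    by (subst sum.swap[of _ "{..<T1}"]) (simp add: ac_simps)
  also have "\<dots> \<le> (\<Sum>i<n. \<Sum>c<T1. (?p * (1 - \<kappa>)) ^ r)"
    by (intro sum_mono orbit)
  also have "\<dots> = real (n * T) * (1 - \<kappa>) ^ r"
    by (simp add: T_def power_mult_distrib)
  also have "n * T \<le> 2 * N"
    using TN div_times_less_eq_dividend[of N T] unfolding n_def add_mult_distrib by linarith
  then have "real (n * T) \<le> real (2 * N)" by (simp only: of_nat_le_iff)
  then have "real (n * T) * (1 - \<kappa>) ^ r \<le> real (2 * N) * (1 - \<kappa>) ^ r"
    using \<kappa> by (intro mult_right_mono) auto
  finally show ?thesis by (simp add: f_def)
qed

text \<open>For general k the prime need not divide b^k - 1, but this number divides b^((p-1) k) -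
  1, to which lifting the exponent applies.\<close>

lemma multiplicity_power_minus_1_le:
  assumes "k \<ge> 1"
  shows "multiplicity (q (Suc s)) (b ^ k - 1) \<le> a + multiplicity (q (Suc s)) k"
proof -
  have "b ^ k - 1 dvd b ^ ((q (Suc s) - 1) * k) - 1"
  proof -
    have "(int b ^ k - 1) dvd ((int b ^ k) ^ (q (Suc s) - 1) - 1)" by (simp add: power_diff_1_eq)
    then have "int (b ^ k - 1) dvd int (b ^ ((q (Suc s) - 1) * k) - 1)"
      using b by (simp add: of_nat_diff power_mult[symmetric] mult.commute)
    then show ?thesis by (simp only: of_nat_dvd_iff)
  qed
  moreover have "b ^ ((q (Suc s) - 1) * k) - 1 \<noteq> 0"
    using power_gt_1[of "(q (Suc s) - 1) * k"] assms q_Suc_ge[of s] by auto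
  ultimately show ?thesis
    using multiplicity_b_power[of k] assms by (metis dvd_imp_multiplicity_le less_le_trans zero_less_one)
qed

text \<open>The exponents k divisible by p^V are too few to matter and get the trivial bound. For
  the others at most a + (a + V) digits are lost, and the budget 2a + 2V leaves V uniform
  digits.\<close>

lemma double_sum_block_bound_le:
  fixes h N V :: nat and \<kappa> :: real
  assumes h: "h > 0" "\<not> q (Suc s) dvd h" 
    and V: "2 * a + 2 * V \<le> ell d (Suc s)"
    and N: "N \<ge> modulus q d (Suc s)" and \<kappa>: "0 \<le> \<kappa>" "\<kappa> \<le> 1/2"
  shows "(\<Sum>k\<in>{1..<N}. \<Sum>m<N. block_bound \<kappa> s (h * (b ^ k - 1) * b ^ m)) \<le> N * b ^ d + 3 * N\<^sup>2 * (1 - \<kappa>) ^ V"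
proof -
  let ?p = "q (Suc s)"
  define S where "S k = (\<Sum>m<N. block_bound \<kappa> s (h * (b ^ k - 1) * b ^ m))" for k
  define X where "X = {k \<in> {1..<N}. ?p ^ V dvd k}"
  have p: "prime ?p" "?p \<ge> 7" using q_prime q_Suc_ge[of s] by auto
  have good: "S k \<le> b ^ d + 2 * N * (1 - \<kappa>) ^ V" if k: "k \<in> {1..<N} - X" for k
  proof -
    from k have "\<not> ?p ^ V dvd k" "k \<ge> 1" by (auto simp: X_def)
    then have "multiplicity ?p k < V"
      using multiplicity_dvd'[of V ?p k] by force
    then show ?thesis
      unfolding S_def using multiplicity_power_minus_1_le[OF \<open>k \<ge> 1\<close>] V
      by (intro sum_block_bound_le h N \<kappa> \<open>k \<ge> 1\<close>) linarith
  qed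
  have bad: "S k \<le> N" for k
    unfolding S_def using sum_bounded_above[of "{..<N}" _ "1::real"] block_bound_bounds(2)[OF \<kappa>] by simp
  have "(\<Sum>k\<in>{1..<N}. S k) = (\<Sum>k\<in>X. S k) + (\<Sum>k\<in>{1..<N} - X. S k)"
    by (subst add.commute, rule sum.subset_diff) (auto simp: X_def)
  also have "(\<Sum>k\<in>X. S k) \<le> real (card X) * N"
    using bad by (intro sum_bounded_above) auto
  also have "\<dots> \<le> real N / real (?p ^ V) * N"
    unfolding X_def using p by (intro mult_right_mono card_multiples_le) auto
  also have "\<dots> \<le> N\<^sup>2 * (1 - \<kappa>) ^ V"
  proof -
    \<comment> \<open>The density of the exceptional k is absorbed in the same exponential: 1/p
      \<le> 1/2 \<le> 1 - \<kappa>.\<close>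
    have "1 / real ?p ^ V \<le> (1 - \<kappa>) ^ V"
      unfolding power_one_over[symmetric]
    proof (rule power_mono)
      have "1 / real ?p \<le> 1 / 2" using p by (intro divide_left_mono) auto
      then show "1 / real ?p \<le> 1 - \<kappa>" using \<kappa> by linarith
    qed simp
    then show ?thesis
      using mult_left_mono[of "1 / real ?p ^ V" _ "(real N)\<^sup>2"] by (simp add: power2_eq_square)
  qed
  also have "(\<Sum>k\<in>{1..<N} - X. S k) \<le> real (card ({1..<N} - X)) * (b ^ d + 2 * N * (1 - \<kappa>) ^ V)"
    using good by (intro sum_bounded_above) auto
  also have "\<dots> \<le> N * (b ^ d + 2 * N * (1 - \<kappa>) ^ V)"
  proof -
    have "card ({1..<N} - X) \<le> card {1..<N}" by (intro card_mono) auto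
    then show ?thesis using \<kappa> by (intro mult_right_mono add_nonneg_nonneg mult_nonneg_nonneg) auto
  qed
  finally show ?thesis by (simp add: S_def power2_eq_square algebra_simps)
qed

end

end

section \<open>Growth of the moduli and summability in the DEL criterion\<close>

lemma summable_inverse_ln_square: "summable (\<lambda>n. 1 / (real n * (ln (real n))\<^sup>2))"
proof -
  have "summable (\<lambda>n. 1 / (real (n + 2) * (ln (real (n + 2)))\<^sup>2))"
  proof -
    \<comment> \<open>Cauchy condensation needs a decreasing sequence, but division by
      \<open>ln 1 = 0\<close> yields 0 at index 1. The values below 2 are therefore replaced by the
      value at 2.\<close>
    define f where "f n = (if n \<ge> 2 then 1 / (real n * (ln (real n))\<^sup>2) else 1 / (2 * (ln 2)\<^sup>2))" for n :: nat
    have "summable (\<lambda>n. 2 ^ n * f (2 ^ n))"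
    proof (rule summable_comparison_test_ev)
      have "norm (2 ^ n * f (2 ^ n)) \<le> 1 / (ln 2)\<^sup>2 * (1 / real n ^ 2)" if "n \<ge> 1" for n
      proof -
        have "(2::nat) ^ n \<ge> 2 ^ 1" using that by (intro power_increasing) auto
        then show ?thesis by (simp add: f_def ln_realpow power_mult_distrib mult.commute)
      qed
      then show "\<forall>\<^sub>F n in sequentially. norm (2 ^ n * f (2 ^ n)) \<le> 1 / (ln 2)\<^sup>2 * (1 / real n ^ 2)"
        by (rule eventually_sequentiallyI[of 1])
      show "summable (\<lambda>n. 1 / (ln 2)\<^sup>2 * (1 / real n ^ 2))"
        using inverse_power_summable[of 2, where 'a=real] by (intro summable_mult) (simp add: inverse_eq_divide)
    qed
    moreover have "f (Suc m) \<le> f m" if "m > 0" for m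
    proof (cases "m \<ge> 2")
      case True
      then have "real m * (ln (real m))\<^sup>2 \<le> real (Suc m) * (ln (real (Suc m)))\<^sup>2"
        by (intro mult_mono power_mono) auto
      moreover have "real m * (ln (real m))\<^sup>2 > 0" using True by simp
      ultimately show ?thesis using True by (simp add: f_def frac_le)
    next
      case False
      with that have "m = 1" by simp
      then show ?thesis by (simp add: f_def numeral_2_eq_2[symmetric])
    qed
    moreover have "f n \<ge> 0" for n by (simp add: f_def)
    ultimately have "summable f"
      using condensation_test[of f] by blast
    then have "summable (\<lambda>n. f (n + 2))" by (rule summable_ignore_initial_segment)
    then show ?thesis by (simp add: f_def)
  qed
  then show ?thesis by (subst (asm) summable_iff_shift)
qed

lemma bounded_power_times_poly:
  fixes \<rho> :: real
  assumes "0 < \<rho>" "\<rho> < 1"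
  obtains C where "\<And>v. \<rho> ^ v * (real v + 1) ^ K \<le> C"
proof -
  have "((\<lambda>v. \<rho> ^ v * (real v + 1) ^ K) \<longlongrightarrow> 0) at_top"
    using assms by real_asymp
  then have "Bseq (\<lambda>v. \<rho> ^ v * (real v + 1) ^ K)"
    using convergent_imp_Bseq convergentI by blast
  then obtain C where "\<And>v. norm (\<rho> ^ v * (real v + 1) ^ K) \<le> C"
    by (auto simp: Bseq_def)
  then show thesis by (intro that[of C]) (metis abs_le_D1 real_norm_def)
qed

context moran
begin

lemma q_le_poly:
  assumes "(\<lambda>n. real (q n)) \<in> O(\<lambda>n. real n ^ d)"
  obtains C where "C \<ge> 1" "\<And>i. i \<ge> 1 \<Longrightarrow> real (q i) \<le> C * real (ell d i)"
proof -
  obtain c where c: "\<forall>\<^sub>F n in at_top. norm (real (q n)) \<le> c * norm (real n ^ d)" "c > 0"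
    using assms by (elim landau_o.bigE)
  then obtain N where N: "\<And>n. n \<ge> N \<Longrightarrow> real (q n) \<le> c * real n ^ d"
    by (auto simp: eventually_at_top_linorder)
  \<comment> \<open>The sum absorbs the finitely many indices where the asymptotic bound may fail;
    this works because every \<open>ell d i\<close> is at least 1.\<close>
  define C where "C = c + 1 + (\<Sum>i\<le>N. real (q i))"
  have S: "(\<Sum>i\<le>N. real (q i)) \<ge> 0" by (intro sum_nonneg) auto
  show thesis
  proof (rule that[of C])
    show "C \<ge> 1" using c(2) S by (simp add: C_def)
    fix i :: nat assume i: "i \<ge> 1"
    have l: "real (ell d i) \<ge> 1" using ell_ge_1[OF i] by simp
    show "real (q i) \<le> C * real (ell d i)"
    proof (cases "i \<ge> N")
      case True
      then have "real (q i) \<le> c * real (ell d i)" using N[of i] by (simp add: ell_def)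
      also have "\<dots> \<le> C * real (ell d i)"
        using S by (intro mult_right_mono) (auto simp: C_def)
      finally show ?thesis .
    next
      case False
      then have "real (q i) \<le> (\<Sum>i\<le>N. real (q i))" by (intro member_le_sum) auto
      also have "\<dots> \<le> C * 1" using c(2) by (simp add: C_def)
      also have "\<dots> \<le> C * real (ell d i)" using l S c(2) by (intro mult_left_mono) (auto simp: C_def)
      finally show ?thesis .
    qed
  qed
qed

text \<open>The crude estimate ln q_i \<le> q_i is affordable, since any polynomial bound in n loses
  against the exponential gain of a block.\<close>

lemma ln_modulus_le:
  assumes C: "C \<ge> 1" "\<And>i. i \<ge> 1 \<Longrightarrow> real (q i) \<le> C * real (ell d i)"
  shows "ln (modulus q d n) \<le> C * real n ^ (2 * d + 1)"
proof -
  have "ln (modulus q d n) = (\<Sum>i=1..n. ln (real (q i ^ ell d i)))"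
    unfolding modulus_def of_nat_prod using q_ge by (subst ln_prod) (force simp: zero_less_power)+
  also have "\<dots> \<le> (\<Sum>i=1..n. C * real n ^ (2 * d))"
  proof (rule sum_mono)
    fix i assume i: "i \<in> {1..n}"
    have q: "real (q i) > 0" using q_ge[of i] i by auto
    have "ln (real (q i ^ ell d i)) = real (ell d i) * ln (real (q i))"
      using q by (simp add: ln_realpow)
    also have "\<dots> \<le> real (ell d i) * (C * real (ell d i))"
      using C(2)[of i] i ln_le_minus_one[OF q] by (intro mult_left_mono) auto
    also have "\<dots> = C * (real i ^ (2 * d))"
      by (simp add: ell_def mult_2 power_add)
    also have "\<dots> \<le> C * real n ^ (2 * d)"
      using C i by (intro mult_left_mono power_mono) auto
    finally show "ln (real (q i ^ ell d i)) \<le> C * real n ^ (2 * d)" .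
  qed
  also have "\<dots> = C * real n ^ (2 * d + 1)" by simp
  finally show ?thesis .
qed

text \<open>From p^a \<le> b^p one gets a ln p \<le> p ln b, and p is at most a constant times the
  block length by the growth condition on q. As ln p tends to infinity, a is eventually at most a
  quarter of the block.\<close>

lemma eventually_multiplicity_le:
  assumes C: "C \<ge> 1" "\<And>i. i \<ge> 1 \<Longrightarrow> real (q i) \<le> C * real (ell d i)"
    and b: "b \<ge> 2"
  shows "\<forall>\<^sub>F s in sequentially. 4 * multiplicity (q (Suc s)) (b ^ (q (Suc s) - 1) - 1) \<le> ell d (Suc s)"
proof -
  have "filterlim (\<lambda>s. ln (real s)) at_top sequentially" by real_asymp
  then have "\<forall>\<^sub>F s in sequentially. ln (real s) \<ge> 4 * C * ln b"
    by (simp add: filterlim_at_top)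
  then show ?thesis
    using eventually_ge_at_top[of 1]
  proof eventually_elim
    case (elim s)
    let ?p = "q (Suc s)"
    define a where "a = multiplicity ?p (b ^ (?p - 1) - 1)"
    have p: "?p \<ge> s + 7" by (rule q_Suc_ge)
    have "b ^ (?p - 1) > 1" using b p by (intro one_less_power) auto
    then have "?p ^ a \<le> b ^ (?p - 1) - 1"
      unfolding a_def by (intro dvd_imp_le multiplicity_dvd) auto
    also have "\<dots> \<le> b ^ ?p" using b by (intro order_trans[OF diff_le_self] power_increasing) auto
    finally have "real (?p ^ a) \<le> real (b ^ ?p)" by (simp only: of_nat_le_iff)
    then have "ln (real (?p ^ a)) \<le> ln (real (b ^ ?p))"
      using p b by (subst ln_le_cancel_iff) auto
    then have "a * ln ?p \<le> ?p * ln b" using p b by (simp add: ln_realpow)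
    also have "\<dots> \<le> (C * ell d (Suc s)) * ln b"
      using C(2)[of "Suc s"] b by (intro mult_right_mono) auto
    finally have 1: "a * ln ?p \<le> C * ell d (Suc s) * ln b" .
    have "ln (real s) \<le> ln (real ?p)" using p elim by (subst ln_le_cancel_iff) auto
    with elim have "4 * C * ln b \<le> ln (real ?p)" by linarith
    then have "a * (4 * C * ln b) \<le> a * ln ?p" by (intro mult_left_mono) auto
    with 1 have "(4 * a) * (C * ln b) \<le> ell d (Suc s) * (C * ln b)" by (simp add: algebra_simps)
    moreover have "C * ln b > 0" using C b by simp
    ultimately have "real (4 * a) \<le> real (ell d (Suc s))" by (rule mult_right_le_imp_le)
    then show "4 * a \<le> ell d (Suc s)" by (simp only: of_nat_le_iff)
  qed
qed

lemma block_index: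
  assumes "modulus q d (Suc s0) \<le> N"
  obtains s where "s0 \<le> s" "modulus q d (Suc s) \<le> N" "N < modulus q d (Suc (Suc s))"
proof -
  define P where "P s \<longleftrightarrow> N < modulus q d s" for s
  have ex: "P N"
    unfolding P_def using modulus_ge[of N] less_le_trans[OF less_exp[of N] order_trans[OF power_mono[of 2 7 N]]] by simp
  define s where "s = (LEAST s. P s)"
  have s: "P s" unfolding s_def by (rule LeastI) (rule ex)
  have less: "\<not> P t" if "t < s" for t using that not_less_Least unfolding s_def by blast
  have mono: "modulus q d m \<le> modulus q d n" if "m \<le> n" for m n
    using that
  proof (induction n rule: dec_induct)
    case (step n)
    then show ?case using modulus_Suc_ge[of n] by linarith
  qed simp
  have "Suc s0 < s"
  proof (rule ccontr)
    assume "\<not> Suc s0 < s"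
    then have "modulus q d s \<le> modulus q d (Suc s0)" by (intro mono) simp
    with s assms show False by (simp add: P_def)
  qed
  then have s': "s = Suc (Suc (s - 2))" by linarith
  show thesis
    using s less[of "Suc (s - 2)"] s' \<open>Suc s0 < s\<close> by (intro that[of "s - 2"]) (auto simp: P_def)
qed

theorem DEL_criterion_of_bound:
  assumes bigo: "(\<lambda>n. real (q n)) \<in> O(\<lambda>n. real n ^ d)"
    and \<kappa>: "0 < \<kappa>" "\<kappa> \<le> 1/2"
    and bound: "\<And>s \<xi>. norm (fourier_transform \<mu> \<xi>) \<le> block_bound \<kappa> s \<xi>"
    and b: "b \<ge> 2"
  shows "DEL_criterion \<mu> b"
  unfolding DEL_criterion_def
proof (intro allI impI)
  fix h :: int assume h: "h \<noteq> 0"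
  obtain C where C: "C \<ge> 1" "\<And>i. i \<ge> 1 \<Longrightarrow> real (q i) \<le> C * real (ell d i)"
    using q_le_poly[OF bigo] by blast
  define h' where "h' = nat \<bar>h\<bar>"
  have h': "h' > 0" using h by (simp add: h'_def)
  define \<rho> where "\<rho> = 1 - \<kappa>"
  have \<rho>: "0 < \<rho>" "\<rho> < 1" using \<kappa> by (auto simp: \<rho>_def)
  note \<kappa>' = less_imp_le[OF \<kappa>(1)] \<kappa>(2)
  have ft1: "norm (fourier_transform \<mu> \<xi>) \<le> 1" for \<xi>
    using bound[of \<xi> 0] block_bound_bounds(2)[OF \<kappa>', of 0 \<xi>] by linarith
  let ?ft = "\<lambda>n m. fourier_transform \<mu> (of_int h * (of_nat b ^ n - of_nat b ^ m))"
  define D where "D N = norm (\<Sum>m<N. \<Sum>n<N. ?ft n m)" for N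
  \<comment> \<open>Up to sign the frequency is |h| (b^(n-m) - 1) b^m, and the block bound is even,
    so both orders of m and n share one estimate.\<close>
  have off: "norm (?ft n m)
      \<le> block_bound \<kappa> s (h' * (b ^ (n - m) - 1) * b ^ m)"
      "norm (?ft m n)
      \<le> block_bound \<kappa> s (h' * (b ^ (n - m) - 1) * b ^ m)" if "m < n" for m n s
  proof -
    define \<xi> where "\<xi> = real_of_int h * (real b ^ n - real b ^ m)"
    have "real b ^ n = real b ^ (n - m) * real b ^ m" using that by (simp flip: power_add)
    moreover have "real (b ^ (n - m) - 1) = real b ^ (n - m) - 1" using b by (simp add: of_nat_diff)
    ultimately have e: "real (h' * (b ^ (n - m) - 1) * b ^ m) = real h' * (real b ^ n - real b ^ m)"
      by (simp only: of_nat_mult of_nat_power) (simp add: algebra_simps)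
    have hh: "real_of_int h = real h' \<or> real_of_int h = - real h'"
      unfolding h'_def by (cases "h \<ge> 0") auto
    have "\<xi> = real (h' * (b ^ (n - m) - 1) * b ^ m) \<or> \<xi> = - real (h' * (b ^ (n - m) - 1) * b ^ m)"
      unfolding e \<xi>_def using hh by (elim disjE) simp_all
    then have "block_bound \<kappa> s \<xi> = block_bound \<kappa> s (h' * (b ^ (n - m) - 1) * b ^ m)"
      "block_bound \<kappa> s (- \<xi>) = block_bound \<kappa> s (h' * (b ^ (n - m) - 1) * b ^ m)"
      using block_bound_uminus by auto
    moreover have "of_int h * (of_nat b ^ m - of_nat b ^ n) = - \<xi>" by (simp add: \<xi>_def algebra_simps)
    ultimately show "norm (?ft n m)
        \<le> block_bound \<kappa> s (h' * (b ^ (n - m) - 1) * b ^ m)"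
      "norm (?ft m n)
        \<le> block_bound \<kappa> s (h' * (b ^ (n - m) - 1) * b ^ m)"
      using bound[of \<xi> s] bound[of "- \<xi>" s] by (simp_all add: \<xi>_def)
  qed
  \<comment> \<open>The N diagonal terms are bounded by 1; the off-diagonal ones are indexed by the
    difference k = n - m, with m relaxed to the full range.\<close>
  have D_le: "D N \<le> N + 2 * (\<Sum>k\<in>{1..<N}. \<Sum>m<N. block_bound \<kappa> s (h' * (b ^ k - 1) * b ^ m))" for N s
  proof -
    define G where "G k m = block_bound \<kappa> s (h' * (b ^ k - 1) * b ^ m)" for k m :: nat
    have G0: "G k m \<ge> 0" for k m unfolding G_def by (rule block_bound_bounds[OF \<kappa>'])
    have half: "(\<Sum>n<N. if m < n then G (n - m) m else 0) \<le> (\<Sum>k\<in>{1..<N}. G k m)" for m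
    proof -
      have "(\<Sum>n<N. if m < n then G (n - m) m else 0) = (\<Sum>n\<in>{n. n < N \<and> m < n}. G (n - m) m)"
        by (simp add: sum.If_cases Int_def conj_commute lessThan_def)
      also have "\<dots> = (\<Sum>k\<in>(\<lambda>n. n - m) ` {n. n < N \<and> m < n}. G k m)"
        by (subst sum.reindex) (auto intro!: inj_onI)
      also have "\<dots> \<le> (\<Sum>k\<in>{1..<N}. G k m)"
        by (intro sum_mono2) (auto simp: G0)
      finally show ?thesis .
    qed
    have "D N \<le> (\<Sum>m<N. \<Sum>n<N. norm (?ft n m))"
      unfolding D_def by (intro order_trans[OF norm_sum] sum_mono norm_sum)
    also have "\<dots> \<le> (\<Sum>m<N. \<Sum>n<N. (if m = n then 1 else 0) + ((if m < n then G (n - m) m else 0) + (if n < m then G (m - n) n else 0)))"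
    proof (intro sum_mono)
      fix m n
      show "norm (?ft n m) \<le>
          (if m = n then 1 else 0) + ((if m < n then G (n - m) m else 0) + (if n < m then G (m - n) n else 0))"
        using ft1 off(1)[of m n s] off(2)[of n m s] by (cases m n rule: linorder_cases) (auto simp: G_def)
    qed
    also have "\<dots> = N + ((\<Sum>m<N. \<Sum>n<N. if m < n then G (n - m) m else 0) + (\<Sum>m<N. \<Sum>n<N. if n < m then G (m - n) n else 0))"
      by (simp add: sum.distrib)
    also have "(\<Sum>m<N. \<Sum>n<N. if n < m then G (m - n) n else 0) = (\<Sum>m<N. \<Sum>n<N. if m < n then G (n - m) m else 0)"
      by (rule sum.swap)
    also have "(\<Sum>m<N. \<Sum>n<N. if m < n then G (n - m) m else 0) \<le> (\<Sum>m<N. \<Sum>k\<in>{1..<N}. G k m)"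
      by (intro sum_mono half)
    also have "(\<Sum>m<N. \<Sum>k\<in>{1..<N}. G k m) = (\<Sum>k\<in>{1..<N}. \<Sum>m<N. G k m)" by (rule sum.swap)
    finally show ?thesis by (simp add: G_def)
  qed
  obtain s1 where s1: "\<And>s. s \<ge> s1 \<Longrightarrow> 4 * multiplicity (q (Suc s)) (b ^ (q (Suc s) - 1) - 1) \<le> ell d (Suc s)"
    using eventually_multiplicity_le[OF C b] by (auto simp: eventually_at_top_linorder)
  \<comment> \<open>Beyond this index q_(s+1) exceeds both b and |h|, so it divides neither.\<close>
  define s0 where "s0 = max s1 (b + h')"
  obtain C' where C': "\<And>v. \<rho> ^ v * (real v + 1) ^ (4 * d + 2) \<le> C'"
    using bounded_power_times_poly[OF \<rho>] by blast
  define C'' where "C'' = C\<^sup>2 * 6 ^ (4 * d + 2) * C'"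
  have main: "D N / N ^ 3 \<le> (1 + 2 * b ^ d) * (1 / real N ^ 2) + 6 * C'' * (1 / (N * (ln N)\<^sup>2))"
    if N: "N \<ge> modulus q d (Suc s0)" for N
  proof -
    obtain s where s: "s0 \<le> s" "modulus q d (Suc s) \<le> N" "N < modulus q d (Suc (Suc s))"
      using block_index[OF N] .
    \<comment> \<open>A quarter of the block: with 4a at most the block length, the budget 2a + 2V
      fits.\<close>
    define V where "V = ell d (Suc s) div 4"
    have N2: "N \<ge> 7" using s(2) modulus_ge[of "Suc s"] self_le_power[of "7::nat" "Suc s"] by linarith
    have qs: "q (Suc s) > b" "q (Suc s) > h'" using q_Suc_ge[of s] s(1) by (auto simp: s0_def)
    then have "\<not> q (Suc s) dvd b" "\<not> q (Suc s) dvd h'"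
      using b h' by (auto dest!: dvd_imp_le)
    moreover have "2 * multiplicity (q (Suc s)) (b ^ (q (Suc s) - 1) - 1) + 2 * V \<le> ell d (Suc s)"
      using s1[of s] s(1) by (simp add: s0_def V_def)
    ultimately have "(\<Sum>k\<in>{1..<N}. \<Sum>m<N. block_bound \<kappa> s (h' * (b ^ k - 1) * b ^ m)) \<le> N * b ^ d + 3 * N\<^sup>2 * \<rho> ^ V"
      unfolding \<rho>_def using double_sum_block_bound_le[OF b _ refl h' _ _ s(2) \<kappa>'] by blast
    with D_le[of N s] have "D N \<le> N + 2 * (N * b ^ d + 3 * N\<^sup>2 * \<rho> ^ V)" by simp
    then have "D N / N ^ 3 \<le> (N + 2 * (N * b ^ d + 3 * N\<^sup>2 * \<rho> ^ V)) / N ^ 3"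
      by (intro divide_right_mono) auto
    also have "\<dots> = (1 + 2 * b ^ d) * (1 / real N ^ 2) + 6 * (\<rho> ^ V / N)"
      using N2 by (simp add: field_simps power2_eq_square power3_eq_cube)
    also have "\<rho> ^ V / N \<le> C'' * (1 / (N * (ln N)\<^sup>2))"
    proof -
      \<comment> \<open>A lower bound for \<open>V\<close> that is linear in s. It serves as the
        common parameter: ln N is bounded by a polynomial in v, the gain by
        \<open>\<rho> ^ v\<close>.\<close>
      define v where "v = (s + 1) div 4"
      have "\<rho> ^ V \<le> \<rho> ^ v"
        using \<rho> ell_Suc_ge[of s] by (intro power_decreasing) (auto simp: V_def v_def div_le_mono)
      have lnN: "0 < ln (real N)" using N2 by simp
      have "ln (real N) \<le> ln (real (modulus q d (Suc (Suc s))))"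
        using N2 s(3) by (subst ln_le_cancel_iff) auto
      also have "\<dots> \<le> C * real (Suc (Suc s)) ^ (2 * d + 1)"
        by (rule ln_modulus_le[OF C])
      also have "\<dots> \<le> C * (6 * (real v + 1)) ^ (2 * d + 1)"
      proof (intro mult_left_mono power_mono)
        have "Suc (Suc s) \<le> 6 * (v + 1)" unfolding v_def by presburger
        then have "real (Suc (Suc s)) \<le> real (6 * (v + 1))" by (simp only: of_nat_le_iff)
        then show "real (Suc (Suc s)) \<le> 6 * (real v + 1)" by simp
      qed (use C in auto)
      finally have "(ln (real N))\<^sup>2 \<le> (C * (6 * (real v + 1)) ^ (2 * d + 1))\<^sup>2"
        using lnN by (intro power_mono) auto
      also have "\<dots> = C\<^sup>2 * 6 ^ (4 * d + 2) * (real v + 1) ^ (4 * d + 2)"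
      proof -
        have "(2 * d + 1) * 2 = 4 * d + 2" by simp
        then show ?thesis by (simp only: power_mult_distrib power_mult[symmetric] mult.assoc)
      qed
      finally have "\<rho> ^ V * (ln (real N))\<^sup>2 \<le> \<rho> ^ v * (C\<^sup>2 * 6 ^ (4 * d + 2) * (real v + 1) ^ (4 * d + 2))"
        using \<open>\<rho> ^ V \<le> \<rho> ^ v\<close> \<rho> by (intro mult_mono) auto
      also have "\<dots> = C\<^sup>2 * 6 ^ (4 * d + 2) * (\<rho> ^ v * (real v + 1) ^ (4 * d + 2))" by simp
      also have "\<dots> \<le> C''"
        unfolding C''_def by (intro mult_left_mono C') auto
      finally show ?thesis using lnN N2 by (simp add: field_simps)
    qed
    finally show ?thesis by simp
  qed
  have "summable (\<lambda>N. norm (1 / of_nat N ^ 3 * (\<Sum>m<N. \<Sum>n<N. ?ft n m)))"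
  proof (rule summable_comparison_test_ev)
    show "summable (\<lambda>N. (1 + 2 * b ^ d) * (1 / real N ^ 2) + 6 * C'' * (1 / (N * (ln N)\<^sup>2)))"
      using inverse_power_summable[of 2, where 'a=real]
      by (intro summable_add summable_mult summable_inverse_ln_square) (simp add: inverse_eq_divide)
    show "\<forall>\<^sub>F N in sequentially. norm (norm (1 / of_nat N ^ 3 * (\<Sum>m<N. \<Sum>n<N. ?ft n m)))
      \<le> (1 + 2 * b ^ d) * (1 / real N ^ 2) + 6 * C'' * (1 / (N * (ln N)\<^sup>2))"
      using eventually_ge_at_top[of "modulus q d (Suc s0)"]
    proof eventually_elim
      case (elim N)
      show ?case using main[OF elim] by (simp add: D_def norm_mult norm_divide norm_power)
    qed
  qed
  then have "summable (\<lambda>N. 1 / of_nat N ^ 3 * (\<Sum>m<N. \<Sum>n<N. ?ft n m))"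
    by (rule summable_norm_cancel)
  then show "summable (\<lambda>N. 1 / of_nat (Suc N) ^ 3 * (\<Sum>m<Suc N. \<Sum>n<Suc N. ?ft n m))"
    by (subst summable_Suc_iff)
qed

end

section \<open>Normality\<close>

text \<open>If |T_N| \<ge> \<epsilon> N, slow variation keeps |T_M| \<ge> \<epsilon> N/2 for about
  \<epsilon> N/2 consecutive M \<le> 2N. Each contributes at least (\<epsilon> N/2)^2/(2N)^3,
  together at least \<epsilon>^3/64, contradicting the Cauchy property when N is large.\<close>

lemma tendsto_mean_0_if_summable:
  fixes T :: "nat \<Rightarrow> 'a::real_normed_vector"
  assumes step: "\<And>n. norm (T (Suc n) - T n) \<le> 1"
    and sum: "summable (\<lambda>n. (norm (T n))\<^sup>2 / real n ^ 3)"
  shows "(\<lambda>n. norm (T n) / real n) \<longlonglongrightarrow> 0"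
proof (rule ccontr)
  assume "\<not> (\<lambda>n. norm (T n) / real n) \<longlonglongrightarrow> 0"
  then obtain e where e: "e > 0" "\<And>n0. \<exists>n\<ge>n0. norm (T n) / real n \<ge> e"
    by (auto simp: LIMSEQ_iff not_less)
  \<comment> \<open>Capping at 1 ensures that the run of indices after N stays below 2N.\<close>
  define \<epsilon> where "\<epsilon> = min e 1"
  have \<epsilon>: "0 < \<epsilon>" "\<epsilon> \<le> 1" using e by (auto simp: \<epsilon>_def)
  define f where "f n = (norm (T n))\<^sup>2 / real n ^ 3" for n
  obtain n0 where n0: "\<And>m n. m \<ge> n0 \<Longrightarrow> norm (sum f {m..<n}) < \<epsilon> ^ 3 / 64"
    using sum \<epsilon> unfolding f_def[symmetric] summable_Cauchy by (meson divide_pos_pos zero_less_numeral zero_less_power)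
  obtain N where N: "N \<ge> max 1 n0" "norm (T N) / real N \<ge> e" using e(2) by blast
  have N0: "real N \<ge> 1" using N(1) by simp
  have TN: "norm (T N) \<ge> \<epsilon> * real N"
  proof -
    have "\<epsilon> * real N \<le> e * real N" by (intro mult_right_mono) (auto simp: \<epsilon>_def)
    also have "\<dots> \<le> norm (T N)" using N(2) N0 by (simp add: pos_le_divide_eq)
    finally show ?thesis .
  qed
  have diff: "norm (T (m + j) - T m) \<le> j" for m j
  proof (induction j)
    case (Suc j)
    have "norm (T (m + Suc j) - T m) \<le> norm (T (Suc (m + j)) - T (m + j)) + norm (T (m + j) - T m)"
      using norm_triangle_ineq[of "T (Suc (m + j)) - T (m + j)" "T (m + j) - T m"] by simp
    with Suc step[of "m + j"] show ?case by simp
  qed simp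
  define k where "k = nat \<lfloor>\<epsilon> * real N / 2\<rfloor> + 1"
  have k: "real k \<ge> \<epsilon> * real N / 2" "real k - 1 \<le> \<epsilon> * real N / 2"
    using \<epsilon> N0 unfolding k_def by (auto simp: real_nat_ceiling_ge) linarith+
  have "\<epsilon>\<^sup>2 / (32 * real N) \<le> f M" if M: "M \<in> {N..<N + k}" for M
  proof -
    obtain j where j: "M = N + j" "j < k" using M by (auto simp: le_iff_add)
    then have jr: "real j \<le> \<epsilon> * real N / 2" using k by linarith
    have "\<epsilon> * real N \<le> norm (T M) + j"
      using TN diff[of N j] norm_triangle_ineq2[of "T N" "T M"] unfolding j by (simp add: norm_minus_commute)
    then have 1: "\<epsilon> * real N / 2 \<le> norm (T M)" using jr by linarith
    have "\<epsilon> * real N \<le> 1 * real N" using \<epsilon> by (intro mult_right_mono) auto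
    then have 2: "real M \<le> 2 * real N" using jr j by simp
    have "\<epsilon>\<^sup>2 / (32 * real N) = (\<epsilon> * real N / 2)\<^sup>2 / (2 * real N) ^ 3"
      using N0 by (simp add: field_simps power2_eq_square power3_eq_cube)
    also have "\<dots> \<le> (norm (T M))\<^sup>2 / real M ^ 3"
      using 1 2 N0 \<epsilon> M by (intro frac_le power_mono) auto
    finally show ?thesis by (simp add: f_def)
  qed
  then have "of_nat (card {N..<N + k}) * (\<epsilon>\<^sup>2 / (32 * real N)) \<le> sum f {N..<N + k}"
    by (rule sum_bounded_below)
  moreover have "\<epsilon> * real N / 2 * (\<epsilon>\<^sup>2 / (32 * real N)) \<le> real k * (\<epsilon>\<^sup>2 / (32 * real N))"
    using k by (intro mult_right_mono) auto
  moreover have "\<epsilon> * real N / 2 * (\<epsilon>\<^sup>2 / (32 * real N)) = \<epsilon> ^ 3 / 64"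
    using N0 by (simp add: field_simps power2_eq_square power3_eq_cube)
  ultimately have "\<epsilon> ^ 3 / 64 \<le> sum f {N..<N + k}" by simp
  moreover have "norm (sum f {N..<N + k}) < \<epsilon> ^ 3 / 64" using n0[of N "N + k"] N by auto
  ultimately show False by simp
qed

section \<open>Weyl's criterion by approximation on the unit circle\<close>

inductive trig_poly :: "(real \<Rightarrow> complex) \<Rightarrow> bool" where
  trig_poly_cis: "trig_poly (\<lambda>t. c * cis (of_int h * t))"
| trig_poly_add: "trig_poly f \<Longrightarrow> trig_poly g \<Longrightarrow> trig_poly (\<lambda>t. f t + g t)"

lemma trig_poly_mult:
  assumes "trig_poly f" "trig_poly g"
  shows "trig_poly (\<lambda>t. f t * g t)"
  using assms
proof (induction f)
  case (trig_poly_cis c h)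
  from trig_poly_cis(1) show ?case
  proof (induction g)
    case (trig_poly_cis c' h')
    have "(\<lambda>t. c * cis (of_int h * t) * (c' * cis (of_int h' * t))) = (\<lambda>t. (c * c') * cis (of_int (h + h') * t))"
      by (auto simp: cis_mult[symmetric] distrib_right)
    then show ?case by (simp only: trig_poly.trig_poly_cis)
  next
    case (trig_poly_add g1 g2)
    then show ?case by (simp add: distrib_left trig_poly.trig_poly_add)
  qed
next
  case (trig_poly_add f1 f2)
  then show ?case by (simp add: distrib_right trig_poly.trig_poly_add)
qed

lemma trig_poly_const: "trig_poly (\<lambda>t. c)"
  using trig_poly_cis[of c 0] by simp

text \<open>Stone-Weierstrass on the unit circle produces polynomials in the two real coordinates;
  cosine and sine are combinations of the exponentials with h = 1 and h = -1.\<close>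

lemma trig_poly_real_polynomial:
  assumes "real_polynomial_function p"
  shows "trig_poly (\<lambda>t. complex_of_real (p (cis t)))"
  using assms
proof (induction p)
  case (linear f)
  interpret bounded_linear f by fact
  have "complex_of_real (f (cis t)) = (complex_of_real (f 1) / 2 + complex_of_real (f \<i>) / (2 * \<i>)) * cis (of_int 1 * t)
      + (complex_of_real (f 1) / 2 - complex_of_real (f \<i>) / (2 * \<i>)) * cis (of_int (- 1) * t)" for t
  proof -
    have "cis t = cos t *\<^sub>R 1 + sin t *\<^sub>R \<i>" by (simp add: complex_eq_iff)
    then have "f (cis t) = cos t * f 1 + sin t * f \<i>" by (metis add scale real_scaleR_def)
    then show ?thesis by (simp add: complex_eq_iff)
  qed
  then show ?case
    by (simp only: trig_poly_add trig_poly_cis)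
qed (simp_all add: trig_poly_const trig_poly_add trig_poly_mult)

lemma has_integral_cis_period:
  assumes "h \<noteq> 0"
  shows "((\<lambda>t. cis (of_int h * (2 * pi * t))) has_integral 0) {a..a + 1}"
proof -
  define c where "c = complex_of_real (2 * pi * of_int h) * \<i>"
  have c: "c \<noteq> 0" using assms by (simp add: c_def)
  have "((\<lambda>t. exp (c * of_real t)) has_integral (exp (c * of_real (a + 1)) / c - exp (c * of_real a) / c)) {a..a + 1}"
  proof (rule fundamental_theorem_of_calculus)
    fix x :: real
    have "((\<lambda>z. exp (c * z) / c) has_field_derivative exp (c * of_real x)) (at (of_real x))"
      using c by (auto intro!: derivative_eq_intros)
    then show "((\<lambda>t. exp (c * of_real t) / c) has_vector_derivative exp (c * of_real x)) (at x within {a..a + 1})"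
      by (rule has_vector_derivative_real_field)
  qed simp
  moreover have "exp (c * of_real (a + 1)) = exp (c * of_real a)"
  proof -
    have "exp c = cis (2 * pi * of_int h)" by (simp add: c_def cis_conv_exp mult.commute)
    then have "exp c = 1" by (simp add: cis_multiple_2pi)
    then show ?thesis by (simp add: distrib_left exp_add)
  qed
  moreover have "exp (c * of_real t) = cis (of_int h * (2 * pi * t))" for t
    by (simp add: c_def cis_conv_exp ac_simps)
  ultimately show ?thesis by simp
qed

text \<open>The integral is claimed over every unit interval so that the period can later be cut at
  a point adapted to the arc under consideration.\<close>

lemma trig_poly_mean:
  assumes W: "\<And>h. h \<noteq> 0 \<Longrightarrow> (\<lambda>N. (\<Sum>k=1..N. cis (of_int h * (2 * pi * u k))) / of_nat N) \<longlonglongrightarrow> 0"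
    and "trig_poly f"
  shows "\<exists>L. (\<lambda>N. (\<Sum>k=1..N. f (2 * pi * u k)) / of_nat N) \<longlonglongrightarrow> L
    \<and> (\<forall>a. ((\<lambda>t. f (2 * pi * t)) has_integral L) {a..a + 1})"
  using assms(2)
proof (induction f)
  case (trig_poly_cis c h)
  show ?case
  proof (cases "h = 0")
    case True
    have "(\<lambda>N. (\<Sum>k=1..N. c) / of_nat N) \<longlonglongrightarrow> c"
    proof (rule tendsto_eventually)
      show "\<forall>\<^sub>F N in sequentially. (\<Sum>k=1..N. c) / of_nat N = c"
        using eventually_gt_at_top[of 0] by eventually_elim simp
    qed
    moreover have "((\<lambda>t. c) has_integral c) {a..a + 1}" for a :: real
      using has_integral_const_real[of c a "a + 1"] by simp
    ultimately show ?thesis using True by auto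
  next
    case False
    have "(\<lambda>N. c * ((\<Sum>k=1..N. cis (of_int h * (2 * pi * u k))) / of_nat N)) \<longlonglongrightarrow> c * 0"
      by (intro tendsto_mult W False tendsto_const)
    moreover have "((\<lambda>t. c * cis (of_int h * (2 * pi * t))) has_integral c * 0) {a..a + 1}" for a
      by (intro has_integral_mult_right has_integral_cis_period False)
    ultimately show ?thesis by (auto simp: sum_distrib_left)
  qed
next
  case (trig_poly_add f g)
  then obtain L M where
    "(\<lambda>N. (\<Sum>k=1..N. f (2 * pi * u k)) / of_nat N) \<longlonglongrightarrow> L" "\<And>a. ((\<lambda>t. f (2 * pi * t)) has_integral L) {a..a + 1}"
    "(\<lambda>N. (\<Sum>k=1..N. g (2 * pi * u k)) / of_nat N) \<longlonglongrightarrow> M" "\<And>a. ((\<lambda>t. g (2 * pi * t)) has_integral M) {a..a + 1}"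
    by blast
  then have "(\<lambda>N. (\<Sum>k=1..N. f (2 * pi * u k)) / of_nat N + (\<Sum>k=1..N. g (2 * pi * u k)) / of_nat N) \<longlonglongrightarrow> L + M"
    "\<And>a. ((\<lambda>t. f (2 * pi * t) + g (2 * pi * t)) has_integral L + M) {a..a + 1}"
    by (auto intro: tendsto_add has_integral_add)
  then show ?case by (auto simp: sum.distrib add_divide_distrib)
qed

text \<open>A continuous function on the circle that is 1 on the arc of [s, t] and 0 outside its
  \<epsilon>-enlargement is approximated by a trigonometric polynomial, whose mean is at most t - s
  + 3\<epsilon>. The remaining 2\<epsilon> pay for the limit and for the approximation error at the
  points.\<close>

lemma weyl_upper_bound:
  assumes W: "\<And>h. h \<noteq> 0 \<Longrightarrow> (\<lambda>N. (\<Sum>k=1..N. cis (of_int h * (2 * pi * u k))) / of_nat N) \<longlonglongrightarrow> 0"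
    and st: "s \<le> t" and \<epsilon>: "\<epsilon> > 0"
  shows "\<forall>\<^sub>F N in sequentially. real (card {k \<in> {1..N}. u k \<in> {s..t}}) / real N \<le> t - s + 5 * \<epsilon>"
proof (cases "t + \<epsilon> \<le> 1 + s - \<epsilon>")
  case False
  have "real (card {k \<in> {1..N}. u k \<in> {s..t}}) / real N \<le> 1" for N
  proof -
    have "card {k \<in> {1..N}. u k \<in> {s..t}} \<le> card {1..N}" by (intro card_mono) auto
    then show ?thesis by (cases "N = 0") (simp_all add: divide_le_eq_1)
  qed
  \<comment> \<open>The enlarged arc is then longer than the whole circle, so the claimed bound
    exceeds 1.\<close>
  then show ?thesis using False \<epsilon> by (intro always_eventually allI) (smt (verit))
next
  case True
  define K where "K = (\<lambda>x. cis (2 * pi * x)) ` {s..t}"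
  define K' where "K' = (\<lambda>x. cis (2 * pi * x)) ` {t + \<epsilon>..1 + s - \<epsilon>}"
  have "closed K" "closed K'"
    unfolding K_def K'_def
    by (intro compact_imp_closed compact_continuous_image continuous_intros compact_Icc)+
  moreover have "K \<inter> K' = {}"
  proof -
    have False if x: "x \<in> {s..t}" and y: "y \<in> {t + \<epsilon>..1 + s - \<epsilon>}" and e: "cis (2 * pi * x) = cis (2 * pi * y)" for x y
    proof -
      have "cis (2 * pi * y - 2 * pi * x) = 1" using e by (simp flip: cis_divide)
      then have "cos (2 * pi * y - 2 * pi * x) = 1" by (metis cis.simps(1) one_complex.simps(1))
      then obtain n :: int where "2 * pi * y - 2 * pi * x = n * 2 * pi" by (auto simp: cos_one_2pi_int)
      then have "2 * pi * (y - x) = 2 * pi * n" by (simp add: algebra_simps)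
      then have "y - x = n" by (subst (asm) mult_cancel_left) simp
      then have "0 < real_of_int n" "real_of_int n < 1" using x y \<epsilon> by auto
      then have "0 < n" "n < 1" by (simp_all only: of_int_0_less_iff of_int_less_1_iff)
      then show False by simp
    qed
    note disj = this
    have False if z: "z \<in> K" "z \<in> K'" for z
    proof -
      from z obtain x y where "x \<in> {s..t}" "z = cis (2 * pi * x)" "y \<in> {t + \<epsilon>..1 + s - \<epsilon>}" "z = cis (2 * pi * y)"
        unfolding K_def K'_def by blast
      then show False using disj[of x y] by simp
    qed
    then show ?thesis by blast
  qed
  ultimately obtain g :: "complex \<Rightarrow> real" where g: "continuous_on UNIV g"
    "\<And>z. g z \<in> closed_segment 1 0" "\<And>z. z \<in> K \<Longrightarrow> g z = 1" "\<And>z. z \<in> K' \<Longrightarrow> g z = 0"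
    using Urysohn[of K K' 1 "0::real"] by blast
  have g01: "0 \<le> g z" "g z \<le> 1" for z
    using g(2)[of z] by (auto simp: closed_segment_eq_real_ivl)
  obtain p where p: "real_polynomial_function p" "\<And>z. z \<in> sphere 0 1 \<Longrightarrow> \<bar>g z - p z\<bar> < \<epsilon>"
    using Stone_Weierstrass_real_polynomial_function[of "sphere 0 1" g \<epsilon>] g(1) \<epsilon> continuous_on_subset
    by (metis compact_sphere subset_UNIV)
  have pg: "\<bar>g (cis x) - p (cis x)\<bar> < \<epsilon>" for x using p(2) by simp
  obtain L where L: "(\<lambda>N. (\<Sum>k=1..N. complex_of_real (p (cis (2 * pi * u k)))) / of_nat N) \<longlonglongrightarrow> L"
    "\<And>a. ((\<lambda>t. complex_of_real (p (cis (2 * pi * t)))) has_integral L) {a..a + 1}"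
    using trig_poly_mean[OF W trig_poly_real_polynomial[OF p(1)]] by blast
  have lim: "(\<lambda>N. (\<Sum>k=1..N. p (cis (2 * pi * u k))) / N) \<longlonglongrightarrow> Re L"
    using tendsto_Re[OF L(1)] by simp
  have int: "((\<lambda>x. p (cis (2 * pi * x))) has_integral Re L) {s - \<epsilon>..s - \<epsilon> + 1}"
    using has_integral_Re[OF L(2)[of "s - \<epsilon>"]] by simp
  have int2: "((\<lambda>x. \<epsilon> + (if x \<in> {s - \<epsilon>..t + \<epsilon>} then 1 else 0)) has_integral \<epsilon> + (t - s + 2 * \<epsilon>)) {s - \<epsilon>..s - \<epsilon> + 1}"
  proof (rule has_integral_add)
    show "((\<lambda>x. \<epsilon>) has_integral \<epsilon>) {s - \<epsilon>..s - \<epsilon> + 1}"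
      using has_integral_const_real[of \<epsilon> "s - \<epsilon>" "s - \<epsilon> + 1"] by simp
    have "((\<lambda>x. 1::real) has_integral (t - s + 2 * \<epsilon>)) {s - \<epsilon>..t + \<epsilon>}"
      using has_integral_const_real[of "1::real" "s - \<epsilon>" "t + \<epsilon>"] st \<epsilon> by (simp add: add.commute)
    then show "((\<lambda>x. if x \<in> {s - \<epsilon>..t + \<epsilon>} then 1 else 0) has_integral (t - s + 2 * \<epsilon>)) {s - \<epsilon>..s - \<epsilon> + 1}"
      using True by (subst has_integral_restrict) auto
  qed
  have "Re L \<le> \<epsilon> + (t - s + 2 * \<epsilon>)"
  proof (rule has_integral_le[OF int int2])
    fix x assume x: "x \<in> {s - \<epsilon>..s - \<epsilon> + 1}"
    show "p (cis (2 * pi * x)) \<le> \<epsilon> + (if x \<in> {s - \<epsilon>..t + \<epsilon>} then 1 else 0)"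
    proof (cases "x \<in> {s - \<epsilon>..t + \<epsilon>}")
      case True
      then show ?thesis using pg[of "2 * pi * x"] g01[of "cis (2 * pi * x)"] by simp
    next
      case False
      then have "cis (2 * pi * x) \<in> K'" using x unfolding K'_def by auto
      from g(4)[OF this] show ?thesis using pg[of "2 * pi * x"] unfolding if_not_P[OF False] by simp
    qed
  qed
  then have "Re L < t - s + 4 * \<epsilon>" using \<epsilon> by simp
  from order_tendstoD(2)[OF lim this] show ?thesis
    using eventually_gt_at_top[of 0]
  proof eventually_elim
    case (elim N)
    have "real (card {k \<in> {1..N}. u k \<in> {s..t}}) = (\<Sum>k=1..N. if u k \<in> {s..t} then 1 else 0)"
      by (simp add: sum.If_cases Int_def)
    also have "\<dots> \<le> (\<Sum>k=1..N. p (cis (2 * pi * u k)) + \<epsilon>)"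
    proof (rule sum_mono)
      fix k
      show "(if u k \<in> {s..t} then 1 else 0) \<le> p (cis (2 * pi * u k)) + \<epsilon>"
        using pg[of "2 * pi * u k"] g01(1)[of "cis (2 * pi * u k)"] g(3)[of "cis (2 * pi * u k)"]
        by (auto simp: K_def)
    qed
    also have "\<dots> = (\<Sum>k=1..N. p (cis (2 * pi * u k))) + real N * \<epsilon>"
      by (simp add: sum.distrib)
    finally have "real (card {k \<in> {1..N}. u k \<in> {s..t}}) / N \<le> (\<Sum>k=1..N. p (cis (2 * pi * u k))) / N + \<epsilon>"
      using elim by (simp add: field_simps)
    then show ?case using elim by simp
  qed
qed

text \<open>Upper bounds suffice: [0, s], [s, t] and [t, 1] cover all points, so upper bounds for
  the outer two force a lower bound for the middle one.\<close>

lemma weyl_criterion: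
  assumes W: "\<And>h. h \<noteq> 0 \<Longrightarrow> (\<lambda>N. (\<Sum>k=1..N. cis (of_int h * (2 * pi * u k))) / of_nat N) \<longlonglongrightarrow> 0"
    and u: "\<And>k. u k \<in> {0..1}"
  shows "equidistributed_01 u"
  unfolding equidistributed_01_def
proof (intro allI impI)
  fix s t :: real assume st: "0 \<le> s \<and> s \<le> t \<and> t \<le> 1"
  define c where "c s t N = real (card {k \<in> {1..N}. u k \<in> {s..t}}) / real N" for s t N
  have "(\<lambda>N. c s t N) \<longlonglongrightarrow> t - s"
  proof (rule tendstoI)
    fix e :: real assume e: "e > 0"
    \<comment> \<open>The lower estimate spends 5\<epsilon> on each outer interval, that is e/2 in
      total.\<close>
    define \<epsilon> where "\<epsilon> = e / 20"
    have \<epsilon>: "\<epsilon> > 0" using e by (simp add: \<epsilon>_def)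
    have up: "\<forall>\<^sub>F N in sequentially. c a b N \<le> b - a + 5 * \<epsilon>" if "a \<le> b" for a b
      unfolding c_def by (rule weyl_upper_bound[OF W that \<epsilon>])
    have "s \<le> t" "0 \<le> s" "t \<le> 1" using st by auto
    from up[OF this(1)] up[OF this(2)] up[OF this(3)] eventually_gt_at_top[of 0]
    show "\<forall>\<^sub>F N in sequentially. dist (c s t N) (t - s) < e"
    proof (eventually_elim)
      case (elim N)
      have "card {1..N} \<le> card ({k \<in> {1..N}. u k \<in> {s..t}} \<union> {k \<in> {1..N}. u k \<in> {0..s}} \<union> {k \<in> {1..N}. u k \<in> {t..1}})"
        using u by (intro card_mono) fastforce+
      also have "\<dots> \<le> card {k \<in> {1..N}. u k \<in> {s..t}} + card {k \<in> {1..N}. u k \<in> {0..s}} + card {k \<in> {1..N}. u k \<in> {t..1}}"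
        by (rule order_trans[OF card_Un_le add_right_mono[OF card_Un_le]])
      finally have "real N \<le> real (card {k \<in> {1..N}. u k \<in> {s..t}}) + real (card {k \<in> {1..N}. u k \<in> {0..s}}) + real (card {k \<in> {1..N}. u k \<in> {t..1}})"
        by simp
      then have "real N / real N \<le> c s t N + c 0 s N + c t 1 N"
        unfolding c_def by (simp only: add_divide_distrib[symmetric] divide_right_mono of_nat_0_le_iff)
      then have "1 \<le> c s t N + c 0 s N + c t 1 N" using elim by simp
      then show ?case using elim e unfolding \<epsilon>_def dist_real_def by (auto simp: abs_less_iff)
    qed
  qed
  then show "(\<lambda>n. real (card {k \<in> {1..n}. u k \<in> {s..t}}) / real n) \<longlonglongrightarrow> measure lborel {s..t}"
    using st by (simp add: c_def)
qed

text \<open>The double sum is the integral of |T_N|^2, so the integral of the weighted series is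
  finite by monotone convergence and the series itself is finite almost everywhere. There are
  countably many h, hence one null set serves them all.\<close>

lemma DEL_imp_AE_normal:
  assumes \<mu>: "real_distribution \<mu>" and DEL: "DEL_criterion \<mu> b"
  shows "AE x in \<mu>. normal_in_base b x"
proof -
  interpret real_distribution \<mu> by fact
  define e where "e h n x = cis (of_int h * (2 * pi * (real b ^ n * x)))" for h :: int and n :: nat and x :: real
  define T where "T h N x = (\<Sum>n<N. e h n x)" for h N x
  have [measurable]: "e h n \<in> borel_measurable \<mu>" "T h N \<in> borel_measurable \<mu>" for h n N
    unfolding T_def e_def cis_conv_exp by measurable
  have T_le: "norm (T h N x) \<le> N" for h N x
    unfolding T_def using norm_sum[of "\<lambda>n. e h n x" "{..<N}"] by (simp add: e_def)
  have main: "AE x in \<mu>. (\<lambda>N. norm (T h N x) / real N) \<longlonglongrightarrow> 0" if h: "h \<noteq> 0" for h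
  proof -
    define S where "S N = (\<Sum>m<N. \<Sum>n<N. fourier_transform \<mu> (of_int h * (of_nat b ^ n - of_nat b ^ m)))" for N
    have S: "S N = of_real (LINT x|\<mu>. (norm (T h N x))\<^sup>2)" for N
    proof -
      have ft: "fourier_transform \<mu> (of_int h * (of_nat b ^ n - of_nat b ^ m)) = (CLINT x|\<mu>. e h m x * cnj (e h n x))" for m n
        unfolding fourier_transform_def
      proof (intro Bochner_Integration.integral_cong refl)
        fix x
        have "exp (- 2 * of_real pi * \<i> * of_real (of_int h * (of_nat b ^ n - of_nat b ^ m)) * of_real x)
            = cis (of_int h * (2 * pi * (real b ^ m * x)) + - (of_int h * (2 * pi * (real b ^ n * x))))"
          by (simp add: cis_conv_exp algebra_simps)
        then show "exp (- 2 * of_real pi * \<i> * of_real (of_int h * (of_nat b ^ n - of_nat b ^ m)) * of_real x)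
            = e h m x * cnj (e h n x)"
          by (simp only: cis_mult[symmetric] cis_cnj e_def)
      qed
      have int: "integrable \<mu> (\<lambda>x. e h m x * cnj (e h n x))" for m n
      proof (rule integrable_const_bound[of _ 1])
        have "cnj \<in> borel_measurable borel"
          by (intro borel_measurable_continuous_onI continuous_intros)
        note [measurable] = measurable_compose[OF _ this]
        show "(\<lambda>x. e h m x * cnj (e h n x)) \<in> borel_measurable \<mu>" by measurable
      qed (simp add: e_def norm_mult)
      have "S N = (CLINT x|\<mu>. (\<Sum>m<N. \<Sum>n<N. e h m x * cnj (e h n x)))"
        unfolding S_def ft
        by (simp add: Bochner_Integration.integral_sum Bochner_Integration.integrable_sum int)
      also have "(\<lambda>x. \<Sum>m<N. \<Sum>n<N. e h m x * cnj (e h n x)) = (\<lambda>x. of_real ((norm (T h N x))\<^sup>2))"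
        by (simp only: complex_norm_square T_def cnj_sum sum_product)
      finally show ?thesis by (simp only: integral_complex_of_real)
    qed
    have "summable (\<lambda>N. 1 / of_nat (Suc N) ^ 3 * S (Suc N))"
      using DEL h unfolding DEL_criterion_def S_def by blast
    \<comment> \<open>The criterion is a complex summability; since its terms are nonnegative reals,
      it passes to a real series to which monotone convergence applies.\<close>
    then have "summable (\<lambda>N. complex_of_real ((LINT x|\<mu>. (norm (T h (Suc N) x))\<^sup>2) / real (Suc N) ^ 3))"
      unfolding S by simp
    then have sm: "summable (\<lambda>N. (LINT x|\<mu>. (norm (T h (Suc N) x))\<^sup>2) / real (Suc N) ^ 3)"
      by (simp only: summable_complex_of_real)
    define F where "F N x = (norm (T h (Suc N) x))\<^sup>2 / real (Suc N) ^ 3" for N x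
    have [measurable]: "F N \<in> borel_measurable \<mu>" for N unfolding F_def by measurable
    have intF: "integrable \<mu> (F N)" for N
    proof -
      have "norm (F N x) \<le> (real (Suc N))\<^sup>2 / real (Suc N) ^ 3" for x
        unfolding F_def using power_mono[OF T_le[of h "Suc N" x], of 2] by (simp add: divide_right_mono)
      then show ?thesis by (intro integrable_const_bound[where B="(real (Suc N))\<^sup>2 / real (Suc N) ^ 3"]) auto
    qed
    have F0: "0 \<le> F N x" for N x by (simp add: F_def)
    have "(\<integral>\<^sup>+x. (\<Sum>N. ennreal (F N x)) \<partial>\<mu>) = (\<Sum>N. \<integral>\<^sup>+x. ennreal (F N x) \<partial>\<mu>)"
      by (intro nn_integral_suminf) measurable
    also have "\<dots> = (\<Sum>N. ennreal (LINT x|\<mu>. F N x))"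
      by (intro suminf_cong nn_integral_eq_integral intF) (auto simp: F0)
    also have "\<dots> < \<infinity>"
    proof -
      have "summable (\<lambda>N. LINT x|\<mu>. F N x)"
        using sm unfolding F_def by (simp only: Bochner_Integration.integral_divide_zero)
      then show ?thesis
        by (subst suminf_ennreal2) (auto simp: F0 intro!: Bochner_Integration.integral_nonneg)
    qed
    finally have "AE x in \<mu>. (\<Sum>N. ennreal (F N x)) \<noteq> \<infinity>"
      by (intro nn_integral_PInf_AE) auto
    then show ?thesis
    proof eventually_elim
      case (elim x)
      have "summable (\<lambda>N. F N x)"
        using elim F0 by (intro summable_suminf_not_top) auto
      then have "summable (\<lambda>N. (norm (T h N x))\<^sup>2 / real N ^ 3)"
        unfolding F_def by (subst (asm) summable_Suc_iff)
      then show ?case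
        by (intro tendsto_mean_0_if_summable) (auto simp: T_def e_def)
    qed
  qed
  then have "AE x in \<mu>. \<forall>h. h \<noteq> 0 \<longrightarrow> (\<lambda>N. norm (T h N x) / real N) \<longlonglongrightarrow> 0"
    unfolding AE_all_countable by auto
  then show ?thesis
  proof eventually_elim
    case (elim x)
    show ?case
      unfolding normal_in_base_def
    proof (rule weyl_criterion)
      fix h :: int assume "h \<noteq> 0"
      have cis_frac: "cis (of_int h * (2 * pi * frac y)) = cis (of_int h * (2 * pi * y))" for y
      proof -
        have "of_int h * (2 * pi * frac y) = of_int h * (2 * pi * y) - 2 * pi * of_int (h * \<lfloor>y\<rfloor>)"
          by (simp add: frac_def algebra_simps)
        then show ?thesis by (simp only: cis_divide[symmetric] cis_multiple_2pi[OF Ints_of_int] div_by_1)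
      qed
      \<comment> \<open>Equidistribution counts k = 1, ..., N, the criterion sums n = 0, ..., N - 1.
        The two unimodular boundary terms disappear after division by N.\<close>
      have shift: "(\<Sum>k=1..N. e h k x) = T h N x + (e h N x - e h 0 x)" for N
        unfolding T_def by (induction N) simp_all
      show "(\<lambda>N. (\<Sum>k=1..N. cis (of_int h * (2 * pi * frac (real b ^ k * x)))) / of_nat N) \<longlonglongrightarrow> 0"
        unfolding cis_frac e_def[symmetric] shift
      proof (rule tendsto_0_le[where K=1])
        have "(\<lambda>N. norm (T h N x) / real N + 2 / real N) \<longlonglongrightarrow> 0 + 0"
          using elim \<open>h \<noteq> 0\<close> by (intro tendsto_add lim_const_over_n) auto
        then show "(\<lambda>N. norm (T h N x) / real N + 2 / real N) \<longlonglongrightarrow> 0" by simp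
        have "norm (T h N x + (e h N x - e h 0 x)) \<le> norm (T h N x) + 2" for N
        proof -
          have "norm (e h N x - e h 0 x) \<le> 2"
            using norm_triangle_ineq4[of "e h N x" "e h 0 x"] by (simp add: e_def)
          then show ?thesis using norm_triangle_ineq[of "T h N x" "e h N x - e h 0 x"] by linarith
        qed
        then have "norm ((T h N x + (e h N x - e h 0 x)) / of_nat N) \<le> norm (norm (T h N x) / real N + 2 / real N) * 1" for N
          by (simp add: norm_divide divide_right_mono flip: add_divide_distrib)
        then show "\<forall>\<^sub>F N in sequentially. norm ((T h N x + (e h N x - e h 0 x)) / of_nat N) \<le> norm (norm (T h N x) / real N + 2 / real N) * 1"
          by simp
      qed
    next
      fix k show "frac (real b ^ k * x) \<in> {0..1}" by (simp add: frac_lt_1 less_imp_le)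
    qed
  qed
qed

section \<open>Trigonometric series and sets of uniqueness\<close>

definition trig_term :: "(nat \<Rightarrow> real) \<Rightarrow> (nat \<Rightarrow> real) \<Rightarrow> nat \<Rightarrow> real \<Rightarrow> real" where
  "trig_term a b n x = a n * cos (2 * pi * real n * x) + b n * sin (2 * pi * real n * x)"

lemma trig_term_le: "\<bar>trig_term a b n x\<bar> \<le> \<bar>a n\<bar> + \<bar>b n\<bar>"
proof -
  have "\<bar>trig_term a b n x\<bar> \<le> \<bar>a n\<bar> * \<bar>cos (2 * pi * real n * x)\<bar> + \<bar>b n\<bar> * \<bar>sin (2 * pi * real n * x)\<bar>"
    unfolding trig_term_def by (metis abs_mult abs_triangle_ineq)
  also have "\<dots> \<le> \<bar>a n\<bar> * 1 + \<bar>b n\<bar> * 1"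
    by (intro add_mono mult_left_mono) auto
  finally show ?thesis by simp
qed

lemma trig_term_square:
  "(trig_term a b n x)\<^sup>2 = ((a n)\<^sup>2 + (b n)\<^sup>2) / 2
     + (((a n)\<^sup>2 - (b n)\<^sup>2) / 2 * cos (4 * pi * real n * x) + a n * b n * sin (4 * pi * real n * x))"
proof -
  define t where "t = 2 * pi * real n * x"
  have t2: "4 * pi * real n * x = 2 * t" by (simp add: t_def)
  have "(a n * y + b n * z)\<^sup>2 = ((a n)\<^sup>2 + (b n)\<^sup>2) * (z\<^sup>2 + y\<^sup>2) / 2
      + (((a n)\<^sup>2 - (b n)\<^sup>2) / 2 * (y\<^sup>2 - z\<^sup>2) + a n * b n * (2 * z * y))" for y z
    by (simp add: power2_eq_square field_simps)
  from this[of "cos t" "sin t"] show ?thesis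
    unfolding trig_term_def t2 t_def[symmetric] cos_double sin_double by simp
qed

lemma has_integral_trig:
  fixes c :: real
  assumes "c \<noteq> 0" "lo \<le> hi"
  shows "((\<lambda>x. A * cos (c * x) + B * sin (c * x)) has_integral
     (A * sin (c * hi) - B * cos (c * hi)) / c - (A * sin (c * lo) - B * cos (c * lo)) / c) {lo..hi}"
  using assms
  by (intro fundamental_theorem_of_calculus)
     (auto intro!: derivative_eq_intros simp: has_real_derivative_iff_has_vector_derivative[symmetric] field_simps)

text \<open>The mean of the squared term over the interval is asymptotically R/2 with R the sum of
  the squared coefficients, because the oscillating part integrates to O(R/n). If the terms tend to
  0, dominated convergence sends the normalized mean to 0, and R with it.\<close>

lemma cantor_lebesgue_interval:
  assumes "lo < hi" and lim: "\<And>x. x \<in> {lo..hi} \<Longrightarrow> (\<lambda>n. trig_term a b n x) \<longlonglongrightarrow> 0"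
  shows "(\<lambda>n. (a n)\<^sup>2 + (b n)\<^sup>2) \<longlonglongrightarrow> 0"
proof -
  define R where "R n = (a n)\<^sup>2 + (b n)\<^sup>2" for n
  \<comment> \<open>The coefficients are not yet known to be bounded; dividing by 1 + R makes the
    integrands uniformly dominated by 1, and R is recovered from R/(1 + R) at the end.\<close>
  define f where "f n x = (trig_term a b n x)\<^sup>2 / (1 + R n)" for n x
  have R: "R n \<ge> 0" for n by (simp add: R_def)
  have term_R: "(trig_term a b n x)\<^sup>2 \<le> R n" for n x
  proof -
    define s c where "s = sin (2 * pi * real n * x)" and "c = cos (2 * pi * real n * x)"
    have "R n = (trig_term a b n x)\<^sup>2 + (a n * s - b n * c)\<^sup>2 + R n * (1 - (s\<^sup>2 + c\<^sup>2))"
      unfolding R_def trig_term_def s_def[symmetric] c_def[symmetric]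
      by (simp add: power2_eq_square algebra_simps)
    moreover have "s\<^sup>2 + c\<^sup>2 = 1" by (simp add: s_def c_def)
    ultimately have "R n = (trig_term a b n x)\<^sup>2 + (a n * s - b n * c)\<^sup>2" by simp
    then show ?thesis by simp
  qed
  have f_bound: "norm (f n x) \<le> 1" for n x
    using term_R[of n x] R[of n] by (simp add: f_def divide_le_eq_1)
  have f_lim: "(\<lambda>n. f n x) \<longlonglongrightarrow> 0" if "x \<in> {lo..hi}" for x
  proof (rule tendsto_0_le[where K=1])
    show "(\<lambda>n. (trig_term a b n x)\<^sup>2) \<longlonglongrightarrow> 0"
      using tendsto_power[OF lim[OF that], of 2] by simp
    have "norm (f n x) \<le> norm ((trig_term a b n x)\<^sup>2) * 1" for n
      using R[of n] frac_le[of "(trig_term a b n x)\<^sup>2" "(trig_term a b n x)\<^sup>2" 1 "1 + R n"] by (simp add: f_def)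
    then show "\<forall>\<^sub>F n in sequentially. norm (f n x) \<le> norm ((trig_term a b n x)\<^sup>2) * 1"
      by simp
  qed
  have f_int: "f n integrable_on {lo..hi}" for n
    unfolding f_def trig_term_def using R[of n]
    by (intro integrable_continuous_interval continuous_intros) auto
  have int_lim: "(\<lambda>n. integral {lo..hi} (f n)) \<longlonglongrightarrow> integral {lo..hi} (\<lambda>x. 0)"
    by (rule dominated_convergence(2)[OF f_int, of "\<lambda>_. 1"]) (use f_bound f_lim in auto)
  have int_f: "integral {lo..hi} (f n) \<ge> R n / (1 + R n) * ((hi - lo) / 2 - 1 / (pi * real n))" if n: "n > 0" for n
  proof -
    define A B c where "A = ((a n)\<^sup>2 - (b n)\<^sup>2) / 2" and "B = a n * b n" and "c = 4 * pi * real n"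
    define Q where "Q = (A * sin (c * hi) - B * cos (c * hi)) / c - (A * sin (c * lo) - B * cos (c * lo)) / c"
    have c: "c > 0" using n by (simp add: c_def)
    have "((\<lambda>x. A * cos (c * x) + B * sin (c * x)) has_integral Q) {lo..hi}"
      unfolding Q_def using c assms(1) by (intro has_integral_trig) auto
    moreover have "((\<lambda>x. R n / 2) has_integral (hi - lo) * (R n / 2)) {lo..hi}"
      using has_integral_const_real[of "R n / 2" lo hi] assms(1) by simp
    ultimately have "((\<lambda>x. (R n / 2 + (A * cos (c * x) + B * sin (c * x))) / (1 + R n)) has_integral
        ((hi - lo) * (R n / 2) + Q) / (1 + R n)) {lo..hi}"
      by (intro has_integral_divide has_integral_add)
    then have "(f n has_integral ((hi - lo) * (R n / 2) + Q) / (1 + R n)) {lo..hi}"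
      unfolding f_def trig_term_square R_def A_def B_def c_def by simp
    then have *: "integral {lo..hi} (f n) = ((hi - lo) * (R n / 2) + Q) / (1 + R n)"
      by (rule integral_unique)
    have AB: "\<bar>A\<bar> \<le> R n / 2" "\<bar>B\<bar> \<le> R n / 2"
      using zero_le_power2[of "a n - b n"] zero_le_power2[of "a n + b n"]
      by (auto simp: A_def B_def R_def abs_le_iff power2_eq_square algebra_simps)
    have trig_AB: "\<bar>A * sin y - B * cos y\<bar> \<le> R n" for y
    proof -
      have "\<bar>A * sin y - B * cos y\<bar> \<le> \<bar>A\<bar> * \<bar>sin y\<bar> + \<bar>B\<bar> * \<bar>cos y\<bar>"
        by (metis abs_mult abs_triangle_ineq4)
      also have "\<dots> \<le> R n / 2 * 1 + R n / 2 * 1"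
        using AB R[of n] by (intro add_mono mult_mono) auto
      finally show ?thesis by simp
    qed
    have "\<bar>Q\<bar> \<le> (R n + R n) / c"
    proof -
      have "Q = ((A * sin (c * hi) - B * cos (c * hi)) - (A * sin (c * lo) - B * cos (c * lo))) / c"
        by (simp add: Q_def diff_divide_distrib)
      then show ?thesis
        using trig_AB[of "c * hi"] trig_AB[of "c * lo"] c by (auto simp: abs_divide intro!: divide_right_mono)
    qed
    also have "\<dots> \<le> R n * (1 / (pi * real n))"
      using R[of n] n by (simp add: c_def field_simps)
    finally have "- (R n * (1 / (pi * real n))) \<le> Q" by linarith
    moreover have "R n * ((hi - lo) / 2 - 1 / (pi * real n)) = (hi - lo) * (R n / 2) - R n * (1 / (pi * real n))"
      using right_diff_distrib[of "R n" "(hi - lo) / 2" "1 / (pi * real n)"] by simp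
    ultimately have "R n * ((hi - lo) / 2 - 1 / (pi * real n)) \<le> (hi - lo) * (R n / 2) + Q"
      by linarith
    then show ?thesis
      unfolding * using R[of n] divide_right_mono[of "R n * ((hi - lo) / 2 - 1 / (pi * real n))" _ "1 + R n"] by simp
  qed
  have "(\<lambda>n. 1 / (pi * real n)) \<longlonglongrightarrow> 0"
    using tendsto_mult_right_zero[OF lim_1_over_n, of "1 / pi"] by simp
  then have "\<forall>\<^sub>F n in sequentially. 1 / (pi * real n) < (hi - lo) / 4"
    using assms(1) by (intro order_tendstoD(2)) auto
  then have ev: "\<forall>\<^sub>F n in sequentially. norm (R n / (1 + R n)) \<le> norm (integral {lo..hi} (f n)) * (4 / (hi - lo))"
    using eventually_gt_at_top[of 0]
  proof eventually_elim
    case (elim n)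
    have "R n / (1 + R n) * ((hi - lo) / 4) \<le> R n / (1 + R n) * ((hi - lo) / 2 - 1 / (pi * real n))"
    proof (rule mult_left_mono)
      show "(hi - lo) / 4 \<le> (hi - lo) / 2 - 1 / (pi * real n)" using elim(1) by linarith
    qed (use R[of n] in simp)
    also have "\<dots> \<le> norm (integral {lo..hi} (f n))"
      using int_f[of n] elim by simp
    finally show ?case using assms(1) R[of n] by (simp add: field_simps)
  qed
  have lim1: "(\<lambda>n. R n / (1 + R n)) \<longlonglongrightarrow> 0"
    by (rule tendsto_0_le[OF _ ev]) (use int_lim in simp)
  have "(\<lambda>n. 1 - R n / (1 + R n)) \<longlonglongrightarrow> 1 - 0"
    by (intro tendsto_intros lim1)
  then have "(\<lambda>n. R n / (1 + R n) / (1 - R n / (1 + R n))) \<longlonglongrightarrow> 0 / (1 - 0)"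
    by (intro tendsto_divide lim1) auto
  moreover have "R n / (1 + R n) / (1 - R n / (1 + R n)) = R n" for n
    using R[of n] by (simp add: field_simps)
  ultimately show ?thesis by (simp add: R_def)
qed

section \<open>Riemann's summation method and the variation of its kernel\<close>

definition sinc2 :: "real \<Rightarrow> real" where
  "sinc2 t = (if t = 0 then 1 else (sin t / t)\<^sup>2)"

lemma sinc2_bounds: "0 \<le> sinc2 t" "sinc2 t \<le> 1"
proof -
  have "\<bar>sin t / t\<bar> \<le> 1" using abs_sin_x_le_abs_x[of t] by (cases "t = 0") (simp_all add: abs_divide)
  then have "(sin t / t)\<^sup>2 \<le> 1" by (simp add: abs_square_le_1)
  then show "0 \<le> sinc2 t" "sinc2 t \<le> 1" by (auto simp: sinc2_def)
qed

lemma isCont_sinc2_0: "isCont sinc2 0"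
proof -
  have "((\<lambda>h. (sin (0 + h) - sin 0) / h) \<longlongrightarrow> cos 0) (at (0::real))"
    using DERIV_sin[of "0::real"] unfolding DERIV_def .
  from tendsto_power[OF this, of 2] have "((\<lambda>h. (sin h / h)\<^sup>2) \<longlongrightarrow> 1) (at (0::real))"
    by simp
  then have "(sinc2 \<longlongrightarrow> 1) (at 0)"
    by (rule Lim_transform_eventually) (auto simp: sinc2_def eventually_at_filter)
  then show ?thesis by (simp add: isCont_def sinc2_def)
qed

text \<open>The majorant is a multiple of the derivative of arctan, hence integrable. Near 0 the
  derivative is controlled by sin s - s cos s \<le> s^3/2, away from 0 by the trivial bound
  4/s^2.\<close>

lemma sinc2_deriv_bound:
  assumes "s > 0"
  shows "\<exists>D. (sinc2 has_real_derivative D) (at s) \<and> \<bar>D\<bar> \<le> 8 / (1 + s\<^sup>2)"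
proof -
  define k where "k s = sin s - s * cos s" for s :: real
  define D where "D = - (2 * sin s * k s / s ^ 3)"
  have "((\<lambda>t. (sin t / t)\<^sup>2) has_real_derivative D) (at s)"
    using assms by (auto intro!: derivative_eq_intros simp: D_def k_def field_simps power2_eq_square power3_eq_cube)
  then have "(sinc2 has_real_derivative D) (at s)"
    by (rule has_field_derivative_transform_within_open[of _ _ _ "{0<..}"])
       (use assms in \<open>auto simp: sinc2_def\<close>)
  moreover have "\<bar>D\<bar> \<le> 8 / (1 + s\<^sup>2)"
  proof (cases "s \<le> 1")
    case True
    have "k 0 \<le> k s"
    proof (rule DERIV_nonneg_imp_nondecreasing[of 0 s k])
      fix x assume x: "0 \<le> x" "x \<le> s"
      have "(k has_real_derivative x * sin x) (at x)"
        unfolding k_def[abs_def] by (auto intro!: derivative_eq_intros)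
      moreover have "x * sin x \<ge> 0" using x True pi_gt3 by (intro mult_nonneg_nonneg sin_ge_zero) auto
      ultimately show "\<exists>y. (k has_real_derivative y) (at x) \<and> 0 \<le> y" by blast
    qed (use assms in simp)
    then have k0: "k s \<ge> 0" by (simp add: k_def)
    have ss: "0 \<le> sin s" "sin s \<le> s" using assms True pi_gt3 by (auto intro!: sin_ge_zero sin_x_le_x)
    have "1 - cos s = 2 * (sin (s / 2))\<^sup>2" using cos_double_sin[of "s / 2"] by simp
    also have "\<dots> \<le> 2 * (s / 2)\<^sup>2"
      using assms True pi_gt3 by (intro mult_left_mono power_mono sin_x_le_x sin_ge_zero) auto
    finally have "1 - cos s \<le> s\<^sup>2 / 2" by (simp add: power2_eq_square)
    then have "s * (1 - cos s) \<le> s * (s\<^sup>2 / 2)" using assms by (intro mult_left_mono) auto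
    then have "k s \<le> s ^ 3 / 2" using ss by (simp add: k_def algebra_simps power2_eq_square power3_eq_cube)
    then have "2 * sin s * k s \<le> 2 * s * (s ^ 3 / 2)"
      using ss k0 assms by (intro mult_mono) auto
    then have "2 * sin s * k s / s ^ 3 \<le> s"
      using assms by (simp add: pos_divide_le_eq)
    moreover have "2 * sin s * k s / s ^ 3 \<ge> 0" using ss k0 assms by simp
    ultimately have "\<bar>D\<bar> \<le> 1" using True by (simp add: D_def)
    moreover have "1 \<le> 8 / (1 + s\<^sup>2)"
      using power_mono[of s 1 2] True assms by (simp add: pos_le_divide_eq add_pos_nonneg)
    ultimately show ?thesis by linarith
  next
    case False
    have "\<bar>k s\<bar> \<le> \<bar>sin s\<bar> + \<bar>s * cos s\<bar>" unfolding k_def by (rule abs_triangle_ineq4)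
    also have "\<dots> \<le> 1 + s * 1" using assms by (intro add_mono) (auto simp: abs_mult)
    also have "\<dots> \<le> 2 * s" using False by simp
    finally have ks: "\<bar>k s\<bar> \<le> 2 * s" .
    have "\<bar>D\<bar> = 2 * \<bar>sin s\<bar> * \<bar>k s\<bar> / s ^ 3" using assms by (simp add: D_def abs_mult abs_divide)
    also have "\<dots> \<le> 2 * 1 * (2 * s) / s ^ 3"
      using ks assms by (intro divide_right_mono mult_mono) auto
    also have "\<dots> = 4 / s\<^sup>2" using assms by (simp add: power2_eq_square power3_eq_cube)
    also have "\<dots> \<le> 8 / (1 + s\<^sup>2)"
      using False power_mono[of 1 s 2] by (simp add: divide_simps add_pos_nonneg)
    finally show ?thesis .
  qed
  ultimately show ?thesis by blast
qed

text \<open>The essential point is independence of \<eta> and N. Each step after the first is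
  compared with 8 times the increment of arctan over the preceding grid interval, where the
  decreasing majorant is larger; the increments telescope to at most \<pi>/2.\<close>

lemma sinc2_variation:
  assumes \<eta>: "\<eta> > 0"
  shows "(\<Sum>n<N. \<bar>sinc2 (\<eta> * real (Suc n)) - sinc2 (\<eta> * real n)\<bar>) \<le> 1 + 4 * pi"
proof -
  have step: "\<bar>sinc2 (\<eta> * real (Suc n)) - sinc2 (\<eta> * real n)\<bar> \<le> 8 * (arctan (\<eta> * real n) - arctan (\<eta> * real (n - 1)))"
    if n: "n > 0" for n
  proof -
    define t where "t = \<eta> * real n"
    have t: "t > 0" and t': "\<eta> * real (Suc n) = t + \<eta>" "\<eta> * real (n - 1) = t - \<eta>"
      using \<eta> n by (auto simp: t_def algebra_simps of_nat_diff)
    obtain D where D: "\<And>s. s > 0 \<Longrightarrow> (sinc2 has_real_derivative D s) (at s)" "\<And>s. s > 0 \<Longrightarrow> \<bar>D s\<bar> \<le> 8 / (1 + s\<^sup>2)"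
      using sinc2_deriv_bound by metis
    obtain z where z: "t < z" "z < t + \<eta>" "sinc2 (t + \<eta>) - sinc2 t = (t + \<eta> - t) * D z"
      using MVT2[of t "t + \<eta>" sinc2 D] \<eta> t D(1) by auto
    have "\<bar>D z\<bar> \<le> 8 / (1 + z\<^sup>2)" using D(2) z t by simp
    also have "\<dots> \<le> 8 / (1 + t\<^sup>2)"
      using z t by (intro divide_left_mono add_left_mono power_mono mult_pos_pos add_pos_nonneg) auto
    finally have 1: "\<bar>sinc2 (t + \<eta>) - sinc2 t\<bar> \<le> \<eta> * (8 / (1 + t\<^sup>2))"
      using z(3) \<eta> mult_left_mono[of "\<bar>D z\<bar>" "8 / (1 + t\<^sup>2)" \<eta>] by (simp add: abs_mult)
    have t\<eta>: "t - \<eta> \<ge> 0" using \<eta> n by (simp add: t_def algebra_simps)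
    obtain y where y: "t - \<eta> < y" "y < t" "arctan t - arctan (t - \<eta>) = (t - (t - \<eta>)) * inverse (1 + y\<^sup>2)"
      using MVT2[of "t - \<eta>" t arctan "\<lambda>x. inverse (1 + x\<^sup>2)"] \<eta> DERIV_arctan by auto
    have "inverse (1 + t\<^sup>2) \<le> inverse (1 + y\<^sup>2)"
      using y t\<eta> by (intro le_imp_inverse_le add_left_mono power_mono add_pos_nonneg) auto
    then have "\<eta> * inverse (1 + t\<^sup>2) \<le> arctan t - arctan (t - \<eta>)" using y(3) \<eta> by simp
    then show ?thesis
      using 1 unfolding t' t_def[symmetric] by (simp add: divide_inverse)
  qed
  have "(\<Sum>n<N. \<bar>sinc2 (\<eta> * real (Suc n)) - sinc2 (\<eta> * real n)\<bar>) \<le> 1 + 8 * arctan (\<eta> * real (N - 1))"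
  proof (induction N)
    case (Suc N)
    show ?case
    proof (cases "N = 0")
      case True
      then show ?thesis using sinc2_bounds[of \<eta>] sinc2_bounds[of 0] by (auto simp: abs_le_iff)
    next
      case False
      then show ?thesis using Suc step[of N] by simp
    qed
  qed (simp add: sinc2_def)
  also have "\<dots> \<le> 1 + 4 * pi" using arctan_ubound[of "\<eta> * real (N - 1)"] by simp
  finally show ?thesis .
qed

text \<open>Riemann's first theorem for series with sum 0. Summation by parts moves the differences
  to the kernel: the tail costs \<epsilon> times its variation, uniformly in \<eta>, and the
  finitely many remaining differences vanish as \<eta> tends to 0 by continuity of the kernel at
  0.\<close>

lemma riemann_summation:
  fixes c :: "nat \<Rightarrow> real"
  assumes c: "c sums 0" and Z: "\<And>\<eta>. \<eta> > 0 \<Longrightarrow> (\<lambda>n. c n * sinc2 (\<eta> * real n)) sums Z \<eta>"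
  shows "(Z \<longlongrightarrow> 0) (at_right 0)"
proof (rule tendstoI)
  fix e :: real assume e: "e > 0"
  define V where "V = 1 + 4 * pi"
  have V: "V > 0" using pi_gt_zero unfolding V_def by linarith
  define \<epsilon> where "\<epsilon> = e / (2 * V)"
  have \<epsilon>: "\<epsilon> > 0" using e V by (simp add: \<epsilon>_def)
  define S where "S n = (\<Sum>k<n. c k)" for n
  define u where "u \<eta> n = sinc2 (\<eta> * real n)" for \<eta> n
  have S: "S \<longlonglongrightarrow> 0" using c by (simp add: sums_def S_def[abs_def])
  then obtain n0 where n0: "\<And>n. n \<ge> n0 \<Longrightarrow> \<bar>S n\<bar> \<le> \<epsilon>"
    using \<epsilon> unfolding LIMSEQ_iff by (metis diff_zero less_imp_le real_norm_def)
  have abel: "(\<Sum>n<N. c n * u \<eta> n) = S N * u \<eta> N - (\<Sum>n<N. S (Suc n) * (u \<eta> (Suc n) - u \<eta> n))" for \<eta> N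
    by (induction N) (simp_all add: S_def algebra_simps)
  have Z_le: "\<bar>Z \<eta>\<bar> \<le> (\<Sum>n<n0. \<bar>S (Suc n)\<bar> * \<bar>u \<eta> (Suc n) - u \<eta> n\<bar>) + \<epsilon> * V" if \<eta>: "\<eta> > 0" for \<eta>
  proof (rule tendsto_upperbound)
    show "(\<lambda>N. \<bar>(\<Sum>n<N. c n * u \<eta> n) - S N * u \<eta> N\<bar>) \<longlonglongrightarrow> \<bar>Z \<eta>\<bar>"
    proof -
      have "(\<lambda>N. \<Sum>n<N. c n * u \<eta> n) \<longlonglongrightarrow> Z \<eta>" using Z[OF \<eta>] by (simp add: sums_def u_def)
      moreover have "(\<lambda>N. S N * u \<eta> N) \<longlonglongrightarrow> 0"
      proof (rule tendsto_0_le[OF S, where K=1])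
        have "norm (S N * u \<eta> N) \<le> norm (S N) * 1" for N
          unfolding norm_mult using sinc2_bounds[of "\<eta> * real N"] by (intro mult_left_mono) (auto simp: u_def)
        then show "\<forall>\<^sub>F N in sequentially. norm (S N * u \<eta> N) \<le> norm (S N) * 1" by simp
      qed
      ultimately have "(\<lambda>N. (\<Sum>n<N. c n * u \<eta> n) - S N * u \<eta> N) \<longlonglongrightarrow> Z \<eta> - 0" by (rule tendsto_diff)
      then show ?thesis using tendsto_rabs by fastforce
    qed
    have "\<bar>(\<Sum>n<N. c n * u \<eta> n) - S N * u \<eta> N\<bar> \<le> (\<Sum>n<n0. \<bar>S (Suc n)\<bar> * \<bar>u \<eta> (Suc n) - u \<eta> n\<bar>) + \<epsilon> * V" for N
    proof -
      have "\<bar>(\<Sum>n<N. c n * u \<eta> n) - S N * u \<eta> N\<bar> \<le> (\<Sum>n<N. \<bar>S (Suc n)\<bar> * \<bar>u \<eta> (Suc n) - u \<eta> n\<bar>)"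
        unfolding abel using sum_abs[of "\<lambda>n. S (Suc n) * (u \<eta> (Suc n) - u \<eta> n)" "{..<N}"] by (simp add: abs_mult)
      also have "\<dots> \<le> (\<Sum>n<N. (if n < n0 then \<bar>S (Suc n)\<bar> * \<bar>u \<eta> (Suc n) - u \<eta> n\<bar> else 0) + \<epsilon> * \<bar>u \<eta> (Suc n) - u \<eta> n\<bar>)"
        using n0 \<epsilon> by (intro sum_mono) (auto intro!: mult_right_mono)
      also have "\<dots> = (\<Sum>n<N. if n < n0 then \<bar>S (Suc n)\<bar> * \<bar>u \<eta> (Suc n) - u \<eta> n\<bar> else 0) + \<epsilon> * (\<Sum>n<N. \<bar>u \<eta> (Suc n) - u \<eta> n\<bar>)"
        by (simp add: sum.distrib sum_distrib_left)
      also have "(\<Sum>n<N. if n < n0 then \<bar>S (Suc n)\<bar> * \<bar>u \<eta> (Suc n) - u \<eta> n\<bar> else 0)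
          \<le> (\<Sum>n<n0. \<bar>S (Suc n)\<bar> * \<bar>u \<eta> (Suc n) - u \<eta> n\<bar>)"
        by (subst sum.inter_filter[symmetric]) (auto intro!: sum_mono2)
      also have "\<epsilon> * (\<Sum>n<N. \<bar>u \<eta> (Suc n) - u \<eta> n\<bar>) \<le> \<epsilon> * V"
        using sinc2_variation[OF \<eta>, of N] \<epsilon> by (intro mult_left_mono) (auto simp: V_def u_def)
      finally show ?thesis by simp
    qed
    then show "\<forall>\<^sub>F N in sequentially. \<bar>(\<Sum>n<N. c n * u \<eta> n) - S N * u \<eta> N\<bar> \<le> (\<Sum>n<n0. \<bar>S (Suc n)\<bar> * \<bar>u \<eta> (Suc n) - u \<eta> n\<bar>) + \<epsilon> * V"
      by simp
  qed simp
  have "((\<lambda>\<eta>. \<Sum>n<n0. \<bar>S (Suc n)\<bar> * \<bar>u \<eta> (Suc n) - u \<eta> n\<bar>) \<longlongrightarrow> (\<Sum>n<n0. \<bar>S (Suc n)\<bar> * \<bar>1 - 1\<bar>)) (at_right 0)"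
  proof -
    have "((\<lambda>\<eta>. u \<eta> n) \<longlongrightarrow> 1) (at_right 0)" for n
    proof -
      have "((\<lambda>\<eta>. \<eta> * real n) \<longlongrightarrow> 0 * real n) (at_right 0)" by (intro tendsto_intros)
      then have "((\<lambda>\<eta>. u \<eta> n) \<longlongrightarrow> sinc2 0) (at_right 0)"
        unfolding u_def by (intro isCont_tendsto_compose[OF isCont_sinc2_0]) simp
      then show ?thesis by (simp add: sinc2_def)
    qed
    then show ?thesis by (intro tendsto_intros)
  qed
  then have "\<forall>\<^sub>F \<eta> in at_right 0. (\<Sum>n<n0. \<bar>S (Suc n)\<bar> * \<bar>u \<eta> (Suc n) - u \<eta> n\<bar>) < e / 2"
    using e by (intro order_tendstoD(2)) auto
  then show "\<forall>\<^sub>F \<eta> in at_right 0. dist (Z \<eta>) 0 < e"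
    using eventually_at_right_less[of 0]
  proof eventually_elim
    case (elim \<eta>)
    have "\<epsilon> * V = e / 2" using V by (simp add: \<epsilon>_def)
    then show ?case using Z_le[OF elim(2)] elim(1) by simp
  qed
qed

section \<open>Schwarz's theorem on vanishing symmetric second derivatives\<close>

lemma nonpos_if_symmetric_second_derivative_0:
  fixes F :: "real \<Rightarrow> real"
  assumes ab: "lo < hi" and cont: "continuous_on {lo..hi} F"
    and D2: "\<And>x. x \<in> {lo<..<hi} \<Longrightarrow> ((\<lambda>h. (F (x + h) + F (x - h) - 2 * F x) / h\<^sup>2) \<longlongrightarrow> 0) (at_right 0)"
    and F0: "F lo = 0" "F hi = 0" and x: "x \<in> {lo..hi}"
  shows "F x \<le> 0"
proof (rule ccontr)
  assume "\<not> F x \<le> 0"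
  then have Fx: "F x > 0" by simp
  \<comment> \<open>Small enough that the convex parabola added below takes away at most half of
    \<open>F x\<close>, so the perturbed function is still positive somewhere while vanishing at
    both ends.\<close>
  define \<epsilon> where "\<epsilon> = F x / (2 * (hi - lo)\<^sup>2)"
  have \<epsilon>: "\<epsilon> > 0" using Fx ab by (simp add: \<epsilon>_def)
  define \<phi> where "\<phi> y = F y + \<epsilon> * ((y - lo) * (y - hi))" for y
  have "continuous_on {lo..hi} \<phi>" unfolding \<phi>_def by (intro continuous_intros cont)
  then obtain y where y: "y \<in> {lo..hi}" "\<And>z. z \<in> {lo..hi} \<Longrightarrow> \<phi> z \<le> \<phi> y"
    using continuous_attains_sup[of "{lo..hi}" \<phi>] ab by auto
  have "(x - lo) * (hi - x) \<le> (hi - lo) * (hi - lo)" using x by (intro mult_mono) auto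
  then have "\<epsilon> * ((x - lo) * (hi - x)) \<le> \<epsilon> * (hi - lo)\<^sup>2"
    using \<epsilon> by (intro mult_left_mono) (auto simp: power2_eq_square)
  also have "\<dots> = F x / 2" using ab by (simp add: \<epsilon>_def)
  finally have "\<epsilon> * ((x - lo) * (hi - x)) \<le> F x / 2" .
  moreover have "\<epsilon> * ((x - lo) * (x - hi)) = - (\<epsilon> * ((x - lo) * (hi - x)))" by (simp add: algebra_simps)
  ultimately have "\<phi> x > 0" using Fx unfolding \<phi>_def by linarith
  with y(2)[OF x] have "\<phi> y > 0" by simp
  then have "y \<noteq> lo" "y \<noteq> hi" using F0 by (auto simp: \<phi>_def)
  with y(1) have y': "y \<in> {lo<..<hi}" by auto
  have "\<forall>\<^sub>F h in at_right 0. (F (y + h) + F (y - h) - 2 * F y) / h\<^sup>2 > - 2 * \<epsilon>"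
    using order_tendstoD(1)[OF D2[OF y'], of "- 2 * \<epsilon>"] \<epsilon> by simp
  moreover have "\<forall>\<^sub>F h in at_right 0. h < min (y - lo) (hi - y)"
    using y' eventually_at_right_less[of 0]
    by (intro eventually_at_rightI[of 0 "min (y - lo) (hi - y)"]) auto
  ultimately have "\<forall>\<^sub>F h in at_right (0::real). False"
    using eventually_at_right_less[of 0]
  proof eventually_elim
    case (elim h)
    \<comment> \<open>At an interior maximum the symmetric second difference is nonpositive, while
      the parabola contributes 2\<epsilon> h^2; the quotient for \<open>F\<close> then stays below
      -2\<epsilon> and cannot tend to 0.\<close>
    have "\<phi> (y + h) \<le> \<phi> y" "\<phi> (y - h) \<le> \<phi> y" using elim y' by (auto intro!: y(2))
    moreover have "\<phi> (y + h) + \<phi> (y - h) - 2 * \<phi> y = (F (y + h) + F (y - h) - 2 * F y) + 2 * \<epsilon> * h\<^sup>2"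
      by (simp add: \<phi>_def power2_eq_square algebra_simps)
    ultimately have "F (y + h) + F (y - h) - 2 * F y \<le> - 2 * \<epsilon> * h\<^sup>2" by linarith
    then have "(F (y + h) + F (y - h) - 2 * F y) / h\<^sup>2 \<le> - 2 * \<epsilon>"
      using elim by (simp add: pos_divide_le_eq)
    with elim show False by simp
  qed
  then show False by (simp add: eventually_False trivial_limit_at_right_real)
qed

text \<open>After subtracting the chord, the one-sided maximum argument applies to the remainder and
  to its negative.\<close>

lemma schwarz_affine:
  fixes F :: "real \<Rightarrow> real"
  assumes ab: "lo < hi" and cont: "continuous_on {lo..hi} F"
    and D2: "\<And>x. x \<in> {lo<..<hi} \<Longrightarrow> ((\<lambda>h. (F (x + h) + F (x - h) - 2 * F x) / h\<^sup>2) \<longlongrightarrow> 0) (at_right 0)"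
  obtains A B where "\<And>x. x \<in> {lo..hi} \<Longrightarrow> F x = A + B * x"
proof -
  define B where "B = (F hi - F lo) / (hi - lo)"
  define A where "A = F lo - B * lo"
  define G where "G x = F x - (A + B * x)" for x
  have G0: "G lo = 0" "G hi = 0"
  proof -
    have "B * (hi - lo) = F hi - F lo" using ab by (simp add: B_def)
    then show "G lo = 0" "G hi = 0" by (auto simp: G_def A_def algebra_simps)
  qed
  have contG: "continuous_on {lo..hi} G" unfolding G_def by (intro continuous_intros cont)
  have diff: "G (x + h) + G (x - h) - 2 * G x = F (x + h) + F (x - h) - 2 * F x" for x h
    by (simp add: G_def algebra_simps)
  have D2G: "((\<lambda>h. (G (x + h) + G (x - h) - 2 * G x) / h\<^sup>2) \<longlongrightarrow> 0) (at_right 0)" if "x \<in> {lo<..<hi}" for x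
    unfolding diff by (rule D2[OF that])
  have D2G': "((\<lambda>h. (- G (x + h) + - G (x - h) - 2 * (- G x)) / h\<^sup>2) \<longlongrightarrow> 0) (at_right 0)" if "x \<in> {lo<..<hi}" for x
  proof -
    have "(- G (x + h) + - G (x - h) - 2 * (- G x)) / h\<^sup>2 = - ((G (x + h) + G (x - h) - 2 * G x) / h\<^sup>2)" for h
      by (simp add: minus_divide_left)
    then show ?thesis using tendsto_minus[OF D2G[OF that]] by simp
  qed
  have "G x = 0" if "x \<in> {lo..hi}" for x
  proof (rule antisym)
    show "G x \<le> 0" by (rule nonpos_if_symmetric_second_derivative_0[OF ab contG D2G G0 that])
    have "- G x \<le> 0"
      by (rule nonpos_if_symmetric_second_derivative_0[OF ab continuous_on_minus[OF contG] D2G' _ _ that]) (auto simp: G0)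
    then show "0 \<le> G x" by simp
  qed
  then show thesis by (intro that[of A B]) (simp add: G_def)
qed

text \<open>The trigonometric series formally integrated twice. The constant term yields the
  quadratic, so the series part starts at index 1 and converges uniformly for bounded
  coefficients.\<close>

definition riemann_fun :: "(nat \<Rightarrow> real) \<Rightarrow> (nat \<Rightarrow> real) \<Rightarrow> real \<Rightarrow> real" where
  "riemann_fun a b x = a 0 * x\<^sup>2 / 2 - (\<Sum>n. trig_term a b (Suc n) x / (4 * pi\<^sup>2 * (real (Suc n))\<^sup>2))"

context
  fixes a b :: "nat \<Rightarrow> real" and M :: real
  assumes M: "\<And>n. \<bar>a n\<bar> + \<bar>b n\<bar> \<le> M"
begin

lemma coefficient_bound_nonneg: "M \<ge> 0"
  using M[of 0] by linarith

abbreviation riemann_term :: "nat \<Rightarrow> real \<Rightarrow> real" where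
  "riemann_term n x \<equiv> trig_term a b (Suc n) x / (4 * pi\<^sup>2 * (real (Suc n))\<^sup>2)"

lemma riemann_term_le: "norm (riemann_term n x) \<le> M * (1 / (real (Suc n))\<^sup>2)"
proof -
  have "1 * 1 \<le> 4 * pi\<^sup>2" using power_mono[of 1 pi 2] pi_gt3 by (intro mult_mono) auto
  then have "1 * (real (Suc n))\<^sup>2 \<le> 4 * pi\<^sup>2 * (real (Suc n))\<^sup>2" by (intro mult_right_mono) auto
  then have "\<bar>trig_term a b (Suc n) x\<bar> / (4 * pi\<^sup>2 * (real (Suc n))\<^sup>2) \<le> M / (1 * (real (Suc n))\<^sup>2)"
    using trig_term_le[of a b "Suc n" x] M[of "Suc n"] coefficient_bound_nonneg by (intro frac_le) auto
  then show ?thesis by (simp add: abs_divide abs_mult)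
qed

lemma summable_riemann_term_bound: "summable (\<lambda>n. M * (1 / (real (Suc n))\<^sup>2))"
proof (rule summable_mult)
  have "summable (\<lambda>n. 1 / (real n)\<^sup>2)"
    using inverse_power_summable[of 2, where 'a=real] by (simp add: inverse_eq_divide)
  then show "summable (\<lambda>n. 1 / (real (Suc n))\<^sup>2)" by (subst summable_Suc_iff)
qed

lemma summable_riemann_term: "summable (\<lambda>n. riemann_term n x)"
  by (rule summable_comparison_test'[OF summable_riemann_term_bound riemann_term_le])

lemma uniform_limit_riemann_term: "uniform_limit S (\<lambda>N x. \<Sum>n<N. riemann_term n x) (\<lambda>x. \<Sum>n. riemann_term n x) sequentially"
  by (rule Weierstrass_m_test[OF riemann_term_le summable_riemann_term_bound])

lemma continuous_on_riemann_fun: "continuous_on S (riemann_fun a b)"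
proof -
  have "continuous_on S (\<lambda>x. \<Sum>n. riemann_term n x)"
    by (rule uniform_limit_theorem[OF _ uniform_limit_riemann_term])
       (auto intro!: always_eventually continuous_intros simp: trig_term_def)
  then show ?thesis
    unfolding riemann_fun_def by (intro continuous_intros) auto
qed

lemma riemann_fun_second_difference:
  assumes h: "h > 0"
  shows "(\<lambda>n. trig_term a b n x * sinc2 (pi * h * real n)) sums
    ((riemann_fun a b (x + h) + riemann_fun a b (x - h) - 2 * riemann_fun a b x) / h\<^sup>2)"
proof -
  have G2: "riemann_term n (x + h) + riemann_term n (x - h) - 2 * riemann_term n x = - h\<^sup>2 * (trig_term a b (Suc n) x * sinc2 (pi * h * real (Suc n)))" for n
  proof -
    define t where "t = pi * h * real (Suc n)"
    define y where "y = 2 * pi * real (Suc n) * x"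
    have t: "t \<noteq> 0" using h by (simp add: t_def)
    have yt: "2 * pi * real (Suc n) * (x + h) = y + 2 * t" "2 * pi * real (Suc n) * (x - h) = y - 2 * t"
      by (simp_all add: y_def t_def algebra_simps)
    have "trig_term a b (Suc n) (x + h) + trig_term a b (Suc n) (x - h) - 2 * trig_term a b (Suc n) x
        = 2 * (cos (2 * t) - 1) * trig_term a b (Suc n) x"
      unfolding trig_term_def yt y_def[symmetric] by (simp add: cos_add cos_diff sin_add sin_diff algebra_simps)
    also have "cos (2 * t) - 1 = - 2 * (sin t)\<^sup>2" by (simp add: cos_double_sin)
    finally have e: "trig_term a b (Suc n) (x + h) + trig_term a b (Suc n) (x - h) - 2 * trig_term a b (Suc n) x
        = 2 * (- 2 * (sin t)\<^sup>2) * trig_term a b (Suc n) x" .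
    have "riemann_term n (x + h) + riemann_term n (x - h) - 2 * riemann_term n x
        = (trig_term a b (Suc n) (x + h) + trig_term a b (Suc n) (x - h) - 2 * trig_term a b (Suc n) x) / (4 * pi\<^sup>2 * (real (Suc n))\<^sup>2)"
      by (simp only: diff_divide_distrib add_divide_distrib times_divide_eq_right)
    also note e
    also have "2 * (- 2 * (sin t)\<^sup>2) * trig_term a b (Suc n) x / (4 * pi\<^sup>2 * (real (Suc n))\<^sup>2)
        = - h\<^sup>2 * (trig_term a b (Suc n) x * sinc2 t)"
    proof -
      have den: "4 * pi\<^sup>2 * (real (Suc n))\<^sup>2 = 4 * t\<^sup>2 / h\<^sup>2"
        using h by (simp add: t_def power_mult_distrib)
      show ?thesis unfolding den using t h by (simp add: sinc2_def power_divide)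
    qed
    finally show ?thesis unfolding t_def .
  qed
  have "(\<lambda>n. riemann_term n (x + h) + riemann_term n (x - h) - 2 * riemann_term n x) sums ((\<Sum>n. riemann_term n (x + h)) + (\<Sum>n. riemann_term n (x - h)) - 2 * (\<Sum>n. riemann_term n x))"
    by (intro sums_add sums_diff sums_mult summable_sums summable_riemann_term)
  then have "(\<lambda>n. - (1 / h\<^sup>2) * (riemann_term n (x + h) + riemann_term n (x - h) - 2 * riemann_term n x)) sums
      (- (1 / h\<^sup>2) * ((\<Sum>n. riemann_term n (x + h)) + (\<Sum>n. riemann_term n (x - h)) - 2 * (\<Sum>n. riemann_term n x)))"
    by (rule sums_mult)
  moreover have "- (1 / h\<^sup>2) * (riemann_term n (x + h) + riemann_term n (x - h) - 2 * riemann_term n x) = trig_term a b (Suc n) x * sinc2 (pi * h * real (Suc n))" for n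
    unfolding G2 using h by simp
  ultimately have "(\<lambda>n. trig_term a b (Suc n) x * sinc2 (pi * h * real (Suc n))) sums
      (- (1 / h\<^sup>2) * ((\<Sum>n. riemann_term n (x + h)) + (\<Sum>n. riemann_term n (x - h)) - 2 * (\<Sum>n. riemann_term n x)))"
    by (simp only:)
  then have "(\<lambda>n. trig_term a b n x * sinc2 (pi * h * real n)) sums
      (- (1 / h\<^sup>2) * ((\<Sum>n. riemann_term n (x + h)) + (\<Sum>n. riemann_term n (x - h)) - 2 * (\<Sum>n. riemann_term n x)) + trig_term a b 0 x * sinc2 (pi * h * real 0))"
    by (rule sums_Suc)
  moreover have "- (1 / h\<^sup>2) * ((\<Sum>n. riemann_term n (x + h)) + (\<Sum>n. riemann_term n (x - h)) - 2 * (\<Sum>n. riemann_term n x)) + trig_term a b 0 x * sinc2 (pi * h * real 0)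
      = (riemann_fun a b (x + h) + riemann_fun a b (x - h) - 2 * riemann_fun a b x) / h\<^sup>2"
  proof -
    \<comment> \<open>The quadratic part supplies exactly the term of index 0, since the kernel
      equals 1 at 0.\<close>
    have "a 0 * (x + h)\<^sup>2 / 2 + a 0 * (x - h)\<^sup>2 / 2 - 2 * (a 0 * x\<^sup>2 / 2) = a 0 * h\<^sup>2"
      by (simp add: power2_eq_square field_simps)
    then have "riemann_fun a b (x + h) + riemann_fun a b (x - h) - 2 * riemann_fun a b x
        = a 0 * h\<^sup>2 - ((\<Sum>n. riemann_term n (x + h)) + (\<Sum>n. riemann_term n (x - h)) - 2 * (\<Sum>n. riemann_term n x))"
      unfolding riemann_fun_def by simp
    then show ?thesis using h by (simp add: trig_term_def sinc2_def diff_divide_distrib)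
  qed
  ultimately show ?thesis by (simp only:)
qed

lemma riemann_fun_second_derivative:
  assumes "(\<lambda>n. trig_term a b n x) sums 0"
  shows "((\<lambda>h. (riemann_fun a b (x + h) + riemann_fun a b (x - h) - 2 * riemann_fun a b x) / h\<^sup>2) \<longlongrightarrow> 0) (at_right 0)"
proof -
  define Z where "Z \<eta> = (riemann_fun a b (x + \<eta> / pi) + riemann_fun a b (x - \<eta> / pi) - 2 * riemann_fun a b x) / (\<eta> / pi)\<^sup>2" for \<eta>
  have "(Z \<longlongrightarrow> 0) (at_right 0)"
  proof (rule riemann_summation[OF assms])
    fix \<eta> :: real assume "\<eta> > 0"
    then show "(\<lambda>n. trig_term a b n x * sinc2 (\<eta> * real n)) sums Z \<eta>"
      using riemann_fun_second_difference[of "\<eta> / pi" x] by (simp add: Z_def)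
  qed
  moreover have "filterlim (\<lambda>h. pi * h) (at_right 0) (at_right 0)"
    unfolding filterlim_at
  proof
    show "((\<lambda>h. pi * h) \<longlongrightarrow> 0) (at_right 0)" by (auto intro!: tendsto_eq_intros)
    show "\<forall>\<^sub>F h in at_right 0. pi * h \<in> {0<..} \<and> pi * h \<noteq> 0"
      using eventually_at_right_less[of 0] by eventually_elim simp
  qed
  ultimately have "((\<lambda>h. Z (pi * h)) \<longlongrightarrow> 0) (at_right 0)" by (rule filterlim_compose)
  then show ?thesis by (simp add: Z_def)
qed

end

section \<open>Test functions and their Fourier decay\<close>

lemma has_integral_green:
  fixes E f :: "real \<Rightarrow> complex"
  assumes ab: "lo \<le> hi"
    and E: "\<And>x. (E has_vector_derivative E1 x) (at x)" "\<And>x. (E1 has_vector_derivative E2 x) (at x)"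
    and f: "\<And>x. (f has_vector_derivative f1 x) (at x)" "\<And>x. (f1 has_vector_derivative f2 x) (at x)"
    and f0: "f lo = 0" "f hi = 0" "f1 lo = 0" "f1 hi = 0"
  shows "((\<lambda>x. E x * f2 x - E2 x * f x) has_integral 0) {lo..hi}"
proof -
  \<comment> \<open>The integrand is the derivative of E f' - E' f, which vanishes at both ends
    together with f and f'.\<close>
  have "((\<lambda>x. E x * f2 x - E2 x * f x) has_integral (E hi * f1 hi - E1 hi * f hi) - (E lo * f1 lo - E1 lo * f lo)) {lo..hi}"
  proof (rule fundamental_theorem_of_calculus[OF ab])
    fix x
    have "((\<lambda>x. E x * f1 x - E1 x * f x) has_vector_derivative
        (E x * f2 x + E1 x * f1 x) - (E1 x * f1 x + E2 x * f x)) (at x)"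
      by (intro has_vector_derivative_diff has_vector_derivative_mult E f)
    then show "((\<lambda>x. E x * f1 x - E1 x * f x) has_vector_derivative (E x * f2 x - E2 x * f x)) (at x within {lo..hi})"
      by (auto intro: has_vector_derivative_at_within simp: algebra_simps)
  qed
  then show ?thesis by (simp add: f0)
qed

text \<open>A \<open>C\<^sup>2\<close> bump on \<open>{lo..hi}\<close>. It is not cut off to \<open>0\<close> outside, where it is never integrated.\<close>

definition bump :: "real \<Rightarrow> real \<Rightarrow> real \<Rightarrow> complex" where
  "bump lo hi y = of_real (((y - lo) * (hi - y)) ^ 3)"

definition bump1 :: "real \<Rightarrow> real \<Rightarrow> real \<Rightarrow> complex" where
  "bump1 lo hi y = of_real (3 * ((y - lo) * (hi - y))\<^sup>2 * (lo + hi - 2 * y))"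

definition bump2 :: "real \<Rightarrow> real \<Rightarrow> real \<Rightarrow> complex" where
  "bump2 lo hi y = of_real (6 * ((y - lo) * (hi - y)) * (lo + hi - 2 * y)\<^sup>2 - 6 * ((y - lo) * (hi - y))\<^sup>2)"

lemma bump_derivs:
  "(bump lo hi has_vector_derivative bump1 lo hi y) (at y)"
  "(bump1 lo hi has_vector_derivative bump2 lo hi y) (at y)"
proof -
  have "((\<lambda>y. ((y - lo) * (hi - y)) ^ 3) has_real_derivative 3 * ((y - lo) * (hi - y))\<^sup>2 * (lo + hi - 2 * y)) (at y)"
    by (auto intro!: derivative_eq_intros simp: power2_eq_square power3_eq_cube algebra_simps)
  then show "(bump lo hi has_vector_derivative bump1 lo hi y) (at y)"
    unfolding bump_def[abs_def] bump1_def
    by (intro has_vector_derivative_of_real) (simp add: has_real_derivative_iff_has_vector_derivative)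
  have "((\<lambda>y. 3 * ((y - lo) * (hi - y))\<^sup>2 * (lo + hi - 2 * y)) has_real_derivative
      6 * ((y - lo) * (hi - y)) * (lo + hi - 2 * y)\<^sup>2 - 6 * ((y - lo) * (hi - y))\<^sup>2) (at y)"
    by (auto intro!: derivative_eq_intros simp: power2_eq_square algebra_simps)
  then show "(bump1 lo hi has_vector_derivative bump2 lo hi y) (at y)"
    unfolding bump1_def[abs_def] bump2_def
    by (intro has_vector_derivative_of_real) (simp add: has_real_derivative_iff_has_vector_derivative)
qed

lemma bump_boundary:
  "bump lo hi lo = 0" "bump lo hi hi = 0" "bump1 lo hi lo = 0" "bump1 lo hi hi = 0"
  by (simp_all add: bump_def bump1_def)

lemma continuous_on_bump [continuous_intros]:
  "continuous_on S (bump lo hi)" "continuous_on S (bump2 lo hi)"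
  unfolding bump_def[abs_def] bump2_def[abs_def] by (intro continuous_intros)+

definition bump_hat :: "real \<Rightarrow> real \<Rightarrow> real \<Rightarrow> complex" where
  "bump_hat lo hi \<xi> = integral {lo..hi} (\<lambda>y. cis (2 * pi * \<xi> * y) * bump lo hi y)"

lemma cis_derivs:
  "((\<lambda>x. cis (c * x)) has_vector_derivative \<i> * of_real c * cis (c * x)) (at x)"
proof -
  have "((\<lambda>z. exp (\<i> * of_real c * z)) has_field_derivative \<i> * of_real c * exp (\<i> * of_real c * of_real x)) (at (of_real x))"
    by (auto intro!: derivative_eq_intros)
  from has_vector_derivative_real_field[OF this] show ?thesis
    by (simp add: cis_conv_exp mult.assoc)
qed

lemma cis_second_deriv:
  "((\<lambda>x. \<i> * of_real c * cis (c * x)) has_vector_derivative - (of_real c)\<^sup>2 * cis (c * x)) (at x)"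
proof -
  have "((\<lambda>x. \<i> * of_real c * cis (c * x)) has_vector_derivative \<i> * of_real c * (\<i> * of_real c * cis (c * x))) (at x)"
    by (intro has_vector_derivative_mult_right cis_derivs)
  moreover have "\<i> * of_real c * (\<i> * of_real c * cis (c * x)) = (\<i> * \<i>) * ((of_real c)\<^sup>2 * cis (c * x))"
    by (simp only: power2_eq_square mult_ac)
  ultimately show ?thesis by simp
qed

lemma bump_hat_0:
  assumes "lo < hi"
  shows "bump_hat lo hi 0 \<noteq> 0"
proof -
  define f where "f y = ((y - lo) * (hi - y)) ^ 3" for y
  have cont: "continuous_on {lo..hi} f" unfolding f_def by (intro continuous_intros)
  have "bump_hat lo hi 0 = integral {lo..hi} (\<lambda>y. complex_of_real (f y))"
    by (simp add: bump_hat_def bump_def f_def)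
  also have "\<dots> = of_real (integral {lo..hi} f)"
    by (intro integral_unique has_integral_of_real integrable_integral integrable_continuous_interval cont)
  finally have "bump_hat lo hi 0 = of_real (integral {lo..hi} f)" .
  moreover have "integral {lo..hi} f \<noteq> 0"
  proof
    assume "integral {lo..hi} f = 0"
    then have "\<forall>y\<in>{lo..hi}. f y = 0"
      using integral_eq_0_iff[OF cont assms] by (simp add: f_def)
    moreover have "f ((lo + hi) / 2) > 0"
      unfolding f_def using assms by (intro zero_less_power mult_pos_pos) auto
    ultimately show False using assms by (auto dest!: bspec[of _ _ "(lo + hi) / 2"])
  qed
  ultimately show ?thesis by simp
qed

text \<open>Green's identity moves two derivatives from the exponential to the bump. Quadratic decay
  is what makes the weights of the unwanted frequencies summable.\<close>

lemma bump_hat_decay: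
  assumes "lo < hi"
  obtains C where "\<And>\<xi>. \<xi> \<noteq> 0 \<Longrightarrow> norm (bump_hat lo hi \<xi>) \<le> C / \<xi>\<^sup>2"
proof -
  define C where "C = integral {lo..hi} (\<lambda>y. norm (bump2 lo hi y))"
  have "norm (bump_hat lo hi \<xi>) \<le> (C / (4 * pi\<^sup>2)) / \<xi>\<^sup>2" if \<xi>: "\<xi> \<noteq> 0" for \<xi>
  proof -
    define c where "c = 2 * pi * \<xi>"
    have c: "c \<noteq> 0" using \<xi> by (simp add: c_def)
    have int1: "(\<lambda>y. cis (c * y) * bump2 lo hi y) integrable_on {lo..hi}"
      by (intro integrable_continuous_interval continuous_intros)
    have "((\<lambda>y. cis (c * y) * bump2 lo hi y - (- (of_real c)\<^sup>2 * cis (c * y)) * bump lo hi y) has_integral 0) {lo..hi}"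
      using assms by (intro has_integral_green[OF _ cis_derivs cis_second_deriv bump_derivs bump_boundary]) auto
    from has_integral_diff[OF this integrable_integral[OF int1]]
    have "((\<lambda>y. (of_real c)\<^sup>2 * (cis (c * y) * bump lo hi y)) has_integral - integral {lo..hi} (\<lambda>y. cis (c * y) * bump2 lo hi y)) {lo..hi}"
      by (simp add: mult.assoc)
    from integral_unique[OF this] have "(of_real c)\<^sup>2 * bump_hat lo hi \<xi> = - integral {lo..hi} (\<lambda>y. cis (c * y) * bump2 lo hi y)"
      by (simp add: bump_hat_def c_def)
    then have "c\<^sup>2 * norm (bump_hat lo hi \<xi>) = norm (integral {lo..hi} (\<lambda>y. cis (c * y) * bump2 lo hi y))"
      by (metis norm_minus_cancel norm_mult norm_of_real norm_power power2_abs)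
    also have "\<dots> \<le> C"
      unfolding C_def using int1
      by (intro integral_norm_bound_integral integrable_continuous_interval continuous_intros) (auto simp: norm_mult)
    finally show ?thesis using c by (simp add: c_def field_simps power_mult_distrib)
  qed
  then show thesis by (rule that)
qed

section \<open>Periodized test functions and their pairing with the series\<close>

lemma sum_cis_roots:
  fixes k :: int and N :: nat
  assumes N: "N > 0"
  shows "(\<Sum>i<N. cis (2 * pi * (of_int k * real i / real N))) = (if int N dvd k then of_nat N else 0)"
proof -
  define z where "z = cis (2 * pi * (of_int k / real N))"
  have z: "cis (2 * pi * (of_int k * real i / real N)) = z ^ i" for i
    unfolding z_def Complex.DeMoivre by (simp add: ac_simps)
  have zN: "z ^ N = 1"
  proof -
    have "z ^ N = cis (2 * pi * of_int k)" unfolding z_def Complex.DeMoivre using N by simp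
    then show ?thesis by (simp add: cis_multiple_2pi)
  qed
  show ?thesis
  proof (cases "int N dvd k")
    case True
    then obtain m where "k = int N * m" by (auto elim: dvdE)
    then have "z = cis (2 * pi * of_int m)" using N by (simp add: z_def)
    then have "z = 1" by (simp add: cis_multiple_2pi)
    then show ?thesis unfolding z using True by simp
  next
    case False
    have "z \<noteq> 1"
    proof
      assume "z = 1"
      then have "cos (2 * pi * (of_int k / real N)) = 1" by (metis z_def cis.simps(1) one_complex.simps(1))
      then obtain n :: int where "2 * pi * (of_int k / real N) = n * 2 * pi" by (auto simp: cos_one_2pi_int)
      then have "2 * pi * (of_int k / real N) = 2 * pi * n" by simp
      then have "of_int k / real N = n" by (subst (asm) mult_cancel_left) simp
      then have "real_of_int k = real_of_int (n * int N)" using N by (simp add: field_simps)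
      then have "k = n * int N" by (simp only: of_int_eq_iff)
      with False show False by simp
    qed
    then show ?thesis unfolding z using False zN by (simp add: geometric_sum)
  qed
qed

definition dilated_bump :: "real \<Rightarrow> real \<Rightarrow> nat \<Rightarrow> nat \<Rightarrow> nat \<Rightarrow> real \<Rightarrow> complex" where
  "dilated_bump lo hi N m i x = cis (- (2 * pi * real m) * x) * bump lo hi (real N * x - real i)"

abbreviation gap_left :: "real \<Rightarrow> nat \<Rightarrow> nat \<Rightarrow> real" where
  "gap_left lo N i \<equiv> (real i + lo) / real N"

abbreviation gap :: "real \<Rightarrow> real \<Rightarrow> nat \<Rightarrow> nat \<Rightarrow> real set" where
  "gap lo hi N i \<equiv> {gap_left lo N i..gap_left hi N i}"

text \<open>Substituting y = N x - i, every gap contributes the same transform at k/N up to the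
  phase of k i/N; summed over i, the phases select the multiples of N.\<close>

lemma sum_integral_cis_dilated_bump:
  fixes k :: int
  assumes N: "N > 0" and lohi: "lo < hi"
  shows "(\<Sum>i<N. integral (gap lo hi N i) (\<lambda>x. cis (2 * pi * of_int k * x) * bump lo hi (real N * x - real i)))
    = (if int N dvd k then bump_hat lo hi (of_int k / real N) else 0)"
proof -
  define g where "g i x = cis (2 * pi * of_int k * x) * bump lo hi (real N * x - real i)" for i x
  have "integral (gap lo hi N i) (g i) =
      cis (2 * pi * (of_int k * real i / real N)) * bump_hat lo hi (of_int k / real N) / of_nat N" for i
  proof -
    define \<xi> where "\<xi> = of_int k / real N"
    have cont: "(\<lambda>y. cis (2 * pi * \<xi> * y) * bump lo hi y) integrable_on cbox lo hi"
      unfolding cbox_interval by (intro integrable_continuous_interval continuous_intros)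
    have "((\<lambda>x. cis (2 * pi * \<xi> * (real N * x + - real i)) * bump lo hi (real N * x + - real i)) has_integral
        (1 / \<bar>real N\<bar> ^ DIM(real)) *\<^sub>R bump_hat lo hi \<xi>) ((\<lambda>x. (1 / real N) *\<^sub>R x + - ((1 / real N) *\<^sub>R - real i)) ` cbox lo hi)"
      using has_integral_affinity[OF integrable_integral[OF cont], of "real N" "- real i"] N
      by (simp add: bump_hat_def)
    moreover have "(\<lambda>x. (1 / real N) *\<^sub>R x + - ((1 / real N) *\<^sub>R - real i)) ` cbox lo hi = (gap lo hi N i)"
      using N lohi image_affinity_atLeastAtMost[of "1 / real N" "real i / real N" lo hi]
      by (simp add: add_divide_distrib add.commute)
    ultimately have "((\<lambda>x. cis (2 * pi * \<xi> * (real N * x - real i)) * bump lo hi (real N * x - real i)) has_integral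
        bump_hat lo hi \<xi> / of_nat N) (gap lo hi N i)"
      using N by (simp add: scaleR_conv_of_real)
    from has_integral_mult_right[OF this, of "cis (2 * pi * (of_int k * real i / real N))"]
    have "((\<lambda>x. cis (2 * pi * (of_int k * real i / real N)) * (cis (2 * pi * \<xi> * (real N * x - real i)) * bump lo hi (real N * x - real i)))
        has_integral cis (2 * pi * (of_int k * real i / real N)) * bump_hat lo hi \<xi> / of_nat N) (gap lo hi N i)"
      by simp
    moreover have "cis (2 * pi * (of_int k * real i / real N)) * (cis (2 * pi * \<xi> * (real N * x - real i)) * bump lo hi (real N * x - real i)) = g i x" for x
    proof -
      have "2 * pi * (of_int k * real i / real N) + 2 * pi * \<xi> * (real N * x - real i) = 2 * pi * of_int k * x"
        using N by (simp add: \<xi>_def field_simps)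
      then show ?thesis by (simp only: g_def mult.assoc[symmetric] cis_mult)
    qed
    ultimately have "(g i has_integral cis (2 * pi * (of_int k * real i / real N)) * bump_hat lo hi \<xi> / of_nat N) (gap lo hi N i)"
      by (simp only:)
    then show ?thesis unfolding \<xi>_def by (rule integral_unique)
  qed
  then have "(\<Sum>i<N. integral (gap lo hi N i) (g i))
      = (\<Sum>i<N. cis (2 * pi * (of_int k * real i / real N))) * (bump_hat lo hi (of_int k / real N) / of_nat N)"
    by (simp add: sum_distrib_right sum_divide_distrib)
  then show ?thesis
    unfolding g_def sum_cis_roots[OF N] using N by simp
qed

lemma trig_term_complex:
  "complex_of_real (trig_term a b n x) =
     (Complex (a n) (- b n) * cis (2 * pi * real n * x) + Complex (a n) (b n) * cis (- (2 * pi * real n) * x)) / 2"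
  by (simp add: trig_term_def complex_eq_iff)

lemma trig_term_0: "trig_term a b 0 x = a 0"
  by (simp add: trig_term_def)

text \<open>The pairing of the trigonometric series with the test function \<open>e\<^bsup>-2\<pi>imx\<^esup> \<psi>(N x)\<close>, where \<open>\<psi>\<close> is
  the periodized bump, only sees the coefficients with index \<open>\<equiv> \<plusminus>m\<close> modulo \<open>N\<close>.\<close>

definition test_pairing :: "(nat \<Rightarrow> real) \<Rightarrow> (nat \<Rightarrow> real) \<Rightarrow> real \<Rightarrow> real \<Rightarrow> nat \<Rightarrow> nat \<Rightarrow> nat \<Rightarrow> complex" where
  "test_pairing a b lo hi N m n =
     (\<Sum>i<N. integral (gap lo hi N i) (\<lambda>x. of_real (trig_term a b n x) * dilated_bump lo hi N m i x))"

lemma test_pairing_eq: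
  assumes N: "N > 0" and lohi: "lo < hi"
  shows "test_pairing a b lo hi N m n =
    (Complex (a n) (- b n) * (if int N dvd int n - int m then bump_hat lo hi ((real n - real m) / real N) else 0)
     + Complex (a n) (b n) * (if int N dvd int n + int m then bump_hat lo hi (- (real n + real m) / real N) else 0)) / 2"
proof -
  define I where "I k i = integral (gap lo hi N i) (\<lambda>x. cis (2 * pi * of_int k * x) * bump lo hi (real N * x - real i))" for k :: int and i
  have integrable: "(\<lambda>x. cis (2 * pi * of_int k * x) * bump lo hi (real N * x - real i)) integrable_on (gap lo hi N i)" for k :: int and i
    by (intro integrable_continuous_interval continuous_intros continuous_on_compose2[OF continuous_on_bump(1)[of UNIV]]) auto
  have "integral (gap lo hi N i) (\<lambda>x. of_real (trig_term a b n x) * dilated_bump lo hi N m i x)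
      = Complex (a n) (- b n) / 2 * I (int n - int m) i + Complex (a n) (b n) / 2 * I (- (int n + int m)) i" for i
  proof (rule integral_unique)
    have "((\<lambda>x. Complex (a n) (- b n) / 2 * (cis (2 * pi * of_int (int n - int m) * x) * bump lo hi (real N * x - real i))
         + Complex (a n) (b n) / 2 * (cis (2 * pi * of_int (- (int n + int m)) * x) * bump lo hi (real N * x - real i)))
        has_integral Complex (a n) (- b n) / 2 * I (int n - int m) i + Complex (a n) (b n) / 2 * I (- (int n + int m)) i)
        (gap lo hi N i)"
      unfolding I_def by (intro has_integral_add has_integral_mult_right integrable_integral integrable)
    moreover have "Complex (a n) (- b n) / 2 * (cis (2 * pi * of_int (int n - int m) * x) * bump lo hi (real N * x - real i))
         + Complex (a n) (b n) / 2 * (cis (2 * pi * of_int (- (int n + int m)) * x) * bump lo hi (real N * x - real i))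
        = of_real (trig_term a b n x) * dilated_bump lo hi N m i x" for x
    proof -
      have e: "2 * pi * of_int (int n - int m) * x = 2 * pi * real n * x + - (2 * pi * real m) * x"
        "2 * pi * of_int (- (int n + int m)) * x = - (2 * pi * real n) * x + - (2 * pi * real m) * x"
        by (simp_all add: algebra_simps)
      show ?thesis
        unfolding trig_term_complex dilated_bump_def e cis_mult[symmetric] by (simp add: algebra_simps add_divide_distrib)
    qed
    ultimately show "((\<lambda>x. of_real (trig_term a b n x) * dilated_bump lo hi N m i x) has_integral
        Complex (a n) (- b n) / 2 * I (int n - int m) i + Complex (a n) (b n) / 2 * I (- (int n + int m)) i) (gap lo hi N i)"
      by (simp only:)
  qed
  then have "test_pairing a b lo hi N m n
      = Complex (a n) (- b n) / 2 * (\<Sum>i<N. I (int n - int m) i) + Complex (a n) (b n) / 2 * (\<Sum>i<N. I (- (int n + int m)) i)"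
    by (simp add: test_pairing_def sum.distrib sum_distrib_left)
  then show ?thesis
    unfolding I_def sum_integral_cis_dilated_bump[OF N lohi] dvd_minus_iff
    by (simp add: add_divide_distrib)
qed

text \<open>The derivatives are hidden behind \<open>obtains\<close>, because later only their
  continuity and vanishing at the ends of the gap matter.\<close>

lemma dilated_bump_derivs:
  obtains f1 f2 where
    "\<And>x. (dilated_bump lo hi N m i has_vector_derivative f1 x) (at x)"
    "\<And>x. (f1 has_vector_derivative f2 x) (at x)" "continuous_on UNIV f2"
    "N > 0 \<Longrightarrow> f1 (gap_left lo N i) = 0" "N > 0 \<Longrightarrow> f1 (gap_left hi N i) = 0"
proof -
  define c where "c = - (2 * pi * real m)"
  define y where "y x = real N * x - real i" for x
  have y: "(y has_vector_derivative real N) (at x)" for x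
    unfolding y_def[abs_def] by (auto intro!: derivative_eq_intros simp: has_real_derivative_iff_has_vector_derivative[symmetric])
  have b: "((\<lambda>x. bump lo hi (y x)) has_vector_derivative of_nat N * bump1 lo hi (y x)) (at x)"
    "((\<lambda>x. bump1 lo hi (y x)) has_vector_derivative of_nat N * bump2 lo hi (y x)) (at x)" for x
    using vector_diff_chain_at[OF y bump_derivs(1)] vector_diff_chain_at[OF y bump_derivs(2)]
    by (auto simp: o_def scaleR_conv_of_real)
  define f1 where "f1 x = cis (c * x) * (of_nat N * bump1 lo hi (y x)) + \<i> * of_real c * cis (c * x) * bump lo hi (y x)" for x
  define f2 where "f2 x = (cis (c * x) * (of_nat N * (of_nat N * bump2 lo hi (y x))) + \<i> * of_real c * cis (c * x) * (of_nat N * bump1 lo hi (y x)))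
    + (\<i> * of_real c * cis (c * x) * (of_nat N * bump1 lo hi (y x)) + - (of_real c)\<^sup>2 * cis (c * x) * bump lo hi (y x))" for x
  have "(dilated_bump lo hi N m i has_vector_derivative f1 x) (at x)" for x
    unfolding dilated_bump_def[abs_def] f1_def c_def[symmetric] y_def[symmetric]
    by (intro has_vector_derivative_mult cis_derivs b)
  moreover have "(f1 has_vector_derivative f2 x) (at x)" for x
    unfolding f1_def[abs_def] f2_def
    by (intro has_vector_derivative_add has_vector_derivative_mult has_vector_derivative_mult_right cis_derivs cis_second_deriv b)
  moreover have "continuous_on UNIV f2"
    unfolding f2_def bump_def bump1_def bump2_def y_def by (intro continuous_intros)
  moreover have "f1 (gap_left lo N i) = 0" "f1 (gap_left hi N i) = 0" if "N > 0"
  proof -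
    have "y (gap_left lo N i) = lo" "y (gap_left hi N i) = hi" using that by (auto simp: y_def)
    then show "f1 (gap_left lo N i) = 0" "f1 (gap_left hi N i) = 0" by (auto simp: f1_def bump_boundary)
  qed
  ultimately show thesis by (rule that)
qed

lemma dilated_bump_boundary:
  "N > 0 \<Longrightarrow> dilated_bump lo hi N m i (gap_left lo N i) = 0"
  "N > 0 \<Longrightarrow> dilated_bump lo hi N m i (gap_left hi N i) = 0"
  by (simp_all add: dilated_bump_def bump_boundary)

lemma continuous_on_trig_term: "continuous_on S (trig_term a b n)"
  unfolding trig_term_def[abs_def] by (intro continuous_intros)

lemma has_vector_derivative_of_real':
  "(f has_real_derivative D) (at x) \<Longrightarrow>
    ((\<lambda>x. complex_of_real (f x)) has_vector_derivative of_real D) (at x)"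
  by (intro has_vector_derivative_of_real) (simp add: has_real_derivative_iff_has_vector_derivative)

lemma trig_term_derivs:
  "((\<lambda>x. complex_of_real (trig_term a b n x)) has_vector_derivative
     of_real (2 * pi * real n * (b n * cos (2 * pi * real n * x) - a n * sin (2 * pi * real n * x)))) (at x)"
  "((\<lambda>x. complex_of_real (2 * pi * real n * (b n * cos (2 * pi * real n * x) - a n * sin (2 * pi * real n * x))))
     has_vector_derivative of_real (- (4 * pi\<^sup>2 * (real n)\<^sup>2) * trig_term a b n x)) (at x)"
  unfolding trig_term_def
proof -
  show "((\<lambda>x. complex_of_real (a n * cos (2 * pi * real n * x) + b n * sin (2 * pi * real n * x))) has_vector_derivative
     of_real (2 * pi * real n * (b n * cos (2 * pi * real n * x) - a n * sin (2 * pi * real n * x)))) (at x)"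
    by (rule has_vector_derivative_of_real')
       (auto intro!: derivative_eq_intros simp: algebra_simps)
  show "((\<lambda>x. complex_of_real (2 * pi * real n * (b n * cos (2 * pi * real n * x) - a n * sin (2 * pi * real n * x))))
     has_vector_derivative of_real (- (4 * pi\<^sup>2 * (real n)\<^sup>2) * (a n * cos (2 * pi * real n * x) + b n * sin (2 * pi * real n * x)))) (at x)"
    by (rule has_vector_derivative_of_real')
       (auto intro!: derivative_eq_intros simp: algebra_simps power2_eq_square)
qed

text \<open>On a gap the Riemann function is affine, so it is orthogonal to second derivatives of test functions
  supported there; integrating its series term by term returns the original series.\<close>

lemma sums_test_integral:
  fixes lo hi :: real and N m i :: nat
  assumes M: "\<And>n. \<bar>a n\<bar> + \<bar>b n\<bar> \<le> M" and N: "N > 0" and lohi: "lo < hi"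
    and zero: "\<And>x. x \<in> {gap_left lo N i<..<gap_left hi N i} \<Longrightarrow> (\<lambda>n. trig_term a b n x) sums 0"
  shows "(\<lambda>n. integral (gap lo hi N i) (\<lambda>x. of_real (trig_term a b n x) * dilated_bump lo hi N m i x)) sums 0"
proof -
  define l r where "l = gap_left lo N i" and "r = gap_left hi N i"
  have lr: "l < r" using lohi N by (simp add: l_def r_def divide_strict_right_mono)
  define f where "f = dilated_bump lo hi N m i"
  obtain f1 f2 where f: "\<And>x. (f has_vector_derivative f1 x) (at x)" "\<And>x. (f1 has_vector_derivative f2 x) (at x)"
    and f2: "continuous_on UNIV f2" and f1: "f1 l = 0" "f1 r = 0"
    using dilated_bump_derivs[of lo hi N m i] N unfolding f_def l_def r_def by metis
  have f0: "f l = 0" "f r = 0" unfolding f_def l_def r_def using N by (simp_all add: dilated_bump_boundary)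
  have cont_f2: "continuous_on {l..r} f2" using f2 continuous_on_subset by blast
  have cont_f: "continuous_on {l..r} f"
    by (intro continuous_at_imp_continuous_on ballI has_vector_derivative_continuous[OF f(1)])
  define T where "T n = integral {l..r} (\<lambda>x. of_real (trig_term a b n x) * f x)" for n
  have T: "((\<lambda>x. of_real (trig_term a b n x) * f x) has_integral T n) {l..r}" for n
    unfolding T_def
    by (intro integrable_integral integrable_continuous_interval continuous_intros continuous_on_trig_term cont_f)
  note green = has_integral_green[OF less_imp_le[OF lr] _ _ f f0 f1]
  define F where "F = riemann_fun a b"
  define g where "g n x = trig_term a b (Suc n) x / (4 * pi\<^sup>2 * (real (Suc n))\<^sup>2)" for n x
  have contF: "continuous_on {l..r} F" unfolding F_def by (rule continuous_on_riemann_fun[OF M])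
  obtain A B where AB: "\<And>x. x \<in> {l..r} \<Longrightarrow> F x = A + B * x"
  proof (rule schwarz_affine[OF lr contF])
    fix x assume "x \<in> {l<..<r}"
    then have "(\<lambda>n. trig_term a b n x) sums 0" using zero by (simp add: l_def r_def)
    then show "((\<lambda>h. (F (x + h) + F (x - h) - 2 * F x) / h\<^sup>2) \<longlongrightarrow> 0) (at_right 0)"
      unfolding F_def by (rule riemann_fun_second_derivative[OF M])
  qed (rule that)
  have int_F: "((\<lambda>x. of_real (F x) * f2 x) has_integral 0) {l..r}"
  proof -
    have "((\<lambda>x. complex_of_real (A + B * x) * f2 x - 0 * f x) has_integral 0) {l..r}"
    proof (rule green)
      show "((\<lambda>x. complex_of_real (A + B * x)) has_vector_derivative of_real B) (at x)" for x
        by (rule has_vector_derivative_of_real')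
           (auto intro!: derivative_eq_intros)
    qed (auto intro!: derivative_eq_intros)
    then show ?thesis
      by (rule has_integral_eq[rotated]) (simp add: AB)
  qed
  \<comment> \<open>The second derivative of the quadratic is the constant term of the series, so
    this integral is the pairing of index 0.\<close>
  have int_sq: "((\<lambda>x. of_real (a 0 * x\<^sup>2 / 2) * f2 x) has_integral T 0) {l..r}"
  proof -
    have "((\<lambda>x. complex_of_real (a 0 * x\<^sup>2 / 2) * f2 x - complex_of_real (a 0) * f x) has_integral 0) {l..r}"
    proof (rule green)
      show "((\<lambda>x. complex_of_real (a 0 * x\<^sup>2 / 2)) has_vector_derivative of_real (a 0 * x)) (at x)" for x
        by (rule has_vector_derivative_of_real')
           (auto intro!: derivative_eq_intros)
      show "((\<lambda>x. complex_of_real (a 0 * x)) has_vector_derivative of_real (a 0)) (at x)" for x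
        by (rule has_vector_derivative_of_real')
           (auto intro!: derivative_eq_intros)
    qed
    from has_integral_add[OF this T[of 0]] show ?thesis by (simp add: trig_term_0)
  qed
  have int_g: "((\<lambda>x. of_real (g n x) * f2 x) has_integral - T (Suc n)) {l..r}" for n
  proof -
    define c where "c = 4 * pi\<^sup>2 * (real (Suc n))\<^sup>2"
    have c: "c \<noteq> 0" by (simp add: c_def)
    have "((\<lambda>x. complex_of_real (trig_term a b (Suc n) x) * f2 x - complex_of_real (- (4 * pi\<^sup>2 * (real (Suc n))\<^sup>2) * trig_term a b (Suc n) x) * f x) has_integral 0) {l..r}"
      by (rule green) (rule trig_term_derivs)+
    from has_integral_diff[OF this has_integral_mult_right[OF T[of "Suc n"], of "of_real c"]]
    have "((\<lambda>x. complex_of_real (trig_term a b (Suc n) x) * f2 x) has_integral - (of_real c * T (Suc n))) {l..r}"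
      by (simp add: c_def mult.assoc)
    from has_integral_mult_right[OF this, of "of_real (1 / c)"]
    show ?thesis unfolding g_def c_def[symmetric] using c by simp
  qed
  \<comment> \<open>The given series is only assumed to converge pointwise; its twice integrated
    form converges uniformly, which allows integration term by term against
    \<open>f2\<close>.\<close>
  have ul: "uniform_limit {l..r} (\<lambda>K x. \<Sum>n<K. complex_of_real (g n x) * f2 x) (\<lambda>x. of_real (\<Sum>n. g n x) * f2 x) sequentially"
  proof -
    have "uniform_limit {l..r} (\<lambda>K x. complex_of_real (\<Sum>n<K. g n x)) (\<lambda>x. of_real (\<Sum>n. g n x)) sequentially"
      using uniform_limit_riemann_term[OF M, where S="{l..r}"] unfolding g_def uniform_limit_iff by (simp add: dist_of_real flip: of_real_sum)
    moreover have "uniform_limit {l..r} (\<lambda>K. f2) f2 sequentially" by (rule uniform_limit_const)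
    moreover have "bounded (f2 ` {l..r})"
      using compact_continuous_image[OF cont_f2] compact_imp_bounded by auto
    moreover have "bounded ((\<lambda>x. complex_of_real (\<Sum>n. g n x)) ` {l..r})"
    proof -
      have "continuous_on {l..r} (\<lambda>x. a 0 * x\<^sup>2 / 2 - F x)" by (intro continuous_intros contF) auto
      moreover have "a 0 * x\<^sup>2 / 2 - F x = (\<Sum>n. g n x)" for x by (simp add: F_def riemann_fun_def g_def)
      ultimately have "continuous_on {l..r} (\<lambda>x. complex_of_real (\<Sum>n. g n x))"
        by (simp add: continuous_on_of_real)
      from compact_continuous_image[OF this] show ?thesis using compact_imp_bounded by auto
    qed
    ultimately have "uniform_limit {l..r} (\<lambda>K x. complex_of_real (\<Sum>n<K. g n x) * f2 x) (\<lambda>x. of_real (\<Sum>n. g n x) * f2 x) sequentially"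
      by (intro uniform_lim_mult)
    then show ?thesis by (simp add: sum_distrib_right)
  qed
  have contg: "continuous_on {l..r} (\<lambda>x. \<Sum>n<K. complex_of_real (g n x) * f2 x)" for K
    unfolding g_def by (intro continuous_intros continuous_on_trig_term cont_f2) auto
  obtain I J where IJ: "\<And>K. ((\<lambda>x. \<Sum>n<K. complex_of_real (g n x) * f2 x) has_integral I K) {l..r}"
    "((\<lambda>x. of_real (\<Sum>n. g n x) * f2 x) has_integral J) {l..r}" "I \<longlonglongrightarrow> J"
    using uniform_limit_integral[OF ul contg sequentially_bot] by blast
  have lim: "(\<lambda>K. integral {l..r} (\<lambda>x. \<Sum>n<K. complex_of_real (g n x) * f2 x)) \<longlonglongrightarrow> integral {l..r} (\<lambda>x. of_real (\<Sum>n. g n x) * f2 x)"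
    unfolding integral_unique[OF IJ(1)] integral_unique[OF IJ(2)] by (rule IJ(3))
  have "integral {l..r} (\<lambda>x. \<Sum>n<K. complex_of_real (g n x) * f2 x) = (\<Sum>n<K. - T (Suc n))" for K
    by (intro integral_unique has_integral_sum int_g) auto
  moreover have "integral {l..r} (\<lambda>x. of_real (\<Sum>n. g n x) * f2 x) = T 0"
  proof (rule integral_unique)
    have "((\<lambda>x. of_real (a 0 * x\<^sup>2 / 2) * f2 x - of_real (F x) * f2 x) has_integral T 0 - 0) {l..r}"
      by (intro has_integral_diff int_sq int_F)
    moreover have "of_real (a 0 * x\<^sup>2 / 2) * f2 x - of_real (F x) * f2 x = of_real (\<Sum>n. g n x) * f2 x" for x
      by (simp add: F_def riemann_fun_def g_def algebra_simps)
    ultimately show "((\<lambda>x. of_real (\<Sum>n. g n x) * f2 x) has_integral T 0) {l..r}" by simp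
  qed
  \<comment> \<open>Index 0 sits on the right because it came from the quadratic part; moving it
    back gives a total of 0.\<close>
  ultimately have "(\<lambda>n. - T (Suc n)) sums T 0" using lim by (simp add: sums_def)
  then have "(\<lambda>n. T (Suc n)) sums - T 0" using sums_minus by fastforce
  then have "T sums (- T 0 + T 0)" by (rule sums_Suc)
  then show ?thesis by (simp add: T_def[abs_def] f_def l_def r_def)
qed

section \<open>Rajchman's theorem on H-sets\<close>

lemma sum_inverse_squares_le: "(\<Sum>j=1..L. 1 / (real j)\<^sup>2) \<le> 2"
proof -
  have "(\<Sum>j=1..Suc L. 1 / (real j)\<^sup>2) \<le> 2 - 1 / real (Suc L)" for L
  proof (induction L)
    case (Suc L)
    have "1 / (real (Suc (Suc L)))\<^sup>2 \<le> 1 / (real (Suc L) * real (Suc (Suc L)))"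
      by (intro divide_left_mono) (auto simp: power2_eq_square)
    also have "\<dots> = 1 / real (Suc L) - 1 / real (Suc (Suc L))" by (simp add: field_simps)
    finally show ?case using Suc by simp
  qed simp
  from this[of "L - 1"] show ?thesis
    by (cases L) (auto intro: order_trans)
qed

text \<open>All pairings of the series with a dilated test function add up to 0. Apart from index m,
  those that do not vanish have large indices, hence small coefficients, and weights of size 1/j^2;
  so the pairing of index m is arbitrarily small, and dividing by the nonzero mean of the bump kills
  the coefficient.\<close>

theorem H_set_imp_set_of_uniqueness:
  fixes E :: "real set" and lo hi :: real
  assumes E: "E \<subseteq> {0..1}" and lohi: "0 \<le> lo" "lo < hi" "hi \<le> 1"
    and H: "\<And>n0. \<exists>N\<ge>n0. N > 0 \<and> (\<forall>x\<in>E. frac (real N * x) \<notin> {lo<..<hi})"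
  shows "set_of_uniqueness E"
  unfolding set_of_uniqueness_def
proof (intro conjI allI impI E)
  fix a b' :: "nat \<Rightarrow> real"
  assume zero': "\<forall>x\<in>{0..1} - E. (\<lambda>n. a n * cos (2 * pi * real n * x) + b' n * sin (2 * pi * real n * x)) sums 0"
  \<comment> \<open>The value \<open>b' 0\<close> does not affect the series and is arbitrary;
    setting it to 0 makes the complex coefficient of index 0 real.\<close>
  define b where "b n = (if n = 0 then 0 else b' n)" for n
  have "a n * cos (2 * pi * real n * x) + b' n * sin (2 * pi * real n * x) = trig_term a b n x" for n x
    by (simp add: trig_term_def b_def)
  with zero' have zero: "(\<lambda>n. trig_term a b n x) sums 0" if "x \<in> {0..1}" "x \<notin> E" for x
    using that by simp
  have zero_off_E: "(\<lambda>n. trig_term a b n x) sums 0"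
    if N: "N > 0" "\<forall>x\<in>E. frac (real N * x) \<notin> {lo<..<hi}" and i: "i < N"
      and x: "x \<in> {gap_left lo N i<..<gap_left hi N i}" for N i x
  proof (rule zero)
    have x': "real i + lo < real N * x" "real N * x < real i + hi"
      using x N(1) by (auto simp: field_simps)
    then have "\<lfloor>real N * x\<rfloor> = int i" using lohi by (intro floor_unique) auto
    then have "frac (real N * x) \<in> {lo<..<hi}" using x' by (simp add: frac_def)
    then show "x \<notin> E" using N(2) by blast
    have "0 \<le> gap_left lo N i" using lohi by simp
    moreover have "gap_left hi N i \<le> 1" using lohi i N(1) by (simp add: divide_le_eq_1)
    ultimately show "x \<in> {0..1}" using x by auto
  qed
  obtain N1 where N1: "N1 > 0" "\<forall>x\<in>E. frac (real N1 * x) \<notin> {lo<..<hi}"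
    using H[of 0] by blast
  \<comment> \<open>The series vanishes on an open gap only, whereas Cantor-Lebesgue wants a closed
    interval; the middle third provides one.\<close>
  define lo' hi' where "lo' = (2 * lo + hi) / 3" and "hi' = (lo + 2 * hi) / 3"
  have "lo < lo'" "lo' < hi'" "hi' < hi" using lohi by (simp_all add: lo'_def hi'_def)
  then have gaps: "gap_left lo N1 0 < gap_left lo' N1 0" "gap_left lo' N1 0 < gap_left hi' N1 0"
      "gap_left hi' N1 0 < gap_left hi N1 0"
    using N1(1) by (auto intro!: divide_strict_right_mono)
  have "(\<lambda>n. (a n)\<^sup>2 + (b n)\<^sup>2) \<longlonglongrightarrow> 0"
  proof (rule cantor_lebesgue_interval)
    show "gap_left lo' N1 0 < gap_left hi' N1 0" by (rule gaps)
    fix x assume "x \<in> {gap_left lo' N1 0..gap_left hi' N1 0}"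
    with gaps have "x \<in> {gap_left lo N1 0<..<gap_left hi N1 0}" by auto
    then show "(\<lambda>n. trig_term a b n x) \<longlonglongrightarrow> 0"
      using zero_off_E[OF N1, of 0 x] N1(1) by (intro summable_LIMSEQ_zero sums_summable) auto
  qed
  then have lim: "(\<lambda>n. sqrt ((a n)\<^sup>2 + (b n)\<^sup>2)) \<longlonglongrightarrow> 0"
    using tendsto_real_sqrt by fastforce
  define \<rho> where "\<rho> n = sqrt ((a n)\<^sup>2 + (b n)\<^sup>2)" for n
  have \<rho>: "norm (Complex (a n) (b n)) = \<rho> n" "norm (Complex (a n) (- b n)) = \<rho> n" "0 \<le> \<rho> n" for n
    by (simp_all add: \<rho>_def cmod_def)
  obtain M where M: "\<And>n. \<bar>a n\<bar> + \<bar>b n\<bar> \<le> M"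
  proof -
    obtain K where K: "\<And>n. norm (\<rho> n) \<le> K"
      using convergent_imp_Bseq[OF convergentI[OF lim]] unfolding Bseq_def \<rho>_def by blast
    have "\<bar>a n\<bar> + \<bar>b n\<bar> \<le> 2 * K" for n
      using K[of n] \<rho>(1,3)[of n] abs_Re_le_cmod[of "Complex (a n) (b n)"] abs_Im_le_cmod[of "Complex (a n) (b n)"]
      by simp
    then show thesis by (rule that)
  qed
  obtain C where C: "\<And>\<xi>. \<xi> \<noteq> 0 \<Longrightarrow> norm (bump_hat lo hi \<xi>) \<le> C / \<xi>\<^sup>2"
    using bump_hat_decay[OF lohi(2)] by blast
  have C0: "C \<ge> 0" using order_trans[OF norm_ge_zero C[of 1]] by simp
  have main: "Complex (a m) (- b m) = 0" for m
  proof -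
    \<comment> \<open>For m = 0 the two exponential halves of the term fall on the same frequency
      and add up; otherwise only one of them survives.\<close>
    define w where "w = (if m = 0 then 1 else 1/2 :: real)"
    have "norm (Complex (a m) (- b m) * bump_hat lo hi 0) * w \<le> \<epsilon>" if \<epsilon>: "\<epsilon> > 0" for \<epsilon>
    proof -
      \<comment> \<open>The classes of m and -m contribute at most C e' each; the summand 1 guards
        against C = 0.\<close>
      define e' where "e' = \<epsilon> / (2 * C + 1)"
      have e': "e' > 0" using \<epsilon> C0 by (simp add: e'_def)
      obtain n0 where n0: "\<And>n. n \<ge> n0 \<Longrightarrow> \<rho> n \<le> e'"
        using lim e' unfolding LIMSEQ_iff \<rho>_def[symmetric] by (metis abs_le_D1 diff_zero less_imp_le real_norm_def)
      \<comment> \<open>N is too large to divide 2m unless m = 0, and every other index congruent to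
        m or -m modulo N is at least N - m, hence beyond \<open>n0\<close>.\<close>
      obtain N where N: "N \<ge> n0 + 2 * m + 1" "N > 0" "\<forall>x\<in>E. frac (real N * x) \<notin> {lo<..<hi}"
        using H[of "n0 + 2 * m + 1"] by blast
      define T where "T = test_pairing a b lo hi N m"
      have T_eq: "T n = (Complex (a n) (- b n) * (if int N dvd int n - int m then bump_hat lo hi ((real n - real m) / real N) else 0)
          + Complex (a n) (b n) * (if int N dvd int n + int m then bump_hat lo hi (- (real n + real m) / real N) else 0)) / 2" for n
        unfolding T_def by (rule test_pairing_eq[OF N(2) lohi(2)])
      have "T sums (\<Sum>i<N. 0)"
        unfolding T_def test_pairing_def[abs_def]
        by (intro sums_sum sums_test_integral[OF M N(2) lohi(2)] zero_off_E[OF N(2,3)]) auto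
      then have T0: "T sums 0" by simp
      have Tm: "norm (T m) = norm (Complex (a m) (- b m) * bump_hat lo hi 0) * w"
      proof (cases "m = 0")
        case True
        then show ?thesis by (simp add: T_eq w_def b_def mult.commute)
      next
        case False
        have "\<not> int N dvd int m + int m" using N(1) False by (auto dest!: zdvd_imp_le)
        then show ?thesis using False by (simp add: T_eq w_def norm_mult norm_divide)
      qed
      have bound: "norm (\<Sum>n\<in>{..<L} - {m}. T n) \<le> \<epsilon>" for L
      proof -
        \<comment> \<open>These sets contain all indices below L, other than m, that are congruent
          to m or to -m modulo N. On them the scaled frequencies (n - m)/N and (n + m)/N are exactly
          the integers j \<ge> 1.\<close>
        define P where "P = (\<lambda>j. m + j * N) ` {1..L}"
        define P' where "P' = (\<lambda>j. j * N - m) ` {1..L}"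
        have injP: "inj_on (\<lambda>j. m + j * N) {1..L}" using N(2) by (auto intro!: inj_onI)
        have mN: "m \<le> j * N" if "1 \<le> j" for j
        proof -
          have "1 * N \<le> j * N" using that by (rule mult_le_mono1)
          then show ?thesis using N(1) by linarith
        qed
        have injP': "inj_on (\<lambda>j. j * N - m) {1..L}"
        proof (rule inj_onI)
          fix j j' assume *: "j \<in> {1..L}" "j' \<in> {1..L}" "j * N - m = j' * N - m"
          have "m \<le> j * N" "m \<le> j' * N" using * by (auto intro: mN)
          with * have "j * N = j' * N" by linarith
          then show "j = j'" using N(2) by simp
        qed
        define U where "U n = (if n \<in> P then e' / 2 * (C / ((real n - real m) / real N)\<^sup>2) else 0)" for n
        define U' where "U' n = (if n \<in> P' then e' / 2 * (C / ((real n + real m) / real N)\<^sup>2) else 0)" for n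
        have T_le: "norm (T n) \<le> U n + U' n" if n: "n \<in> {..<L} - {m}" for n
        proof -
          have first: "norm (Complex (a n) (- b n) * (if int N dvd int n - int m then bump_hat lo hi ((real n - real m) / real N) else 0)) / 2 \<le> U n"
          proof (cases "int N dvd int n - int m")
            case True
            then obtain k where k: "int n - int m = int N * k" by (auto elim: dvdE)
            have "k > 0"
            proof (rule ccontr)
              assume "\<not> k > 0"
              moreover have "k \<noteq> 0" using k n by auto
              ultimately have "int N * k \<le> int N * (- 1)" by (intro mult_left_mono) auto
              then show False using k N(1) by linarith
            qed
            define j where "j = nat k"
            have "int n = int (m + j * N)" using k \<open>k > 0\<close> by (simp add: j_def mult.commute)
            then have j: "n = m + j * N" by (simp only: of_nat_eq_iff)
            have "j \<ge> 1" using \<open>k > 0\<close> by (simp add: j_def)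
            have "j \<le> j * N" "n < L" using N(2) n by simp_all
            with j have "j \<le> L" by linarith
            then have "n \<in> P" using j \<open>j \<ge> 1\<close> unfolding P_def by (intro image_eqI[of _ _ j]) auto
            have "N \<le> j * N" using \<open>j \<ge> 1\<close> mult_le_mono[of 1 j N N] by simp
            then have "n \<ge> n0" using j N(1) by linarith
            have "norm (bump_hat lo hi ((real n - real m) / real N)) \<le> C / ((real n - real m) / real N)\<^sup>2"
              using n N(2) by (intro C) auto
            then have "\<rho> n * norm (bump_hat lo hi ((real n - real m) / real N)) \<le> e' * (C / ((real n - real m) / real N)\<^sup>2)"
              using n0[OF \<open>n \<ge> n0\<close>] \<rho>(3) by (intro mult_mono) (auto intro: less_imp_le[OF e'])
            then show ?thesis using True \<open>n \<in> P\<close> by (simp add: U_def norm_mult \<rho>)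
          next
            case False
            then show ?thesis using C0 e' by (simp add: U_def)
          qed
          have second: "norm (Complex (a n) (b n) * (if int N dvd int n + int m then bump_hat lo hi (- (real n + real m) / real N) else 0)) / 2 \<le> U' n"
          proof (cases "int N dvd int n + int m")
            case True
            then have "N dvd n + m" by (metis of_nat_add of_nat_dvd_iff)
            then obtain j where j: "n + m = N * j" by (auto elim: dvdE)
            have "j \<ge> 1" using j n by (cases j) auto
            have "n = j * N - m" using j by (simp add: mult.commute)
            moreover have "j \<le> L"
            proof (rule ccontr)
              assume "\<not> j \<le> L"
              then have "N * (L + 1) \<le> N * j" by (intro mult_le_mono) auto
              moreover have "L + N \<le> N * (L + 1)" using N(2) mult_le_mono[of 1 N L L] by simp
              moreover have "n < L" using n by simp
              ultimately show False using j N(1) by linarith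
            qed
            ultimately have "n \<in> P'" using \<open>j \<ge> 1\<close> unfolding P'_def by (intro image_eqI[of _ _ j]) auto
            have "N \<le> N * j" using \<open>j \<ge> 1\<close> mult_le_mono[of N N 1 j] by simp
            then have "n \<ge> n0" using j N(1) by linarith
            have "norm (bump_hat lo hi (- (real n + real m) / real N)) \<le> C / (- (real n + real m) / real N)\<^sup>2"
              using n N(2) by (intro C) auto
            then have "norm (bump_hat lo hi (- (real n + real m) / real N)) \<le> C / ((real n + real m) / real N)\<^sup>2"
              by (simp only: minus_divide_left[symmetric] power2_minus)
            then have "\<rho> n * norm (bump_hat lo hi (- (real n + real m) / real N)) \<le> e' * (C / ((real n + real m) / real N)\<^sup>2)"
              using n0[OF \<open>n \<ge> n0\<close>] \<rho>(3) by (intro mult_mono) (auto intro: less_imp_le[OF e'])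
            then show ?thesis using True \<open>n \<in> P'\<close> by (simp add: U'_def norm_mult \<rho>)
          next
            case False
            then show ?thesis using C0 e' by (simp add: U'_def)
          qed
          have "norm (T n) \<le> norm (Complex (a n) (- b n) * (if int N dvd int n - int m then bump_hat lo hi ((real n - real m) / real N) else 0)) / 2
              + norm (Complex (a n) (b n) * (if int N dvd int n + int m then bump_hat lo hi (- (real n + real m) / real N) else 0)) / 2"
            unfolding T_eq norm_divide add_divide_distrib[symmetric]
            by (simp only: norm_numeral) (intro divide_right_mono norm_triangle_ineq; simp)
          then show ?thesis using first second by linarith
        qed
        have sumU: "(\<Sum>n\<in>{..<L} - {m}. U n) \<le> e' * C"
        proof -
          have "(\<Sum>n\<in>{..<L} - {m}. U n) \<le> (\<Sum>n\<in>P. e' / 2 * (C / ((real n - real m) / real N)\<^sup>2))"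
            unfolding U_def using C0 e'
            by (subst sum.inter_restrict[symmetric]) (auto intro!: sum_mono2 simp: P_def)
          also have "\<dots> = (\<Sum>j=1..L. e' / 2 * (C / (real j)\<^sup>2))"
            unfolding P_def using injP N(2) by (subst sum.reindex) auto
          also have "\<dots> = e' / 2 * C * (\<Sum>j=1..L. 1 / (real j)\<^sup>2)"
            by (simp add: sum_distrib_left)
          also have "\<dots> \<le> e' / 2 * C * 2"
            using C0 e' by (intro mult_left_mono sum_inverse_squares_le) auto
          finally show ?thesis by simp
        qed
        have sumU': "(\<Sum>n\<in>{..<L} - {m}. U' n) \<le> e' * C"
        proof -
          have "(\<Sum>n\<in>{..<L} - {m}. U' n) \<le> (\<Sum>n\<in>P'. e' / 2 * (C / ((real n + real m) / real N)\<^sup>2))"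
            unfolding U'_def using C0 e'
            by (subst sum.inter_restrict[symmetric]) (auto intro!: sum_mono2 simp: P'_def)
          also have "\<dots> = (\<Sum>j=1..L. e' / 2 * (C / (real j)\<^sup>2))"
            unfolding P'_def
          proof (subst sum.reindex[OF injP'], intro sum.cong refl)
            fix j assume "j \<in> {1..L}"
            then have "m \<le> j * N" by (intro mN) auto
            then have "(real (j * N - m) + real m) / real N = real j" using N(2) by (simp add: of_nat_diff)
            then show "((\<lambda>n. e' / 2 * (C / ((real n + real m) / real N)\<^sup>2)) \<circ> (\<lambda>j. j * N - m)) j = e' / 2 * (C / (real j)\<^sup>2)"
              by simp
          qed
          also have "\<dots> = e' / 2 * C * (\<Sum>j=1..L. 1 / (real j)\<^sup>2)"
            by (simp add: sum_distrib_left)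
          also have "\<dots> \<le> e' / 2 * C * 2"
            using C0 e' by (intro mult_left_mono sum_inverse_squares_le) auto
          finally show ?thesis by simp
        qed
        have "norm (\<Sum>n\<in>{..<L} - {m}. T n) \<le> (\<Sum>n\<in>{..<L} - {m}. U n + U' n)"
          by (rule sum_norm_le) (rule T_le)
        also have "\<dots> \<le> e' * C + e' * C" unfolding sum.distrib by (intro add_mono sumU sumU')
        also have "\<dots> \<le> e' * (2 * C + 1)" using e' by (simp add: algebra_simps)
        also have "\<dots> = \<epsilon>" using C0 by (simp add: e'_def)
        finally show ?thesis .
      qed
      have "(\<lambda>L. norm ((\<Sum>n<L. T n) - T m)) \<longlonglongrightarrow> norm (0 - T m)"
        using T0 unfolding sums_def by (intro tendsto_intros)
      moreover have "\<forall>\<^sub>F L in sequentially. norm ((\<Sum>n<L. T n) - T m) \<le> \<epsilon>"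
        using eventually_gt_at_top[of m]
      proof eventually_elim
        case (elim L)
        then have "(\<Sum>n<L. T n) - T m = (\<Sum>n\<in>{..<L} - {m}. T n)" by (subst sum_diff1) auto
        then show ?case using bound[of L] by simp
      qed
      ultimately have "norm (0 - T m) \<le> \<epsilon>" by (rule tendsto_upperbound) simp
      then show ?thesis using Tm by simp
    qed
    then have "norm (Complex (a m) (- b m) * bump_hat lo hi 0) * w \<le> 0" by (rule field_le_epsilon[where y=0, simplified])
    then have "norm (Complex (a m) (- b m) * bump_hat lo hi 0) = 0"
      by (simp add: w_def split: if_splits)
    then show ?thesis using bump_hat_0[OF lohi(2)] by simp
  qed
  show "a n = 0" for n using main[of n] by (simp add: complex_eq_iff)
  show "b' n = 0" if "n \<ge> 1" for n using main[of n] that by (simp add: complex_eq_iff b_def)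
qed

section \<open>The Moran set\<close>

context moran
begin

lemma modulus_dvd_mono: "m \<le> n \<Longrightarrow> modulus q d m dvd modulus q d n"
  by (induction n rule: dec_induct) (auto simp: modulus_Suc)

context
  fixes \<epsilon> :: "nat \<Rightarrow> nat \<Rightarrow> real"
  assumes \<epsilon>: "\<And>s j. \<epsilon> s j \<in> {0, 1}"
begin

abbreviation block_sum :: "nat \<Rightarrow> real" where
  "block_sum s \<equiv> (\<Sum>j<ell d (Suc s). \<epsilon> s j * contraction q d s j)"

lemma block_sum_bounds: "0 \<le> block_sum s" "block_sum s \<le> block_width s"
proof -
  have e: "0 \<le> \<epsilon> s j" "\<epsilon> s j \<le> 1" for j using \<epsilon>[of s j] by auto
  show "0 \<le> block_sum s"
    by (intro sum_nonneg mult_nonneg_nonneg e contraction_nonneg)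
  have "block_sum s \<le> (\<Sum>j<ell d (Suc s). contraction q d s j)"
    using e contraction_nonneg by (intro sum_mono) (simp add: mult_left_le_one_le)
  also have "\<dots> \<le> block_width s" by (rule sum_contraction_le_block_width)
  finally show "block_sum s \<le> block_width s" .
qed

lemma summable_block_sum: "summable block_sum"
proof (rule summable_comparison_test'[where N=0])
  show "summable block_width" using sums_summable[OF block_width_sums[of 0]] by simp
qed (use block_sum_bounds in auto)

lemma block_sum_tail: "0 \<le> (\<Sum>i. block_sum (i + s))" "(\<Sum>i. block_sum (i + s)) \<le> 1 / (6 * modulus q d s)"
proof -
  have sm: "summable (\<lambda>i. block_sum (i + s))" using summable_block_sum by (rule summable_ignore_initial_segment)
  show "0 \<le> (\<Sum>i. block_sum (i + s))" using sm block_sum_bounds(1) by (intro suminf_nonneg)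
  have "(\<Sum>i. block_sum (i + s)) \<le> (\<Sum>i. block_width (i + s))"
    using sm sums_summable[OF block_width_sums[of s]] block_sum_bounds(2) by (intro suminf_le)
  then show "(\<Sum>i. block_sum (i + s)) \<le> 1 / (6 * modulus q d s)"
    using sums_unique[OF block_width_sums[of s]] by simp
qed

text \<open>Every denominator occurring in the first s blocks divides the modulus.\<close>

lemma modulus_times_partial_sum_int: "modulus q d s * (\<Sum>i<s. block_sum i) \<in> \<int>"
proof -
  have "modulus q d s * (\<epsilon> i j * contraction q d i j) \<in> \<int>" if "i < s" "j < ell d (Suc i)" for i j
  proof -
    have "q (Suc i) ^ Suc j dvd q (Suc i) ^ ell d (Suc i)"
      using that by (intro le_imp_power_dvd) auto
    then have "modulus q d i * q (Suc i) ^ Suc j dvd modulus q d (Suc i)"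
      unfolding modulus_Suc by (intro mult_dvd_mono) auto
    also have "\<dots> dvd modulus q d s" using that by (intro modulus_dvd_mono) auto
    finally obtain k where k: "modulus q d s = modulus q d i * q (Suc i) ^ Suc j * k" by (auto elim: dvdE)
    have "real (modulus q d s) * contraction q d i j = real k"
      unfolding k contraction_def using modulus_pos[of i] q_pos[of i] by simp
    then have "real (modulus q d s) * (\<epsilon> i j * contraction q d i j) = \<epsilon> i j * real k" by simp
    then show ?thesis using \<epsilon>[of i j] by auto
  qed
  then show ?thesis
    unfolding sum_distrib_left by (intro Ints_sum) auto
qed

text \<open>After multiplication by the modulus, the first s blocks become an integer and the tail
  lies in [0, 1/6], so the tail is the fractional part.\<close>

lemma frac_modulus_times: "frac (real (modulus q d s) * (\<Sum>i. block_sum i)) \<le> 1 / 6"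
proof -
  define r where "r = real (modulus q d s) * (\<Sum>i. block_sum (i + s))"
  have r: "0 \<le> r" "r \<le> 1 / 6"
    using block_sum_tail[of s] modulus_pos[of s] by (auto simp: r_def field_simps)
  have "real (modulus q d s) * (\<Sum>i. block_sum i) = real (modulus q d s) * (\<Sum>i<s. block_sum i) + r"
    unfolding r_def suminf_split_initial_segment[OF summable_block_sum, of s] by (simp add: distrib_left)
  moreover obtain z where "real (modulus q d s) * (\<Sum>i<s. block_sum i) = of_int z"
    using modulus_times_partial_sum_int[of s] by (auto elim: Ints_cases)
  ultimately have "frac (real (modulus q d s) * (\<Sum>i. block_sum i)) = frac (r + of_int z)" by (simp add: add.commute)
  also have "\<dots> = r" using r by (simp add: frac_eq)
  finally show ?thesis using r by simp
qed

end

lemma moran_set_is_H_set: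
  assumes "x \<in> moran_set q d"
  shows "x \<in> {0..1}" "frac (real (modulus q d s) * x) \<le> 1 / 6"
proof -
  obtain \<epsilon> where x: "x = (\<Sum>s. \<Sum>j<ell d (Suc s). \<epsilon> s j * contraction q d s j)" and \<epsilon>: "\<And>s j. \<epsilon> s j \<in> {0, 1::real}"
    using assms unfolding moran_set_def by blast
  show "x \<in> {0..1}" using block_sum_tail[where \<epsilon>=\<epsilon> and s=0, OF \<epsilon>] by (simp add: x)
  show "frac (real (modulus q d s) * x) \<le> 1 / 6" unfolding x by (rule frac_modulus_times) (rule \<epsilon>)
qed

text \<open>The moduli serve as the dilation factors, and the avoided interval (1/6, 1) is
  everything that the tail bound leaves free.\<close>

lemma set_of_uniqueness_moran_set: "set_of_uniqueness (moran_set q d)"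
proof (rule H_set_imp_set_of_uniqueness[of _ "1/6" 1])
  show "moran_set q d \<subseteq> {0..1}" using moran_set_is_H_set(1) by blast
  fix n0
  show "\<exists>N\<ge>n0. N > 0 \<and> (\<forall>x\<in>moran_set q d. frac (real N * x) \<notin> {1/6<..<1})"
  proof (intro exI[of _ "modulus q d n0"] conjI ballI)
    have "n0 \<le> 7 ^ n0" by (intro less_imp_le power_gt_expt) simp
    then show "n0 \<le> modulus q d n0" using modulus_ge[of n0] by linarith
  qed (use moran_set_is_H_set(2) modulus_pos in \<open>auto simp: not_less\<close>)
qed auto

end

theorem theorem1p7:
  fixes q :: "nat \<Rightarrow> nat" and d :: nat and \<omega> :: "nat \<Rightarrow> real"
  assumes "strict_mono_on {1..} q"
    and "\<And>n. n \<ge> 1 \<Longrightarrow> prime (q n)"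
    and "q 1 \<ge> 7"
    and "d \<ge> 1"
    and "(\<lambda>n. real (q n)) \<in> O(\<lambda>n. real n ^ d)"
    and "0 < (INF n\<in>{1..}. ereal (\<omega> n))"
    and "(INF n\<in>{1..}. ereal (\<omega> n)) \<le> (SUP n\<in>{1..}. ereal (\<omega> n))"
    and "(SUP n\<in>{1..}. ereal (\<omega> n)) < 1"
  shows "(\<forall>b\<ge>2. DEL_criterion (cantor_moran_measure q d \<omega>) b)
    \<and> pointwise_absolutely_normal (cantor_moran_measure q d \<omega>)
    \<and> set_of_uniqueness (moran_set q d)"
proof -
  interpret moran q d by (rule moran.intro[OF assms(1-4)])
  obtain z1 where z1: "0 < ereal z1" "ereal z1 < (INF n\<in>{1..}. ereal (\<omega> n))"
    using ereal_dense2[OF assms(6)] by blast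
  obtain z2 where z2: "(SUP n\<in>{1..}. ereal (\<omega> n)) < ereal z2" "ereal z2 < 1"
    using ereal_dense2[OF assms(8)] by blast
  \<comment> \<open>The strict bounds on infimum and supremum leave room for real numbers in
    between, which give one constant below both weights of every factor.\<close>
  define \<delta> where "\<delta> = min z1 (1 - z2)"
  have \<delta>: "\<delta> > 0" using z1(1) z2(2) by (simp add: \<delta>_def one_ereal_def)
  have \<omega>: "\<delta> \<le> \<omega> n" "\<omega> n \<le> 1 - \<delta>" if "n \<ge> 1" for n
  proof -
    have "ereal z1 < ereal (\<omega> n)" 
      using less_le_trans[OF z1(2) INF_lower[of n "{1..}" "\<lambda>n. ereal (\<omega> n)"]] that by simp
    then show "\<delta> \<le> \<omega> n" by (simp add: \<delta>_def)
    have "ereal (\<omega> n) < ereal z2" 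
      using le_less_trans[OF SUP_upper[of n "{1..}" "\<lambda>n. ereal (\<omega> n)"] z2(1)] that by simp
    then show "\<omega> n \<le> 1 - \<delta>" by (simp add: \<delta>_def min_def)
  qed
  \<comment> \<open>Forced by \<delta> \<le> \<omega> 1 \<le> 1 - \<delta>; it keeps \<kappa> =
    \<delta>^2 at most 1/2, so the digit factors are nonnegative.\<close>
  have "\<delta> \<le> 1 / 2" using \<omega>[of 1] by simp
  then have "\<delta> * \<delta> \<le> 1 / 2 * 1" using \<delta> by (intro mult_mono) auto
  then have \<kappa>: "0 < \<delta>\<^sup>2" "\<delta>\<^sup>2 \<le> 1 / 2" using \<delta> by (auto simp: power2_eq_square)
  have bound: "norm (fourier_transform (cantor_moran_measure q d \<omega>) \<xi>) \<le> block_bound (\<delta>\<^sup>2) s \<xi>" for s \<xi>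
    unfolding block_bound_def digit_factor_def by (rule norm_fourier_transform_le[OF \<delta> \<omega>])
  have DEL: "DEL_criterion (cantor_moran_measure q d \<omega>) b" if "b \<ge> 2" for b
    by (rule DEL_criterion_of_bound[OF assms(5) \<kappa> bound that])
  \<comment> \<open>Stated with the condition on b inside, so that the countable intersection can
    run over all natural b.\<close>
  have "AE x in cantor_moran_measure q d \<omega>. b \<ge> 2 \<longrightarrow> normal_in_base b x" for b
  proof (cases "b \<ge> 2")
    case True
    then show ?thesis
      using DEL_imp_AE_normal[OF real_distribution_cantor_moran[OF \<delta> \<omega>] DEL[OF True]] by simp
  qed simp
  then have "pointwise_absolutely_normal (cantor_moran_measure q d \<omega>)"
    unfolding pointwise_absolutely_normal_def absolutely_normal_def by (simp add: AE_all_countable)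
  then show ?thesis using DEL set_of_uniqueness_moran_set by blast
qed

end
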